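(* Let $(M,\mathcal D,\langle\cdot,\cdot\rangle)$ be an equiregular sub-Riemannian manifold of dimension $n$ and step $m$, with $\operatorname{rank}\mathcal D=k$. Let $X_1,\dots,X_n$ be a local adapted frame, with structure constants $c_{ij}^l$ and matrices $B_1,\dots,B_m$ defined from its adapted structure constants. Let $\Delta$ be the canonical sub-Laplacian, i.e. the one associated with Popp's volume. Then, on the domain of the frame, $$\Delta=\sum_{i=1}^k\left[X_i^2-\left(\frac12\sum_{j=1}^m\operatorname{Tr}\big(B_j^{-1}X_i(B_j)\big)+\sum_{l=1}^n c_{il}^l\right)X_i\right],$$ where $X_i(B_j)$ denotes the matrix obtained by differentiating the entries of $B_j$ along $X_i$.
   Context: Sub-Riemannian manifold: a triple $(M,\mathcal D,\langle\cdot,\cdot\rangle)$ where $M$ is a connected orientable smooth manifold of dimension $n\ge 3$, $\mathcal D\subset TM$ is a smooth distribution of constant rank $k<n$, and $\langle\cdot,\cdot\rangle_q$ is an inner product on $\mathcal D_q$ depending smoothly on $q$. $\mathcal D$ is assumed bracket-generating: iterated Lie brackets of smooth sections of $\mathcal D$ span $T_qM$ at every $q$. Flag: $\mathcal D^0_q=\{0\}$, $\mathcal D^1=\mathcal D$, $\mathcal D^{i+1}_q=\mathcal D^i_q+[\mathcal D^i,\mathcal D]_q$. $\mathcal D$ is equiregular if $k_i:=\dim\mathcal D^i_q$ does not depend on $q$ for every $i$ (with $k_0=0$, $k_1=k$); the step is the minimal $m$ with $\mathcal D^m=TM$. Then each $\mathcal D^i$ is a distribution. Popp's volume: for $q\in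 M$ and $1\le i\le m$, the linear map $$\pi_i:\otimes^i\mathcal D_q\to\mathcal D^i_q/\mathcal D^{i-1}_q,\qquad \pi_i(v_1\otimes\cdots\otimes v_i)=[V_1,[V_2,\dots,[V_{i-1},V_i]]]_q \bmod \mathcal D^{i-1}_q,$$ where $V_j$ is any local section of $\mathcal D$ with $V_j(q)=v_j$, is well defined and surjective ($\pi_1$ is the identity). Give $\otimes^i\mathcal D_q$ the inner product induced by that of $\mathcal D_q$, and $\mathcal D^i_q/\mathcal D^{i-1}_q$ the inner product whose norm is $\|Y\|=\min\{\|Z\| : \pi_i(Z)=Y\}$. Let $\mathrm{gr}_q(\mathcal D)=\bigoplus_{i=1}^m\mathcal D^i_q/\mathcal D^{i-1}_q$ be the orthogonal direct sum, and let $\mu_q\in\wedge^n\mathrm{gr}_q(\mathcal D)^*$ be the wedge of the elements of an orthonormal dual basis (defined up to sign). Let $\theta_q:\wedge^nT_qM\to\wedge^n\mathrm{gr}_q(\mathcal D)$ be the canonical isomorphism sending $v_1\wedge\cdots\wedge v_n$ to $\widehat\theta(v_1)\wedge\cdots\wedge\widehat\theta(v_n)$, where $v_1,\dots,v_n$ is any basis of $T_qM$ such that $v_1,\dots,v_{k_i}$ is a basis of $\mathcal D^i_q$ for all $i$, and $\widehat\theta(v_l)$ is the class of $v_l$ in $\mathcal D^{i}_q/\mathcal D^{i-1}_q$ for $k_{i-1}<l\le k_{i}$ ($\theta_q$ does not depend on the basis). Popp's volume is the $n$-form $\mathcal P$ with $\mathcal P_q=\mu_q\circ\theta_q$, the signs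 being chosen consistently using an orientation of $M$. Adapted frame: a local frame $X_1,\dots,X_n$ of $TM$ such that $X_1,\dots,X_{k_i}$ is a local frame for $\mathcal D^i$ for each $i$, and $X_1,\dots,X_k$ are orthonormal. Structure constants: the smooth functions $c_{ij}^l$ with $[X_i,X_j]=\sum_{l=1}^nc_{ij}^lX_l$, $1\le i,j\le n$. Adapted structure constants: for $j=2,\dots,m$ and $1\le i_1,\dots,i_j\le k$, the smooth functions $b^l_{i_1\dots i_j}$ with $$[X_{i_1},[X_{i_2},\dots,[X_{i_{j-1}},X_{i_j}]]]=\sum_{l=k_{j-1}+1}^{k_j}b^l_{i_1\dots i_j}X_l \bmod \mathcal D^{j-1}.$$ $B_1$ is the $k\times k$ identity matrix, and for $2\le j\le m$, $B_j$ is the square matrix of size $k_j-k_{j-1}$ with entries $[B_j]^{hl}=\sum_{i_1,\dots,i_j=1}^k b^h_{i_1\dots i_j}b^l_{i_1\dots i_j}$, $k_{j-1}<h,l\le k_j$; each $B_j$ is positive definite. Sub-Laplacian: the horizontal gradient $\nabla f$ of $f\in C^\infty(M)$ is the unique section of $\mathcal D$ with $\langle\nabla f,X\rangle=X(f)$ for all sections $X$ of $\mathcal D$. The divergence of a vector field $X$ with respect to Popp's volume is the function $\operatorname{div}X$ with $\mathcal L_X\mathcal P=(\operatorname{div}X)\,\mathcal P$, where $\mathcal L_X$ is the Lie derivative (it does not depend on the sign of $\mathcal P$). The canonical sub-Laplacian is $\Delta f=\operatorname{div}(\nabla f)$. *)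

theory Defs
  imports
    "HOL-Analysis.Derivative"
    "HOL-Library.Poly_Mapping"
    "HOL-Library.Set_Algebras"
    "Jordan_Normal_Form.Determinant"
    "Jordan_Normal_Form.Gauss_Jordan_Elimination"
begin

section \<open>Smooth manifolds\<close>

fun Ck_on :: "nat \<Rightarrow> 'e::euclidean_space set \<Rightarrow> ('e \<Rightarrow> 'b::real_normed_vector) \<Rightarrow> bool" where
  "Ck_on 0 S f \<longleftrightarrow> continuous_on S f"
| "Ck_on (Suc r) S f \<longleftrightarrow>
     f differentiable_on S \<and> (\<forall>v. Ck_on r S (\<lambda>x. frechet_derivative f (at x) v))"

text \<open>Only used for open \<open>S\<close>.\<close>

definition Cinf_on :: "'e::euclidean_space set \<Rightarrow> ('e \<Rightarrow> 'b::real_normed_vector) \<Rightarrow> bool" where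
  "Cinf_on S f \<longleftrightarrow> (\<forall>r. Ck_on r S f)"

text \<open>The manifold is the whole type \<open>'a\<close>; a chart is a pair \<open>(U, \<phi>)\<close> of its domain and
  its coordinate map, whose values outside \<open>U\<close> are irrelevant.\<close>

type_synonym ('a, 'e) atlas = "('a set \<times> ('a \<Rightarrow> 'e)) set"

definition smooth_atlas ::
  "('a::{t2_space, second_countable_topology}, 'e::euclidean_space) atlas \<Rightarrow> bool" where
  "smooth_atlas A \<longleftrightarrow>
     (\<Union>(U, \<phi>)\<in>A. U) = UNIV \<and>
     (\<forall>(U, \<phi>)\<in>A. open U \<and> open (\<phi> ` U) \<and> (\<exists>\<psi>. homeomorphism U (\<phi> ` U) \<phi> \<psi>)) \<and>
     (\<forall>(U, \<phi>)\<in>A. \<forall>(V, \<psi>)\<in>A. Cinf_on (\<phi> ` (U \<inter> V)) (\<psi> \<circ> inv_into U \<phi>))"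

definition smooth_on ::
  "('a::topological_space, 'e::euclidean_space) atlas \<Rightarrow> 'a set \<Rightarrow> ('a \<Rightarrow> real) \<Rightarrow> bool" where
  "smooth_on A W f \<longleftrightarrow> (\<forall>(U, \<phi>)\<in>A. Cinf_on (\<phi> ` (U \<inter> W)) (f \<circ> inv_into U \<phi>))"

definition smooth_at ::
  "('a::topological_space, 'e::euclidean_space) atlas \<Rightarrow> 'a \<Rightarrow> ('a \<Rightarrow> real) \<Rightarrow> bool" where
  "smooth_at A q f \<longleftrightarrow> (\<exists>W. open W \<and> q \<in> W \<and> smooth_on A W f)"


section \<open>Tangent vectors and vector fields\<close>

text \<open>Arbitrary functionals on real functions, as a real vector space. The tangent vectors are
  those functionals that are derivations.\<close>

typedef 'a functional = "UNIV :: (('a \<Rightarrow> real) \<Rightarrow> real) set"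
  morphisms act Functional
  by simp

setup_lifting type_definition_functional

instantiation functional :: (type) real_vector
begin

lift_definition zero_functional :: "'a functional" is "\<lambda>f. 0" .
lift_definition plus_functional :: "'a functional \<Rightarrow> 'a functional \<Rightarrow> 'a functional"
  is "\<lambda>v w f. v f + w f" .
lift_definition uminus_functional :: "'a functional \<Rightarrow> 'a functional" is "\<lambda>v f. - v f" .
lift_definition minus_functional :: "'a functional \<Rightarrow> 'a functional \<Rightarrow> 'a functional"
  is "\<lambda>v w f. v f - w f" .
lift_definition scaleR_functional :: "real \<Rightarrow> 'a functional \<Rightarrow> 'a functional"
  is "\<lambda>r v f. r * v f" .

instance
  by standard (transfer; auto simp: algebra_simps fun_eq_iff)+

end

text \<open>Derivations at \<open>q\<close> of the algebra of functions that are smooth near \<open>q\<close>. The Leibniz rule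
  makes the value depend only on the germ of \<open>f\<close> at \<open>q\<close>: if \<open>f\<close> vanishes near \<open>q\<close>, then
  \<open>f = f h\<close> where \<open>h\<close> is the indicator function of \<open>f \<noteq> 0\<close>, and \<open>f\<close>, \<open>h\<close> both vanish near \<open>q\<close>.
  The last clause normalises the value on functions that are not smooth near \<open>q\<close>.\<close>

definition tangent_space ::
  "('a::topological_space, 'e::euclidean_space) atlas \<Rightarrow> 'a \<Rightarrow> 'a functional set" where
  "tangent_space A q = {v.
     (\<forall>f h a b. smooth_at A q f \<longrightarrow> smooth_at A q h \<longrightarrow>
        act v (\<lambda>p. a * f p + b * h p) = a * act v f + b * act v h) \<and>
     (\<forall>f h. smooth_at A q f \<longrightarrow> smooth_at A q h \<longrightarrow>
        act v (\<lambda>p. f p * h p) = f q * act v h + h q * act v f) \<and>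
     (\<forall>f. \<not> smooth_at A q f \<longrightarrow> act v f = 0)}"

definition smooth_vf ::
  "('a::topological_space, 'e::euclidean_space) atlas \<Rightarrow> 'a set \<Rightarrow> ('a \<Rightarrow> 'a functional) \<Rightarrow> bool" where
  "smooth_vf A W X \<longleftrightarrow> open W \<and> (\<forall>q\<in>W. X q \<in> tangent_space A q) \<and>
     (\<forall>V f. open V \<longrightarrow> V \<subseteq> W \<longrightarrow> smooth_on A V f \<longrightarrow> smooth_on A V (\<lambda>q. act (X q) f))"

definition bracket ::
  "('a::topological_space, 'e::euclidean_space) atlas \<Rightarrow>
     ('a \<Rightarrow> 'a functional) \<Rightarrow> ('a \<Rightarrow> 'a functional) \<Rightarrow> 'a \<Rightarrow> 'a functional" where
  "bracket A X Y q = Functional (\<lambda>f. if smooth_at A q f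
     then act (X q) (\<lambda>p. act (Y p) f) - act (Y q) (\<lambda>p. act (X p) f) else 0)"

text \<open>\<open>[V\<^sub>1, [V\<^sub>2, \<dots>, [V\<^sub>i\<^sub>-\<^sub>1, V\<^sub>i]]]\<close>\<close>

fun iter_bracket ::
  "('a::topological_space, 'e::euclidean_space) atlas \<Rightarrow>
     ('a \<Rightarrow> 'a functional) list \<Rightarrow> 'a \<Rightarrow> 'a functional" where
  "iter_bracket A [] = (\<lambda>q. 0)"
| "iter_bracket A [V] = V"
| "iter_bracket A (V # W # Vs) = bracket A V (iter_bracket A (W # Vs))"

definition is_section ::
  "('a::topological_space, 'e::euclidean_space) atlas \<Rightarrow>
     ('a \<Rightarrow> 'a functional set) \<Rightarrow> 'a set \<Rightarrow> ('a \<Rightarrow> 'a functional) \<Rightarrow> bool" where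
  "is_section A E W X \<longleftrightarrow> smooth_vf A W X \<and> (\<forall>q\<in>W. X q \<in> E q)"

definition basis_tuple :: "nat \<Rightarrow> 'v::real_vector set \<Rightarrow> (nat \<Rightarrow> 'v) \<Rightarrow> bool" where
  "basis_tuple N V v \<longleftrightarrow> inj_on v {1..N} \<and> independent (v ` {1..N}) \<and> span (v ` {1..N}) = V"


section \<open>Differential forms of top degree\<close>

text \<open>An \<open>n\<close>-form on \<open>V\<close> is a function of an \<open>n\<close>-tuple with index set \<open>{1..n}\<close>.\<close>

definition alternating_form :: "nat \<Rightarrow> 'v::real_vector set \<Rightarrow> ((nat \<Rightarrow> 'v) \<Rightarrow> real) \<Rightarrow> bool" where
  "alternating_form n V \<eta> \<longleftrightarrow>
     (\<forall>v w. (\<forall>i\<in>{1..n}. v i = w i) \<longrightarrow> \<eta> v = \<eta> w) \<and>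
     (\<forall>v i a b x y. (\<forall>j\<in>{1..n}. v j \<in> V) \<longrightarrow> i \<in> {1..n} \<longrightarrow> x \<in> V \<longrightarrow> y \<in> V \<longrightarrow>
        \<eta> (v(i := a *\<^sub>R x + b *\<^sub>R y)) = a * \<eta> (v(i := x)) + b * \<eta> (v(i := y))) \<and>
     (\<forall>v i j. (\<forall>l\<in>{1..n}. v l \<in> V) \<longrightarrow> i \<in> {1..n} \<longrightarrow> j \<in> {1..n} \<longrightarrow> i \<noteq> j \<longrightarrow> v i = v j \<longrightarrow>
        \<eta> v = 0)"

text \<open>A smooth nowhere vanishing \<open>n\<close>-form; it represents an orientation.\<close>

definition orientation_form ::
  "('a::topological_space, 'e::euclidean_space) atlas \<Rightarrow> nat \<Rightarrow>
     ('a \<Rightarrow> (nat \<Rightarrow> 'a functional) \<Rightarrow> real) \<Rightarrow> bool" where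
  "orientation_form A n \<omega> \<longleftrightarrow>
     (\<forall>q. alternating_form n (tangent_space A q) (\<omega> q)) \<and>
     (\<forall>W Y. open W \<longrightarrow> (\<forall>i\<in>{1..n}. smooth_vf A W (Y i)) \<longrightarrow>
        smooth_on A W (\<lambda>q. \<omega> q (\<lambda>i. Y i q))) \<and>
     (\<forall>q v. basis_tuple n (tangent_space A q) v \<longrightarrow> \<omega> q v \<noteq> 0)"

text \<open>The value at \<open>q\<close> of \<open>(\<L>\<^sub>X P)(Y\<^sub>1, \<dots>, Y\<^sub>n)\<close> for vector fields \<open>Y\<^sub>1, \<dots>, Y\<^sub>n\<close> near \<open>q\<close>.\<close>

definition lie_derivative ::
  "('a::topological_space, 'e::euclidean_space) atlas \<Rightarrow> nat \<Rightarrow> ('a \<Rightarrow> 'a functional) \<Rightarrow>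
     ('a \<Rightarrow> (nat \<Rightarrow> 'a functional) \<Rightarrow> real) \<Rightarrow> (nat \<Rightarrow> 'a \<Rightarrow> 'a functional) \<Rightarrow> 'a \<Rightarrow> real" where
  "lie_derivative A n X P Y q =
     act (X q) (\<lambda>p. P p (\<lambda>i. Y i p)) - (\<Sum>i=1..n. P q ((\<lambda>j. Y j q)(i := bracket A X (Y i) q)))"

definition divergence ::
  "('a::topological_space, 'e::euclidean_space) atlas \<Rightarrow> nat \<Rightarrow>
     ('a \<Rightarrow> (nat \<Rightarrow> 'a functional) \<Rightarrow> real) \<Rightarrow> ('a \<Rightarrow> 'a functional) \<Rightarrow> 'a \<Rightarrow> real" where
  "divergence A n P X q = (THE r. \<forall>W Y. q \<in> W \<longrightarrow> (\<forall>i\<in>{1..n}. smooth_vf A W (Y i)) \<longrightarrow>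
     lie_derivative A n X P Y q = r * P q (\<lambda>i. Y i q))"


section \<open>Sub-Riemannian manifolds\<close>

definition smooth_distribution ::
  "('a::topological_space, 'e::euclidean_space) atlas \<Rightarrow> nat \<Rightarrow> ('a \<Rightarrow> 'a functional set) \<Rightarrow> bool" where
  "smooth_distribution A k D \<longleftrightarrow> (\<forall>q. \<exists>W X. open W \<and> q \<in> W \<and>
     (\<forall>i\<in>{1..k}. smooth_vf A W (X i)) \<and> (\<forall>p\<in>W. basis_tuple k (D p) (\<lambda>i. X i p)))"

definition inner_product_on :: "'v::real_vector set \<Rightarrow> ('v \<Rightarrow> 'v \<Rightarrow> real) \<Rightarrow> bool" where
  "inner_product_on V h \<longleftrightarrow>
     (\<forall>x\<in>V. \<forall>y\<in>V. h x y = h y x) \<and>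
     (\<forall>x\<in>V. \<forall>y\<in>V. \<forall>z\<in>V. \<forall>a b. h (a *\<^sub>R x + b *\<^sub>R y) z = a * h x z + b * h y z) \<and>
     (\<forall>x\<in>V. x \<noteq> 0 \<longrightarrow> h x x > 0)"

definition smooth_metric ::
  "('a::topological_space, 'e::euclidean_space) atlas \<Rightarrow> ('a \<Rightarrow> 'a functional set) \<Rightarrow>
     ('a \<Rightarrow> 'a functional \<Rightarrow> 'a functional \<Rightarrow> real) \<Rightarrow> bool" where
  "smooth_metric A D g \<longleftrightarrow> (\<forall>q. inner_product_on (D q) (g q)) \<and>
     (\<forall>W X Y. is_section A D W X \<longrightarrow> is_section A D W Y \<longrightarrow> smooth_on A W (\<lambda>q. g q (X q) (Y q)))"

inductive_set lie_hull ::
  "('a::topological_space, 'e::euclidean_space) atlas \<Rightarrow> ('a \<Rightarrow> 'a functional set) \<Rightarrow> 'a set \<Rightarrow>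
     ('a \<Rightarrow> 'a functional) set"
  for A D W where
  "is_section A D W X \<Longrightarrow> X \<in> lie_hull A D W"
| "X \<in> lie_hull A D W \<Longrightarrow> Y \<in> lie_hull A D W \<Longrightarrow> bracket A X Y \<in> lie_hull A D W"

definition bracket_generating ::
  "('a::topological_space, 'e::euclidean_space) atlas \<Rightarrow> ('a \<Rightarrow> 'a functional set) \<Rightarrow> bool" where
  "bracket_generating A D \<longleftrightarrow>
     (\<forall>q. span {X q | X W. open W \<and> q \<in> W \<and> X \<in> lie_hull A D W} = tangent_space A q)"

definition sub_riemannian ::
  "('a::{t2_space, second_countable_topology}, 'e::euclidean_space) atlas \<Rightarrow> nat \<Rightarrow>
     ('a \<Rightarrow> 'a functional set) \<Rightarrow> nat \<Rightarrow> ('a \<Rightarrow> 'a functional \<Rightarrow> 'a functional \<Rightarrow> real) \<Rightarrow> bool" where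
  "sub_riemannian A n D k g \<longleftrightarrow>
     smooth_atlas A \<and> n = DIM('e) \<and> 3 \<le> n \<and> connected (UNIV :: 'a set) \<and>
     (\<exists>\<omega>. orientation_form A n \<omega>) \<and>
     smooth_distribution A k D \<and> k < n \<and> smooth_metric A D g \<and> bracket_generating A D"

fun flag ::
  "('a::topological_space, 'e::euclidean_space) atlas \<Rightarrow> ('a \<Rightarrow> 'a functional set) \<Rightarrow>
     nat \<Rightarrow> 'a \<Rightarrow> 'a functional set" where
  "flag A D 0 = (\<lambda>q. {0})"
| "flag A D (Suc 0) = D"
| "flag A D (Suc (Suc i)) = (\<lambda>q. flag A D (Suc i) q +
     span {bracket A X Y q | X Y W.
       q \<in> W \<and> is_section A (flag A D (Suc i)) W X \<and> is_section A D W Y})"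

text \<open>\<open>\<kappa> i\<close> is the constant dimension of \<open>flag A D i q\<close>.\<close>

definition equiregular ::
  "('a::topological_space, 'e::euclidean_space) atlas \<Rightarrow> ('a \<Rightarrow> 'a functional set) \<Rightarrow>
     (nat \<Rightarrow> nat) \<Rightarrow> bool" where
  "equiregular A D \<kappa> \<longleftrightarrow> (\<forall>i q. dim (flag A D i q) = \<kappa> i)"

definition has_step ::
  "('a::topological_space, 'e::euclidean_space) atlas \<Rightarrow> ('a \<Rightarrow> 'a functional set) \<Rightarrow> nat \<Rightarrow> bool" where
  "has_step A D m \<longleftrightarrow> flag A D m = tangent_space A \<and> (\<forall>i<m. flag A D i \<noteq> tangent_space A)"


section \<open>Popp's volume\<close>

text \<open>An element of \<open>\<otimes>\<^sup>i V\<close> is represented by a formal linear combination of lists of length \<open>i\<close>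
  over \<open>V\<close>, where the list \<open>[v\<^sub>1, \<dots>, v\<^sub>i]\<close> stands for \<open>v\<^sub>1 \<otimes> \<dots> \<otimes> v\<^sub>i\<close>. Since
  \<open>tensor_inner\<close> and \<open>popp_map\<close> below are the (bi)linear extensions of expressions that are
  multilinear in the list entries, they depend only on the represented tensors, and a minimum over
  representatives is a minimum over tensors.\<close>

definition tensors :: "'v set \<Rightarrow> nat \<Rightarrow> ('v list \<Rightarrow>\<^sub>0 real) set" where
  "tensors V i = {Z. \<forall>xs\<in>Poly_Mapping.keys Z. length xs = i \<and> set xs \<subseteq> V}"

definition tensor_inner ::
  "('v \<Rightarrow> 'v \<Rightarrow> real) \<Rightarrow> nat \<Rightarrow> ('v list \<Rightarrow>\<^sub>0 real) \<Rightarrow> ('v list \<Rightarrow>\<^sub>0 real) \<Rightarrow> real" where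
  "tensor_inner h i Z W = (\<Sum>xs\<in>Poly_Mapping.keys Z. \<Sum>ys\<in>Poly_Mapping.keys W.
     Poly_Mapping.lookup Z xs * Poly_Mapping.lookup W ys * (\<Prod>l<i. h (xs ! l) (ys ! l)))"

definition tensor_norm :: "('v \<Rightarrow> 'v \<Rightarrow> real) \<Rightarrow> nat \<Rightarrow> ('v list \<Rightarrow>\<^sub>0 real) \<Rightarrow> real" where
  "tensor_norm h i Z = sqrt (tensor_inner h i Z Z)"

definition extension ::
  "('a::topological_space, 'e::euclidean_space) atlas \<Rightarrow> ('a \<Rightarrow> 'a functional set) \<Rightarrow> 'a \<Rightarrow>
     'a functional \<Rightarrow> 'a \<Rightarrow> 'a functional" where
  "extension A D q v = (SOME V. (\<exists>W. q \<in> W \<and> is_section A D W V) \<and> V q = v)"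

text \<open>The map \<open>\<pi>\<^sub>i\<close>. Its values are cosets of the flag; they do not depend on the choice of the
  extensions.\<close>

definition popp_map ::
  "('a::topological_space, 'e::euclidean_space) atlas \<Rightarrow> ('a \<Rightarrow> 'a functional set) \<Rightarrow> 'a \<Rightarrow> nat \<Rightarrow>
     ('a functional list \<Rightarrow>\<^sub>0 real) \<Rightarrow> 'a functional set" where
  "popp_map A D q i Z =
     (\<Sum>xs\<in>Poly_Mapping.keys Z. Poly_Mapping.lookup Z xs *\<^sub>R
        iter_bracket A (map (extension A D q) xs) q)
       +o flag A D (i - 1) q"

definition layer_norm ::
  "('a::topological_space, 'e::euclidean_space) atlas \<Rightarrow> ('a \<Rightarrow> 'a functional set) \<Rightarrow>
     ('a \<Rightarrow> 'a functional \<Rightarrow> 'a functional \<Rightarrow> real) \<Rightarrow> 'a \<Rightarrow> nat \<Rightarrow> 'a functional set \<Rightarrow> real" where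
  "layer_norm A D g q i Y =
     Inf {tensor_norm (g q) i Z | Z. Z \<in> tensors (D q) i \<and> popp_map A D q i Z = Y}"

text \<open>The inner product is recovered from its norm by polarization; \<open>Y + Y'\<close> is the sum of cosets.\<close>

definition layer_inner ::
  "('a::topological_space, 'e::euclidean_space) atlas \<Rightarrow> ('a \<Rightarrow> 'a functional set) \<Rightarrow>
     ('a \<Rightarrow> 'a functional \<Rightarrow> 'a functional \<Rightarrow> real) \<Rightarrow> 'a \<Rightarrow> nat \<Rightarrow>
     'a functional set \<Rightarrow> 'a functional set \<Rightarrow> real" where
  "layer_inner A D g q i Y Y' =
     ((layer_norm A D g q i (Y + Y'))\<^sup>2 - (layer_norm A D g q i Y)\<^sup>2 - (layer_norm A D g q i Y')\<^sup>2) / 2"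

text \<open>\<open>gr\<^sub>q(D)\<close>: an element is the tuple of its components in the quotients
  \<open>D\<^sup>i\<^sub>q / D\<^sup>i\<^sup>-\<^sup>1\<^sub>q\<close>, \<open>1 \<le> i \<le> m\<close>, which are sets of cosets.\<close>

definition gr ::
  "('a::topological_space, 'e::euclidean_space) atlas \<Rightarrow> ('a \<Rightarrow> 'a functional set) \<Rightarrow> nat \<Rightarrow> 'a \<Rightarrow>
     (nat \<Rightarrow> 'a functional set) set" where
  "gr A D m q = (\<Pi>\<^sub>E i\<in>{1..m}. (\<lambda>v. v +o flag A D (i - 1) q) ` flag A D i q)"

definition gr_inner ::
  "('a::topological_space, 'e::euclidean_space) atlas \<Rightarrow> ('a \<Rightarrow> 'a functional set) \<Rightarrow>
     ('a \<Rightarrow> 'a functional \<Rightarrow> 'a functional \<Rightarrow> real) \<Rightarrow> nat \<Rightarrow> 'a \<Rightarrow>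
     (nat \<Rightarrow> 'a functional set) \<Rightarrow> (nat \<Rightarrow> 'a functional set) \<Rightarrow> real" where
  "gr_inner A D g m q x y = (\<Sum>i=1..m. layer_inner A D g q i (x i) (y i))"

text \<open>As \<open>gr\<^sub>q(D)\<close> has dimension \<open>n\<close>, orthonormal \<open>n\<close>-tuples are bases.\<close>

definition gr_orthonormal_basis ::
  "('a::topological_space, 'e::euclidean_space) atlas \<Rightarrow> ('a \<Rightarrow> 'a functional set) \<Rightarrow>
     ('a \<Rightarrow> 'a functional \<Rightarrow> 'a functional \<Rightarrow> real) \<Rightarrow> nat \<Rightarrow> nat \<Rightarrow> 'a \<Rightarrow>
     (nat \<Rightarrow> nat \<Rightarrow> 'a functional set) \<Rightarrow> bool" where
  "gr_orthonormal_basis A D g n m q e \<longleftrightarrow> (\<forall>a\<in>{1..n}. e a \<in> gr A D m q) \<and>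
     (\<forall>a\<in>{1..n}. \<forall>b\<in>{1..n}. gr_inner A D g m q (e a) (e b) = (if a = b then 1 else 0))"

definition adapted_basis ::
  "('a::topological_space, 'e::euclidean_space) atlas \<Rightarrow> ('a \<Rightarrow> 'a functional set) \<Rightarrow>
     nat \<Rightarrow> nat \<Rightarrow> (nat \<Rightarrow> nat) \<Rightarrow> 'a \<Rightarrow> (nat \<Rightarrow> 'a functional) \<Rightarrow> bool" where
  "adapted_basis A D n m \<kappa> q v \<longleftrightarrow> basis_tuple n (tangent_space A q) v \<and>
     (\<forall>i\<in>{1..m}. basis_tuple (\<kappa> i) (flag A D i q) v)"

text \<open>The class of the \<open>l\<close>-th vector of an adapted basis, as an element of \<open>gr\<^sub>q(D)\<close>.\<close>

definition theta_hat ::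
  "('a::topological_space, 'e::euclidean_space) atlas \<Rightarrow> ('a \<Rightarrow> 'a functional set) \<Rightarrow>
     nat \<Rightarrow> (nat \<Rightarrow> nat) \<Rightarrow> 'a \<Rightarrow> (nat \<Rightarrow> 'a functional) \<Rightarrow> nat \<Rightarrow> nat \<Rightarrow> 'a functional set" where
  "theta_hat A D m \<kappa> q v l = (\<lambda>i\<in>{1..m}.
     (if \<kappa> (i - 1) < l \<and> l \<le> \<kappa> i then v l else 0) +o flag A D (i - 1) q)"

text \<open>\<open>\<mu>\<^sub>q(x\<^sub>1 \<and> \<dots> \<and> x\<^sub>n)\<close> for the dual basis of the orthonormal basis \<open>e\<close>.\<close>

definition gr_volume ::
  "('a::topological_space, 'e::euclidean_space) atlas \<Rightarrow> ('a \<Rightarrow> 'a functional set) \<Rightarrow>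
     ('a \<Rightarrow> 'a functional \<Rightarrow> 'a functional \<Rightarrow> real) \<Rightarrow> nat \<Rightarrow> nat \<Rightarrow> 'a \<Rightarrow>
     (nat \<Rightarrow> nat \<Rightarrow> 'a functional set) \<Rightarrow> (nat \<Rightarrow> nat \<Rightarrow> 'a functional set) \<Rightarrow> real" where
  "gr_volume A D g n m q e x =
     Determinant.det (Matrix.mat n n (\<lambda>(a, b). gr_inner A D g m q (e (Suc a)) (x (Suc b))))"

text \<open>\<open>P = \<mu> \<circ> \<theta>\<close>, with the sign of \<open>\<mu>\<^sub>q\<close> (that is, the order of \<open>e\<close>) chosen so that \<open>P\<close> is
  positive for the orientation given by \<open>\<omega>\<close>. An alternating \<open>n\<close>-form is determined by its value on
  one basis, so \<open>P\<close> is unique on tangent vectors.\<close>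

definition popp_volume ::
  "('a::topological_space, 'e::euclidean_space) atlas \<Rightarrow> ('a \<Rightarrow> 'a functional set) \<Rightarrow>
     ('a \<Rightarrow> 'a functional \<Rightarrow> 'a functional \<Rightarrow> real) \<Rightarrow> nat \<Rightarrow> nat \<Rightarrow> (nat \<Rightarrow> nat) \<Rightarrow>
     ('a \<Rightarrow> (nat \<Rightarrow> 'a functional) \<Rightarrow> real) \<Rightarrow> ('a \<Rightarrow> (nat \<Rightarrow> 'a functional) \<Rightarrow> real) \<Rightarrow> bool" where
  "popp_volume A D g n m \<kappa> \<omega> P \<longleftrightarrow> (\<forall>q.
     alternating_form n (tangent_space A q) (P q) \<and>
     (\<exists>e. gr_orthonormal_basis A D g n m q e \<and>
        (\<forall>v. adapted_basis A D n m \<kappa> q v \<longrightarrow>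
           P q v = gr_volume A D g n m q e (theta_hat A D m \<kappa> q v))) \<and>
     (\<forall>v. basis_tuple n (tangent_space A q) v \<longrightarrow> P q v * \<omega> q v > 0))"


section \<open>The sub-Laplacian\<close>

definition gradient ::
  "('a::topological_space, 'e::euclidean_space) atlas \<Rightarrow> ('a \<Rightarrow> 'a functional set) \<Rightarrow>
     ('a \<Rightarrow> 'a functional \<Rightarrow> 'a functional \<Rightarrow> real) \<Rightarrow> ('a \<Rightarrow> real) \<Rightarrow> 'a \<Rightarrow> 'a functional" where
  "gradient A D g f q = (THE v. v \<in> D q \<and>
     (\<forall>W X. q \<in> W \<longrightarrow> is_section A D W X \<longrightarrow> g q v (X q) = act (X q) f))"

definition sub_laplacian ::
  "('a::topological_space, 'e::euclidean_space) atlas \<Rightarrow> ('a \<Rightarrow> 'a functional set) \<Rightarrow>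
     ('a \<Rightarrow> 'a functional \<Rightarrow> 'a functional \<Rightarrow> real) \<Rightarrow> nat \<Rightarrow>
     ('a \<Rightarrow> (nat \<Rightarrow> 'a functional) \<Rightarrow> real) \<Rightarrow> ('a \<Rightarrow> real) \<Rightarrow> 'a \<Rightarrow> real" where
  "sub_laplacian A D g n P f = divergence A n P (gradient A D g f)"


section \<open>Adapted frames\<close>

definition adapted_frame ::
  "('a::topological_space, 'e::euclidean_space) atlas \<Rightarrow> ('a \<Rightarrow> 'a functional set) \<Rightarrow>
     ('a \<Rightarrow> 'a functional \<Rightarrow> 'a functional \<Rightarrow> real) \<Rightarrow> nat \<Rightarrow> nat \<Rightarrow> nat \<Rightarrow> (nat \<Rightarrow> nat) \<Rightarrow>
     'a set \<Rightarrow> (nat \<Rightarrow> 'a \<Rightarrow> 'a functional) \<Rightarrow> bool" where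
  "adapted_frame A D g n k m \<kappa> U X \<longleftrightarrow> open U \<and>
     (\<forall>i\<in>{1..n}. smooth_vf A U (X i)) \<and>
     (\<forall>q\<in>U. adapted_basis A D n m \<kappa> q (\<lambda>i. X i q)) \<and>
     (\<forall>q\<in>U. \<forall>i\<in>{1..k}. \<forall>j\<in>{1..k}. g q (X i q) (X j q) = (if i = j then 1 else 0))"

text \<open>\<open>c i j l\<close> stands for \<open>c\<^sup>l\<^sub>i\<^sub>j\<close>.\<close>

definition structure_constants ::
  "('a::topological_space, 'e::euclidean_space) atlas \<Rightarrow> nat \<Rightarrow> 'a set \<Rightarrow>
     (nat \<Rightarrow> 'a \<Rightarrow> 'a functional) \<Rightarrow> (nat \<Rightarrow> nat \<Rightarrow> nat \<Rightarrow> 'a \<Rightarrow> real) \<Rightarrow> bool" where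
  "structure_constants A n U X c \<longleftrightarrow> (\<forall>i\<in>{1..n}. \<forall>j\<in>{1..n}.
     (\<forall>l\<in>{1..n}. smooth_on A U (c i j l)) \<and>
     (\<forall>q\<in>U. bracket A (X i) (X j) q = (\<Sum>l=1..n. c i j l q *\<^sub>R X l q)))"

text \<open>\<open>b [i\<^sub>1, \<dots>, i\<^sub>j] l\<close> stands for the adapted structure constant with lower indices
  \<open>i\<^sub>1, \<dots>, i\<^sub>j\<close> and upper index \<open>l\<close>.\<close>

definition multi_indices :: "nat \<Rightarrow> nat \<Rightarrow> nat list set" where
  "multi_indices k j = {I. set I \<subseteq> {1..k} \<and> length I = j}"

definition adapted_structure_constants ::
  "('a::topological_space, 'e::euclidean_space) atlas \<Rightarrow> ('a \<Rightarrow> 'a functional set) \<Rightarrow> nat \<Rightarrow> nat \<Rightarrow>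
     (nat \<Rightarrow> nat) \<Rightarrow> 'a set \<Rightarrow> (nat \<Rightarrow> 'a \<Rightarrow> 'a functional) \<Rightarrow> (nat list \<Rightarrow> nat \<Rightarrow> 'a \<Rightarrow> real) \<Rightarrow> bool" where
  "adapted_structure_constants A D k m \<kappa> U X b \<longleftrightarrow>
     (\<forall>j\<in>{2..m}. \<forall>I\<in>multi_indices k j.
        (\<forall>l\<in>{\<kappa> (j - 1) + 1..\<kappa> j}. smooth_on A U (b I l)) \<and>
        (\<forall>q\<in>U. iter_bracket A (map X I) q - (\<Sum>l=\<kappa> (j - 1) + 1..\<kappa> j. b I l q *\<^sub>R X l q)
           \<in> flag A D (j - 1) q))"

text \<open>The entry at position \<open>(h, l)\<close>, counted from \<open>0\<close>, is \<open>[B\<^sub>j]\<close> with indices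
  \<open>\<kappa> (j - 1) + 1 + h\<close> and \<open>\<kappa> (j - 1) + 1 + l\<close>.\<close>

definition popp_matrix ::
  "nat \<Rightarrow> (nat \<Rightarrow> nat) \<Rightarrow> (nat list \<Rightarrow> nat \<Rightarrow> 'a \<Rightarrow> real) \<Rightarrow> nat \<Rightarrow> 'a \<Rightarrow> real Matrix.mat" where
  "popp_matrix k \<kappa> b j q = (if j = 1 then 1\<^sub>m k
     else Matrix.mat (\<kappa> j - \<kappa> (j - 1)) (\<kappa> j - \<kappa> (j - 1)) (\<lambda>(h, l).
       \<Sum>I\<in>multi_indices k j. b I (\<kappa> (j - 1) + 1 + h) q * b I (\<kappa> (j - 1) + 1 + l) q))"

definition mat_derivative :: "'a functional \<Rightarrow> ('a \<Rightarrow> real Matrix.mat) \<Rightarrow> 'a \<Rightarrow> real Matrix.mat" where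
  "mat_derivative v M q = Matrix.mat (dim_row (M q)) (dim_col (M q))
     (\<lambda>(h, l). act v (\<lambda>p. M p $$ (h, l)))"

definition mat_trace :: "real Matrix.mat \<Rightarrow> real" where
  "mat_trace M = (\<Sum>i<dim_row M. M $$ (i, i))"

end

theory Submission
  imports Defs
begin

text \<open>
  As \<open>X 1, \<dots>, X k\<close> are orthonormal, the horizontal gradient of \<open>f\<close> is \<open>\<Sum>\<^sub>i X\<^sub>i(f) X\<^sub>i\<close>. Let
  \<open>\<rho> = P(X\<^sub>1, \<dots>, X\<^sub>n)\<close>. Evaluating the Lie derivative of \<open>P\<close> along the gradient on the frame, and expanding
  the brackets by the Leibniz rule, gives
  \<open>div (grad f) = \<Sum>\<^sub>i (X\<^sub>i(X\<^sub>i(f)) + (X\<^sub>i(\<rho>) / \<rho> - \<Sum>\<^sub>l c\<^sup>l\<^sub>i\<^sub>l) X\<^sub>i(f))\<close>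
  (\<open>sub_laplacian_frame\<close>). The rest of the proof computes \<open>\<rho>\<close>: its square is the reciprocal of
  \<open>\<Prod>\<^sub>j det B\<^sub>j\<close> (\<open>popp_volume_frame\<close>), and Jacobi's formula (\<open>act_det_trace\<close>) turns the logarithmic derivative
  of this product into \<open>\<Sum>\<^sub>j Tr (B\<^sub>j\<^sup>-\<^sup>1 X\<^sub>i(B\<^sub>j))\<close>, whence \<open>X\<^sub>i(\<rho>) / \<rho> = - 1/2 \<Sum>\<^sub>j Tr (B\<^sub>j\<^sup>-\<^sup>1 X\<^sub>i(B\<^sub>j))\<close>.

  The value of \<open>\<rho>\<close> comes from the inner product on the layers of the graded space. The tensors
  \<open>X I\<^sub>1 \<otimes> \<dots> \<otimes> X I\<^sub>j\<close> are orthonormal, and \<open>\<pi>\<^sub>j\<close> maps them to the classes of the iterated brackets \<open>T I\<close>, whose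
  coordinates are the adapted structure constants. The quotient norm of a class with coordinate vector
  \<open>y\<close> is the least norm of a solution of a linear system with Gram matrix \<open>B\<^sub>j\<close>, namely
  \<open>sqrt (y\<^sup>T B\<^sub>j\<^sup>-\<^sup>1 y)\<close> (\<open>layer_norm_eq\<close>). So the classes of the frame vectors have the block diagonal Gram matrix
  with the blocks \<open>B\<^sub>j\<^sup>-\<^sup>1\<close>, and the square of the volume that they span is its determinant.

  This rests on two properties of \<open>\<pi>\<^sub>j\<close>: it depends multilinearly on the values of the sections
  (\<open>iter_bracket_expand\<close>), and it is onto, so that \<open>B\<^sub>j\<close> is invertible (\<open>popp_surjective\<close>, \<open>gram_det_nz\<close>). Both follow by
  induction from the fact that bracketing with sections of \<open>D\<close> is tensorial on the graded pieces of the
  flag (\<open>bracket_tensorial\<close>, \<open>bracket_expand\<close>). That fact needs smooth coefficients of vector fields in the frame;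
  Cramer's rule for the orientation form provides them.
\<close>

section \<open>Smooth functions\<close>

lemma Ck_on_cong:
  assumes "open S" and "Ck_on r S f" and "\<And>x. x \<in> S \<Longrightarrow> f x = g x"
  shows "Ck_on r S g"
  using assms
proof (induction r arbitrary: f g)
  case 0
  then show ?case using continuous_on_cong[of S S f g] by auto
next
  case (Suc r)
  have f: "f differentiable at x" if "x \<in> S" for x
    using Suc.prems that by (auto simp: differentiable_on_eq_differentiable_at)
  have fg: "frechet_derivative f (at x) = frechet_derivative g (at x)" if "x \<in> S" for x
    using frechet_derivative_transform_within_open[OF f[OF that] Suc.prems(1) that Suc.prems(3)] .
  have "(g has_derivative frechet_derivative f (at x)) (at x)" if x: "x \<in> S" for x
    using f[OF x, unfolded frechet_derivative_works] Suc.prems(1) x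
    by (rule has_derivative_transform_within_open) (rule Suc.prems(3))
  then have "g differentiable_on S"
    using Suc.prems(1) by (auto simp: differentiable_on_eq_differentiable_at differentiable_def)
  moreover have "Ck_on r S (\<lambda>x. frechet_derivative g (at x) v)" for v
    by (rule Suc.IH[where f = "\<lambda>x. frechet_derivative f (at x) v"]) (use Suc.prems fg in auto)
  ultimately show ?case by simp
qed

text \<open>A derivative known pointwise may be used in place of the chosen \<open>frechet_derivative\<close>.\<close>

lemma Ck_on_SucI:
  assumes S: "open S" and der: "\<And>x. x \<in> S \<Longrightarrow> (f has_derivative f' x) (at x)"
    and Ck: "\<And>v. Ck_on r S (\<lambda>x. f' x v)"
  shows "Ck_on (Suc r) S f"
proof -
  have "f differentiable_on S"
    using der S by (auto simp: differentiable_on_eq_differentiable_at differentiable_def)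
  moreover have "Ck_on r S (\<lambda>x. frechet_derivative f (at x) v)" for v
    by (rule Ck_on_cong[OF S Ck[of v]]) (metis der frechet_derivative_at)
  ultimately show ?thesis by simp
qed

lemma Ck_on_SucD:
  assumes "open S" and "Ck_on (Suc r) S f" and "x \<in> S"
  shows "(f has_derivative frechet_derivative f (at x)) (at x)"
  using assms frechet_derivative_works by (auto simp: differentiable_on_eq_differentiable_at)

lemma Ck_on_pred:
  assumes "open S" and "Ck_on (Suc r) S f"
  shows "Ck_on r S f"
  using assms
proof (induction r arbitrary: f)
  case 0
  then show ?case by (auto intro: differentiable_imp_continuous_on)
next
  case (Suc r)
  then show ?case by (metis Ck_on.simps(2))
qed

lemma Ck_on_subset:
  assumes "Ck_on r S f" and "T \<subseteq> S"
  shows "Ck_on r T f"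
  using assms
  by (induction r arbitrary: f) (auto intro: continuous_on_subset differentiable_on_subset)

lemma Ck_on_const: "open S \<Longrightarrow> Ck_on r S (\<lambda>x. c)"
proof (induction r arbitrary: c)
  case (Suc r)
  show ?case
    by (rule Ck_on_SucI[where f' = "\<lambda>x v. 0"]) (use Suc in auto)
qed simp

lemma Ck_on_add:
  assumes "open S" and "Ck_on r S f" and "Ck_on r S g"
  shows "Ck_on r S (\<lambda>x. f x + g x)"
  using assms
proof (induction r arbitrary: f g)
  case 0
  then show ?case by (auto intro: continuous_on_add)
next
  case (Suc r)
  show ?case
    by (rule Ck_on_SucI[OF Suc.prems(1) has_derivative_add])
      (use Suc in \<open>auto intro: Ck_on_SucD\<close>)
qed

lemma Ck_on_mult:
  fixes f g :: "'e::euclidean_space \<Rightarrow> real"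
  assumes "open S" and "Ck_on r S f" and "Ck_on r S g"
  shows "Ck_on r S (\<lambda>x. f x * g x)"
  using assms
proof (induction r arbitrary: f g)
  case 0
  then show ?case by (auto intro: continuous_on_mult)
next
  case (Suc r)
  have pred: "Ck_on r S f" "Ck_on r S g"
    using Suc.prems Ck_on_pred by blast+
  show ?case
    by (rule Ck_on_SucI[OF Suc.prems(1) has_derivative_mult])
      (use Suc pred in \<open>auto intro!: Ck_on_add Ck_on_SucD\<close>)
qed

lemma Ck_on_inverse:
  fixes f :: "'e::euclidean_space \<Rightarrow> real"
  assumes "open S" and "Ck_on r S f" and "\<And>x. x \<in> S \<Longrightarrow> f x \<noteq> 0"
  shows "Ck_on r S (\<lambda>x. inverse (f x))"
  using assms
proof (induction r arbitrary: f)
  case 0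
  then show ?case by (auto intro: continuous_on_inverse)
next
  case (Suc r)
  have inv: "Ck_on r S (\<lambda>x. inverse (f x))"
    using Suc Ck_on_pred by blast
  have "Ck_on r S (\<lambda>x. (- 1) * (inverse (f x) * frechet_derivative f (at x) v * inverse (f x)))" for v
    using Suc.prems by (intro Ck_on_mult Ck_on_const inv) auto
  then show ?case
    by (intro Ck_on_SucI[OF Suc.prems(1) Deriv.has_derivative_inverse])
      (use Suc.prems in \<open>auto intro: Ck_on_SucD\<close>)
qed

text \<open>The derivative of \<open>1 / sqrt f\<close> is \<open>f'\<close> times a product of \<open>1 / f\<close> and \<open>1 / sqrt f\<close> itself, so one
  order of differentiability is gained at each step of the induction.\<close>

lemma Ck_on_inverse_sqrt:
  fixes f :: "'e::euclidean_space \<Rightarrow> real"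
  assumes "open S" and "Ck_on r S f" and "\<And>x. x \<in> S \<Longrightarrow> f x > 0"
  shows "Ck_on r S (\<lambda>x. inverse (sqrt (f x)))"
  using assms
proof (induction r arbitrary: f)
  case 0
  then show ?case by (force intro!: continuous_on_inverse continuous_on_real_sqrt)
next
  case (Suc r)
  have u: "Ck_on r S (\<lambda>x. inverse (sqrt (f x)))"
    using Suc Ck_on_pred by blast
  have i: "Ck_on r S (\<lambda>x. inverse (f x))"
    using Suc.prems by (intro Ck_on_inverse Ck_on_pred[of S r]) force+
  let ?D = "\<lambda>x v. (- (1/2)) * (frechet_derivative f (at x) v * (inverse (f x) * inverse (sqrt (f x))))"
  show ?case
  proof (rule Ck_on_SucI[OF Suc.prems(1)])
    show "((\<lambda>x. inverse (sqrt (f x))) has_derivative ?D x) (at x)" if x: "x \<in> S" for x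
    proof -
      have f: "(f has_derivative frechet_derivative f (at x)) (at x)"
        by (rule Ck_on_SucD[OF Suc.prems(1,2) x])
      have pos: "f x > 0" using Suc.prems x by auto
      have "sqrt (f x) * sqrt (f x) = f x" using pos by simp
      then have *: "inverse (sqrt (f x)) * inverse (sqrt (f x)) = inverse (f x)"
        by (metis inverse_mult_distrib)
      show ?thesis
        by (rule has_derivative_eq_rhs[OF Deriv.has_derivative_inverse[OF _ has_derivative_real_sqrt[OF pos f]]])
          (use pos in \<open>auto simp: fun_eq_iff *[symmetric] field_simps\<close>)
    qed
    show "Ck_on r S (\<lambda>x. ?D x v)" for v
      using Suc.prems by (intro Ck_on_mult Ck_on_const i u) auto
  qed
qed

locale manifold_atlas =
  fixes A :: "('a::{t2_space, second_countable_topology}, 'e::euclidean_space) atlas"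
  assumes atlas: "smooth_atlas A"
begin

lemma chart_image_open:
  assumes "(U, \<phi>) \<in> A" and "open W"
  shows "open (\<phi> ` (U \<inter> W))"
proof -
  obtain \<psi> where U: "open U" "open (\<phi> ` U)" and h: "homeomorphism U (\<phi> ` U) \<phi> \<psi>"
    using atlas assms(1) unfolding smooth_atlas_def by blast
  have "openin (top_of_set U) (U \<inter> W)" using assms(2) by (auto simp: openin_open)
  then have "openin (top_of_set (\<phi> ` U)) (\<phi> ` (U \<inter> W))"
    using homeomorphism_imp_open_map[OF h] by blast
  then show ?thesis using U(2) openin_open_eq by blast
qed

lemma chart_inverse:
  assumes "(U, \<phi>) \<in> A" and "x \<in> \<phi> ` (U \<inter> W)"
  shows "inv_into U \<phi> x \<in> W"
proof -
  obtain \<psi> where "homeomorphism U (\<phi> ` U) \<phi> \<psi>"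
    using atlas assms(1) unfolding smooth_atlas_def by blast
  then have "inj_on \<phi> U" by (metis homeomorphism_def inj_on_inverseI)
  then show ?thesis using assms(2) by auto
qed

lemma smooth_on_I:
  assumes "\<And>U \<phi> r. (U, \<phi>) \<in> A \<Longrightarrow> Ck_on r (\<phi> ` (U \<inter> W)) (\<lambda>x. f (inv_into U \<phi> x))"
  shows "smooth_on A W f"
  using assms by (auto simp: smooth_on_def Cinf_on_def comp_def)

lemma smooth_on_D:
  assumes "smooth_on A W f" and "(U, \<phi>) \<in> A"
  shows "Ck_on r (\<phi> ` (U \<inter> W)) (\<lambda>x. f (inv_into U \<phi> x))"
  using assms by (auto simp: smooth_on_def Cinf_on_def comp_def)

lemma smooth_on_cong:
  assumes "open W" "smooth_on A W f" "\<And>p. p \<in> W \<Longrightarrow> f p = h p"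
  shows "smooth_on A W h"
  by (rule smooth_on_I, rule Ck_on_cong[OF chart_image_open smooth_on_D[where f = f and W = W]])
    (auto intro!: assms intro: chart_inverse)

lemma smooth_on_subset: "smooth_on A W f \<Longrightarrow> V \<subseteq> W \<Longrightarrow> smooth_on A V f"
  by (rule smooth_on_I, rule Ck_on_subset[OF smooth_on_D[where f = f and W = W]]) auto

lemma smooth_on_const: "open W \<Longrightarrow> smooth_on A W (\<lambda>p. c)"
  by (rule smooth_on_I) (auto intro: Ck_on_const chart_image_open)

lemma smooth_on_add:
  assumes "open W" "smooth_on A W f" "smooth_on A W h"
  shows "smooth_on A W (\<lambda>p. f p + h p)"
  by (rule smooth_on_I, rule Ck_on_add[OF chart_image_open smooth_on_D[OF assms(2)] smooth_on_D[OF assms(3)]])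
    (auto intro: assms)

lemma smooth_on_mult:
  assumes "open W" "smooth_on A W f" "smooth_on A W h"
  shows "smooth_on A W (\<lambda>p. f p * h p)"
  by (rule smooth_on_I, rule Ck_on_mult[OF chart_image_open smooth_on_D[OF assms(2)] smooth_on_D[OF assms(3)]])
    (auto intro: assms)

lemma smooth_on_inverse:
  assumes "open W" "smooth_on A W f" "\<And>p. p \<in> W \<Longrightarrow> f p \<noteq> 0"
  shows "smooth_on A W (\<lambda>p. inverse (f p))"
  by (rule smooth_on_I, rule Ck_on_inverse[OF chart_image_open smooth_on_D[OF assms(2)]])
    (auto dest: chart_inverse assms(3) intro: assms(1))

lemma smooth_on_inverse_sqrt:
  assumes "open W" "smooth_on A W f" "\<And>p. p \<in> W \<Longrightarrow> f p > 0"
  shows "smooth_on A W (\<lambda>p. inverse (sqrt (f p)))"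
  by (rule smooth_on_I, rule Ck_on_inverse_sqrt[OF chart_image_open smooth_on_D[OF assms(2)]])
    (auto dest: chart_inverse intro: assms)

lemma smooth_on_diff:
  assumes "open W" "smooth_on A W f" "smooth_on A W h"
  shows "smooth_on A W (\<lambda>p. f p - h p)"
proof -
  have "smooth_on A W (\<lambda>p. f p + (- 1) * h p)"
    by (intro smooth_on_add smooth_on_mult smooth_on_const assms)
  then show ?thesis by simp
qed

lemma smooth_on_sum:
  assumes "open W" "\<And>i. i \<in> I \<Longrightarrow> smooth_on A W (f i)"
  shows "smooth_on A W (\<lambda>p. \<Sum>i\<in>I. f i p)"
  using assms(2)
  by (induction I rule: infinite_finite_induct) (auto intro: smooth_on_const smooth_on_add assms(1))

lemma smooth_on_prod:
  assumes "open W" "\<And>i. i \<in> I \<Longrightarrow> smooth_on A W (f i)"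
  shows "smooth_on A W (\<lambda>p. \<Prod>i\<in>I. f i p)"
  using assms(2)
  by (induction I rule: infinite_finite_induct) (auto intro: smooth_on_const smooth_on_mult assms(1))

lemma smooth_on_det:
  assumes W: "open W" and N: "\<And>i j. i < N \<Longrightarrow> j < N \<Longrightarrow> smooth_on A W (\<lambda>p. M p $$ (i, j))"
    and dim: "\<And>p. M p \<in> carrier_mat N N"
  shows "smooth_on A W (\<lambda>p. Determinant.det (M p))"
  unfolding det_def'[OF dim]
  by (intro smooth_on_sum smooth_on_mult smooth_on_prod smooth_on_const N W)
    (auto simp: permutes_in_image)

lemma smooth_atI: "open W \<Longrightarrow> q \<in> W \<Longrightarrow> smooth_on A W f \<Longrightarrow> smooth_at A q f"
  by (auto simp: smooth_at_def)

lemma smooth_at_common: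
  assumes "smooth_at A q f" "smooth_at A q h"
  obtains W where "open W" "q \<in> W" "smooth_on A W f" "smooth_on A W h"
proof -
  obtain V W where "open V" "q \<in> V" "smooth_on A V f" "open W" "q \<in> W" "smooth_on A W h"
    using assms by (auto simp: smooth_at_def)
  then show ?thesis
    by (intro that[of "V \<inter> W"]) (auto intro: smooth_on_subset)
qed

lemma smooth_at_add:
  assumes "smooth_at A q f" "smooth_at A q h"
  shows "smooth_at A q (\<lambda>p. f p + h p)"
  by (rule smooth_at_common[OF assms]) (blast intro: smooth_atI smooth_on_add)

lemma smooth_at_mult:
  assumes "smooth_at A q f" "smooth_at A q h"
  shows "smooth_at A q (\<lambda>p. f p * h p)"
  by (rule smooth_at_common[OF assms]) (blast intro: smooth_atI smooth_on_mult)

lemma smooth_at_const: "smooth_at A q (\<lambda>p. c)"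
  using smooth_on_const[of UNIV] by (auto simp: smooth_at_def)

lemma smooth_at_cong:
  assumes "smooth_at A q f" "open W" "q \<in> W" "\<And>p. p \<in> W \<Longrightarrow> f p = h p"
  shows "smooth_at A q h"
proof -
  obtain V where V: "open V" "q \<in> V" "smooth_on A V f" using assms(1) by (auto simp: smooth_at_def)
  have "smooth_on A (V \<inter> W) f" using V(3) smooth_on_subset by blast
  then have "smooth_on A (V \<inter> W) h" using smooth_on_cong[of "V \<inter> W" f h] V assms by auto
  then show ?thesis using V assms by (auto simp: smooth_at_def)
qed

section \<open>Derivations and brackets\<close>

lemma act_zero [simp]: "act 0 f = 0" by transfer simp
lemma act_add: "act (v + w) f = act v f + act w f" by transfer simp
lemma act_scale: "act (r *\<^sub>R v) f = r * act v f" by transfer simp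
lemma act_sum: "act (\<Sum>i\<in>I. v i) f = (\<Sum>i\<in>I. act (v i) f)"
  by (induction I rule: infinite_finite_induct) (auto simp: act_add)
lemma functional_eqI: "(\<And>f. act v f = act w f) \<Longrightarrow> v = w"
  by (metis act_inject ext)
lemma act_Functional [simp]: "act (Functional F) f = F f"
  by (simp add: Functional_inverse)

lemma tangent_space_subspace: "subspace (tangent_space A q)"
proof (rule subspaceI)
  show "0 \<in> tangent_space A q" by (auto simp: tangent_space_def)
next
  fix v w assume "v \<in> tangent_space A q" "w \<in> tangent_space A q"
  then show "v + w \<in> tangent_space A q"
    unfolding tangent_space_def by (simp add: act_add algebra_simps)
next
  fix r v assume "v \<in> tangent_space A q"
  then show "r *\<^sub>R v \<in> tangent_space A q"
    unfolding tangent_space_def by (simp add: act_scale algebra_simps)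
qed

lemma act_lin:
  assumes "v \<in> tangent_space A q" "smooth_at A q f" "smooth_at A q h"
  shows "act v (\<lambda>p. a * f p + b * h p) = a * act v f + b * act v h"
  using assms by (auto simp: tangent_space_def)

lemma act_mult:
  assumes "v \<in> tangent_space A q" "smooth_at A q f" "smooth_at A q h"
  shows "act v (\<lambda>p. f p * h p) = f q * act v h + h q * act v f"
  using assms by (auto simp: tangent_space_def)

lemma act_nonsmooth: "v \<in> tangent_space A q \<Longrightarrow> \<not> smooth_at A q f \<Longrightarrow> act v f = 0"
  by (auto simp: tangent_space_def)

lemma act_plus:
  "v \<in> tangent_space A q \<Longrightarrow> smooth_at A q f \<Longrightarrow> smooth_at A q h \<Longrightarrow>
     act v (\<lambda>p. f p + h p) = act v f + act v h"
  using act_lin[of v q f h 1 1] by simp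

lemma act_minus:
  "v \<in> tangent_space A q \<Longrightarrow> smooth_at A q f \<Longrightarrow> smooth_at A q h \<Longrightarrow>
     act v (\<lambda>p. f p - h p) = act v f - act v h"
  using act_lin[of v q f h 1 "-1"] by simp

lemma act_const:
  assumes "v \<in> tangent_space A q"
  shows "act v (\<lambda>p. c) = 0"
  using act_lin[OF assms smooth_at_const smooth_at_const, of c 1 0 1]
    act_mult[OF assms smooth_at_const smooth_at_const, of 1 1] by simp

lemma act_cmult:
  "v \<in> tangent_space A q \<Longrightarrow> smooth_at A q f \<Longrightarrow> act v (\<lambda>p. c * f p) = c * act v f"
  by (simp add: act_mult smooth_at_const act_const)

text \<open>Multiplying a function that vanishes near \<open>q\<close> by the indicator function of its support, which
  vanishes near \<open>q\<close> as well, does not change it; so the Leibniz rule kills it.\<close>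

lemma act_local:
  assumes v: "v \<in> tangent_space A q" and W: "open W" "q \<in> W"
    and eq: "\<And>p. p \<in> W \<Longrightarrow> f p = h p"
  shows "act v f = act v h"
proof (cases "smooth_at A q f")
  case True
  then have h: "smooth_at A q h" using smooth_at_cong W eq by blast
  define d where "d = (\<lambda>p. f p - h p)"
  define i :: "'a \<Rightarrow> real" where "i = (\<lambda>p. if d p = 0 then 0 else 1)"
  have z: "smooth_at A q (\<lambda>p. 0)" by (rule smooth_at_const)
  have d: "smooth_at A q d" and i: "smooth_at A q i"
    using eq by (auto intro!: smooth_at_cong[OF z W] simp: d_def i_def)
  have "d = (\<lambda>p. d p * i p)" by (auto simp: i_def)
  then have "act v d = d q * act v i + i q * act v d"
    using act_mult[OF v d i] by simp
  also have "\<dots> = 0" using eq[OF W(2)] by (simp add: d_def i_def)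
  finally show ?thesis using act_minus[OF v True h] by (simp add: d_def)
next
  case False
  then have "\<not> smooth_at A q h" using smooth_at_cong[of q h W f] W eq by auto
  then show ?thesis using False act_nonsmooth[OF v] by simp
qed

lemma smooth_at_sum: "(\<And>i. i \<in> I \<Longrightarrow> smooth_at A q (f i)) \<Longrightarrow> smooth_at A q (\<lambda>p. \<Sum>i\<in>I. f i p)"
  by (induction I rule: infinite_finite_induct) (auto intro: smooth_at_const smooth_at_add)

lemma smooth_at_prod: "(\<And>i. i \<in> I \<Longrightarrow> smooth_at A q (f i)) \<Longrightarrow> smooth_at A q (\<lambda>p. \<Prod>i\<in>I. f i p)"
  by (induction I rule: infinite_finite_induct) (auto intro: smooth_at_const smooth_at_mult)

lemma act_of_sum:
  assumes "v \<in> tangent_space A q" "\<And>i. i \<in> I \<Longrightarrow> smooth_at A q (f i)"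
  shows "act v (\<lambda>p. \<Sum>i\<in>I. f i p) = (\<Sum>i\<in>I. act v (f i))"
  using assms(2)
  by (induction I rule: infinite_finite_induct) (auto simp: act_const[OF assms(1)] act_plus[OF assms(1)] smooth_at_sum)

lemma act_of_prod:
  assumes v: "v \<in> tangent_space A q" and "finite I" "\<And>i. i \<in> I \<Longrightarrow> smooth_at A q (f i)"
  shows "act v (\<lambda>p. \<Prod>i\<in>I. f i p) = (\<Sum>i\<in>I. act v (f i) * (\<Prod>j\<in>I - {i}. f j q))"
  using assms(2,3)
proof (induction I rule: finite_induct)
  case empty
  then show ?case by (simp add: act_const[OF v])
next
  case (insert x F)
  have "(\<Sum>i\<in>F. act v (f i) * (\<Prod>j\<in>insert x F - {i}. f j q))
      = (\<Sum>i\<in>F. f x q * (act v (f i) * (\<Prod>j\<in>F - {i}. f j q)))"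
  proof (rule sum.cong[OF refl])
    fix i assume "i \<in> F"
    then have "insert x F - {i} = insert x (F - {i})" using insert by auto
    then show "act v (f i) * (\<Prod>j\<in>insert x F - {i}. f j q)
      = f x q * (act v (f i) * (\<Prod>j\<in>F - {i}. f j q))"
      using insert by simp
  qed
  moreover have "insert x F - {x} = F" using insert by auto
  ultimately show ?case
    using insert by (simp add: act_mult[OF v] smooth_at_prod sum_distrib_left mult.commute)
qed

lemma smooth_vfD:
  assumes "smooth_vf A W X" "p \<in> W"
  shows "X p \<in> tangent_space A p" "open W"
  using assms by (auto simp: smooth_vf_def)

lemma smooth_vf_act: "smooth_vf A W X \<Longrightarrow> smooth_on A W f \<Longrightarrow> smooth_on A W (\<lambda>p. act (X p) f)"
  by (auto simp: smooth_vf_def)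

lemma smooth_vf_subset: "smooth_vf A W X \<Longrightarrow> open V \<Longrightarrow> V \<subseteq> W \<Longrightarrow> smooth_vf A V X"
  by (auto simp: smooth_vf_def)

lemma smooth_vf_cong:
  assumes "smooth_vf A W X" "\<And>p. p \<in> W \<Longrightarrow> X p = Y p"
  shows "smooth_vf A W Y"
  unfolding smooth_vf_def
proof (intro conjI allI impI ballI)
  fix V f assume V: "open V" "V \<subseteq> W" "smooth_on A V f"
  then have "smooth_on A V (\<lambda>p. act (X p) f)" using assms by (auto simp: smooth_vf_def)
  then show "smooth_on A V (\<lambda>p. act (Y p) f)"
    by (rule smooth_on_cong[OF V(1)]) (use V assms in auto)
next
  fix q assume "q \<in> W"
  then show "Y q \<in> tangent_space A q" using assms by (auto simp: smooth_vf_def)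
qed (use assms in \<open>auto simp: smooth_vf_def\<close>)

lemma smooth_vf_act_at:
  assumes "smooth_vf A W X" "q \<in> W" "smooth_at A q f"
  shows "smooth_at A q (\<lambda>p. act (X p) f)"
proof -
  obtain V where V: "open V" "q \<in> V" "smooth_on A V f" using assms(3) by (auto simp: smooth_at_def)
  have "smooth_on A (V \<inter> W) (\<lambda>p. act (X p) f)"
    using assms V smooth_on_subset[of V f "V \<inter> W"] by (auto simp: smooth_vf_def)
  then show ?thesis using V assms by (auto intro!: smooth_atI[of "V \<inter> W"] simp: smooth_vf_def)
qed

lemma smooth_vf_sum:
  assumes "open W" "\<And>i. i \<in> I \<Longrightarrow> smooth_vf A W (X i)" "\<And>i. i \<in> I \<Longrightarrow> smooth_on A W (f i)"
  shows "smooth_vf A W (\<lambda>p. \<Sum>i\<in>I. f i p *\<^sub>R X i p)"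
  unfolding smooth_vf_def
proof (intro conjI allI impI ballI)
  fix q assume "q \<in> W"
  then show "(\<Sum>i\<in>I. f i q *\<^sub>R X i q) \<in> tangent_space A q"
    using assms by (auto intro!: subspace_sum subspace_scale tangent_space_subspace simp: smooth_vf_def)
next
  fix V h assume V: "open V" "V \<subseteq> W" "smooth_on A V h"
  then show "smooth_on A V (\<lambda>q. act (\<Sum>i\<in>I. f i q *\<^sub>R X i q) h)"
    unfolding act_sum act_scale
    by (intro smooth_on_sum smooth_on_mult smooth_vf_act smooth_vf_subset[OF assms(2)] smooth_on_subset[OF assms(3)])
      auto
qed (use assms in auto)

text \<open>The difference is one sum over the disjoint union of a point and the index set, modelled by
  \<open>option\<close>, so that \<open>smooth_vf_sum\<close> applies.\<close>

lemma smooth_vf_diff_sum: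
  assumes "smooth_vf A W S" "\<And>i. i \<in> I \<Longrightarrow> smooth_vf A W (X i)" "\<And>i. i \<in> I \<Longrightarrow> smooth_on A W (f i)" "finite I"
  shows "smooth_vf A W (\<lambda>p. S p - (\<Sum>i\<in>I. f i p *\<^sub>R X i p))"
proof -
  have W: "open W" using assms(1) by (simp add: smooth_vf_def)
  have "smooth_vf A W (\<lambda>p. \<Sum>z\<in>insert None (Some ` I).
      (case z of None \<Rightarrow> 1 | Some i \<Rightarrow> - 1 * f i p) *\<^sub>R (case z of None \<Rightarrow> S | Some i \<Rightarrow> X i) p)"
    using assms by (intro smooth_vf_sum W)
      (auto split: option.splits intro!: smooth_on_const smooth_on_mult[OF W, of "\<lambda>p. - 1", simplified] W)
  then show ?thesis
    by (rule smooth_vf_cong) (simp add: assms(4) sum.reindex sum_negf)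
qed

lemma bracket_act: "act (bracket A X Y q) f = (if smooth_at A q f
     then act (X q) (\<lambda>p. act (Y p) f) - act (Y q) (\<lambda>p. act (X p) f) else 0)"
  by (simp add: bracket_def)

lemma bracket_antisym: "bracket A X Y q = - bracket A Y X q"
proof -
  have "bracket A X Y q + bracket A Y X q = 0"
    by (rule functional_eqI) (simp add: act_add bracket_act)
  then show ?thesis by (simp add: eq_neg_iff_add_eq_0)
qed

text \<open>Tangent vectors are local, so only the germs of the fields at \<open>q\<close> enter.\<close>

lemma bracket_local:
  assumes X: "X q \<in> tangent_space A q" "\<And>p. p \<in> W \<Longrightarrow> X p = X' p"
    and Y: "Y q \<in> tangent_space A q" "\<And>p. p \<in> W \<Longrightarrow> Y p = Y' p"
    and W: "open W" "q \<in> W"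
  shows "bracket A X Y q = bracket A X' Y' q"
proof (rule functional_eqI)
  fix f
  have "act (X q) (\<lambda>p. act (Y p) f) = act (X q) (\<lambda>p. act (Y' p) f)"
    by (rule act_local[OF X(1) W]) (simp add: Y)
  moreover have "act (Y q) (\<lambda>p. act (X p) f) = act (Y q) (\<lambda>p. act (X' p) f)"
    by (rule act_local[OF Y(1) W]) (simp add: X)
  ultimately show "act (bracket A X Y q) f = act (bracket A X' Y' q) f"
    using X(2)[OF W(2)] Y(2)[OF W(2)] by (simp add: bracket_act)
qed

text \<open>In \<open>X(Y(f h))\<close> the mixed terms \<open>X(f) Y(h) + Y(f) X(h)\<close> are symmetric in \<open>X\<close> and \<open>Y\<close>, so they cancel
  in the commutator, which is therefore again a derivation.\<close>

lemma smooth_vf_bracket: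
  assumes X: "smooth_vf A W X" and Y: "smooth_vf A W Y"
  shows "smooth_vf A W (bracket A X Y)"
  unfolding smooth_vf_def
proof (intro conjI allI impI ballI)
  show W: "open W" using X by (simp add: smooth_vf_def)
  fix q assume q: "q \<in> W"
  have Xq: "X q \<in> tangent_space A q" and Yq: "Y q \<in> tangent_space A q"
    using X Y q by (auto simp: smooth_vf_def)
  note Xs = smooth_vf_act_at[OF X q] and Ys = smooth_vf_act_at[OF Y q]
  note sm = Xs Ys smooth_at_add smooth_at_mult smooth_at_const
  show "bracket A X Y q \<in> tangent_space A q"
    unfolding tangent_space_def mem_Collect_eq
  proof (intro conjI allI impI)
    fix f h a b assume f: "smooth_at A q f" and h: "smooth_at A q h"
    obtain V where V: "open V" "q \<in> V" "V \<subseteq> W" "smooth_on A V f" "smooth_on A V h"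
    proof -
      obtain V where "open V" "q \<in> V" "smooth_on A V f" "smooth_on A V h"
        by (rule smooth_at_common[OF f h])
      then show ?thesis
        using W q by (intro that[of "V \<inter> W"]) (auto intro: smooth_on_subset)
    qed
    have at: "smooth_at A p f" "smooth_at A p h" "X p \<in> tangent_space A p" "Y p \<in> tangent_space A p" if "p \<in> V" for p
      using V that X Y by (auto simp: smooth_at_def smooth_vf_def)
    let ?lin = "\<lambda>p. a * f p + b * h p"
    have 1: "act (X q) (\<lambda>p. act (Y p) ?lin) = act (X q) (\<lambda>p. a * act (Y p) f + b * act (Y p) h)"
      by (rule act_local[OF Xq V(1,2)]) (blast intro: act_lin at)
    have 2: "act (Y q) (\<lambda>p. act (X p) ?lin) = act (Y q) (\<lambda>p. a * act (X p) f + b * act (X p) h)"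
      by (rule act_local[OF Yq V(1,2)]) (blast intro: act_lin at)
    show "act (bracket A X Y q) ?lin = a * act (bracket A X Y q) f + b * act (bracket A X Y q) h"
      unfolding bracket_act 1 2
      by (simp add: f h sm act_lin[OF Xq] act_lin[OF Yq] algebra_simps)
    let ?m = "\<lambda>p. f p * h p"
    have 3: "act (X q) (\<lambda>p. act (Y p) ?m) = act (X q) (\<lambda>p. f p * act (Y p) h + h p * act (Y p) f)"
      by (rule act_local[OF Xq V(1,2)]) (blast intro: act_mult at)
    have 4: "act (Y q) (\<lambda>p. act (X p) ?m) = act (Y q) (\<lambda>p. f p * act (X p) h + h p * act (X p) f)"
      by (rule act_local[OF Yq V(1,2)]) (blast intro: act_mult at)
    show "act (bracket A X Y q) ?m = f q * act (bracket A X Y q) h + h q * act (bracket A X Y q) f"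
      unfolding bracket_act 3 4
      by (simp add: f h sm act_mult[OF Xq] act_plus[OF Xq] act_mult[OF Yq] act_plus[OF Yq] algebra_simps)
  next
    fix f assume "\<not> smooth_at A q f"
    then show "act (bracket A X Y q) f = 0" by (simp add: bracket_act)
  qed
next
  fix V f assume V: "open V" "V \<subseteq> W" "smooth_on A V f"
  have X': "smooth_vf A V X" and Y': "smooth_vf A V Y" using X Y V smooth_vf_subset by auto
  have "smooth_on A V (\<lambda>q. act (X q) (\<lambda>p. act (Y p) f) - act (Y q) (\<lambda>p. act (X p) f))"
    by (intro smooth_on_diff smooth_vf_act X' Y' V)
  then show "smooth_on A V (\<lambda>q. act (bracket A X Y q) f)"
    by (rule smooth_on_cong[OF V(1)]) (use V in \<open>auto simp: bracket_act smooth_at_def\<close>)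
qed

text \<open>The Leibniz rule \<open>[X, u Y] = u [X, Y] + X(u) Y\<close>, summed up. All computations with brackets of fields
  given in a frame reduce to it, together with antisymmetry and locality.\<close>

lemma bracket_sum:
  assumes X: "smooth_vf A W X" and q: "q \<in> W"
    and Y: "\<And>i. i \<in> I \<Longrightarrow> smooth_vf A W (Y i)" and u: "\<And>i. i \<in> I \<Longrightarrow> smooth_on A W (u i)"
  shows "bracket A X (\<lambda>p. \<Sum>i\<in>I. u i p *\<^sub>R Y i p) q
     = (\<Sum>i\<in>I. u i q *\<^sub>R bracket A X (Y i) q + act (X q) (u i) *\<^sub>R Y i q)"
proof (rule functional_eqI)
  fix f
  have W: "open W" and Xq: "X q \<in> tangent_space A q" using X q by (auto simp: smooth_vf_def)
  have Yq: "Y i q \<in> tangent_space A q" if "i \<in> I" for i using Y that q by (auto simp: smooth_vf_def)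
  have uq: "smooth_at A q (u i)" if "i \<in> I" for i using u that q W by (auto simp: smooth_at_def)
  show "act (bracket A X (\<lambda>p. \<Sum>i\<in>I. u i p *\<^sub>R Y i p) q) f
     = act (\<Sum>i\<in>I. u i q *\<^sub>R bracket A X (Y i) q + act (X q) (u i) *\<^sub>R Y i q) f"
  proof (cases "smooth_at A q f")
    case True
    have Yf: "smooth_at A q (\<lambda>p. act (Y i p) f)" if "i \<in> I" for i
      using smooth_vf_act_at[OF Y q True] that by blast
    show ?thesis using True
      by (simp add: bracket_act act_sum act_scale act_add act_of_sum[OF Xq] act_mult[OF Xq] uq Yf
          smooth_at_mult sum_subtractf[symmetric] algebra_simps cong: sum.cong)
  next
    case False
    then show ?thesis using act_nonsmooth[OF Yq]
      by (simp add: bracket_act act_sum act_scale act_add)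
  qed
qed

end

section \<open>Alternating forms and frames\<close>

text \<open>Expanding every slot along \<open>x\<close> leaves values at tuples with entries from \<open>x\<close>. Such a tuple either
  has a repeated entry or is a permutation of \<open>x\<close>, and \<open>Q\<close> vanishes in both cases. The entries need not
  be vectors: besides forms on one tangent space this covers functionals of tuples of vector fields
  that are linear over smooth functions, such as a Lie derivative evaluated at a point.\<close>

lemma alternating_vanish:
  fixes Q :: "(nat \<Rightarrow> 'b) \<Rightarrow> real"
  assumes local: "\<And>v w. (\<And>i. i \<in> {1..n} \<Longrightarrow> v i = w i) \<Longrightarrow> Q v = Q w"
    and swap: "\<And>v i j. (\<And>l. l \<in> {1..n} \<Longrightarrow> v l \<in> M) \<Longrightarrow> i \<in> {1..n} \<Longrightarrow> j \<in> {1..n} \<Longrightarrow> i \<noteq> j \<Longrightarrow>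
      Q (v \<circ> Transposition.transpose i j) = - Q v"
    and x: "\<And>l. l \<in> {1..n} \<Longrightarrow> x l \<in> M"
    and expand: "\<And>v i. (\<And>l. l \<in> {1..n} \<Longrightarrow> v l \<in> M) \<Longrightarrow> i \<in> {1..n} \<Longrightarrow>
      \<exists>a. Q v = (\<Sum>l=1..n. a l * Q (v(i := x l)))"
    and zero: "Q x = 0" and v: "\<And>l. l \<in> {1..n} \<Longrightarrow> v l \<in> M"
  shows "Q v = 0"
proof -
  \<comment> \<open>A statement for all tuples \<open>v\<close>, because the induction over transpositions replaces the tuple.\<close>
  have perm: "\<forall>v. (\<forall>l\<in>{1..n}. v l \<in> M) \<longrightarrow> Q (v \<circ> p) = Q v \<or> Q (v \<circ> p) = - Q v"
    if "p permutes {1..n}" for p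
    using that finite_atLeastAtMost
  proof (induction rule: permutes_induct)
    case id
    then show ?case by simp
  next
    case (swap a b p)
    show ?case
    proof (intro allI impI)
      fix v assume v: "\<forall>l\<in>{1..n}. v l \<in> M"
      let ?t = "Transposition.transpose a b"
      have "\<forall>l\<in>{1..n}. (v \<circ> ?t) l \<in> M"
        using v swap by (auto simp: Transposition.transpose_def)
      then have "Q ((v \<circ> ?t) \<circ> p) = Q (v \<circ> ?t) \<or> Q ((v \<circ> ?t) \<circ> p) = - Q (v \<circ> ?t)"
        using swap by blast
      moreover have "Q (v \<circ> ?t) = - Q v" using assms(2)[of v a b] v swap by blast
      ultimately show "Q (v \<circ> (?t \<circ> p)) = Q v \<or> Q (v \<circ> (?t \<circ> p)) = - Q v"
        by (auto simp: comp_assoc)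
    qed
  qed
  have tuple: "Q (x \<circ> s) = 0" if s: "s ` {1..n} \<subseteq> {1..n}" for s
  proof (cases "inj_on s {1..n}")
    case True
    define p where "p = (\<lambda>i. if i \<in> {1..n} then s i else i)"
    have "bij_betw s {1..n} {1..n}"
      using True s by (simp add: bij_betw_def endo_inj_surj)
    then have "bij_betw p {1..n} {1..n}"
      by (rule bij_betw_cong[THEN iffD1, rotated]) (simp add: p_def)
    then have "p permutes {1..n}"
      by (rule bij_imp_permutes) (auto simp: p_def)
    then have "Q (x \<circ> p) = 0" using perm x zero by fastforce
    moreover have "Q (x \<circ> s) = Q (x \<circ> p)" by (rule local) (simp add: p_def)
    ultimately show ?thesis by simp
  next
    case False
    then obtain i j where ij: "i \<in> {1..n}" "j \<in> {1..n}" "i \<noteq> j" "s i = s j"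
      by (auto simp: inj_on_def)
    have "(x \<circ> s) \<circ> Transposition.transpose i j = x \<circ> s"
      using ij by (auto simp: fun_eq_iff Transposition.transpose_def)
    then have "Q (x \<circ> s) = - Q (x \<circ> s)"
      using swap[of "x \<circ> s" i j] ij x s by (auto simp: image_subset_iff)
    then show ?thesis by simp
  qed
  \<comment> \<open>Only the first \<open>t\<close> slots remain to be expanded.\<close>
  have "\<forall>v. (\<forall>l\<in>{1..n}. v l \<in> M) \<longrightarrow> (\<forall>l\<in>{t+1..n}. v l \<in> x ` {1..n}) \<longrightarrow> Q v = 0" if "t \<le> n" for t
    using that
  proof (induction t)
    case 0
    show ?case
    proof (intro allI impI)
      fix v assume "\<forall>l\<in>{0+1..n}. v l \<in> x ` {1..n}"
      then have "\<forall>l\<in>{1..n}. v l \<in> x ` {1..n}" by simp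
      then have "\<forall>l\<in>{1..n}. \<exists>s. v l = x s \<and> s \<in> {1..n}" by blast
      from bchoice[OF this] obtain s where s: "\<And>l. l \<in> {1..n} \<Longrightarrow> v l = x (s l) \<and> s l \<in> {1..n}"
        by blast
      then have "Q v = Q (x \<circ> s)" by (intro local) auto
      moreover have "s ` {1..n} \<subseteq> {1..n}" using s by auto
      ultimately show "Q v = 0" using tuple[of s] by simp
    qed
  next
    case (Suc t)
    show ?case
    proof (intro allI impI)
      fix v assume v: "\<forall>l\<in>{1..n}. v l \<in> M" "\<forall>l\<in>{Suc t+1..n}. v l \<in> x ` {1..n}"
      have i: "Suc t \<in> {1..n}" using Suc by auto
      obtain a where a: "Q v = (\<Sum>l=1..n. a l * Q (v(Suc t := x l)))" using expand[of v, OF _ i] v by blast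
      have "Q (v(Suc t := x l)) = 0" if "l \<in> {1..n}" for l
        using Suc v that x by auto
      then show "Q v = 0" using a by simp
    qed
  qed
  from this[of n] show ?thesis using v by auto
qed

lemma alternating_form_local:
  "alternating_form n V \<eta> \<Longrightarrow> (\<And>i. i \<in> {1..n} \<Longrightarrow> v i = w i) \<Longrightarrow> \<eta> v = \<eta> w"
  unfolding alternating_form_def by blast

lemma alternating_form_lin:
  "alternating_form n V \<eta> \<Longrightarrow> \<forall>j\<in>{1..n}. v j \<in> V \<Longrightarrow> i \<in> {1..n} \<Longrightarrow> x \<in> V \<Longrightarrow> y \<in> V \<Longrightarrow>
     \<eta> (v(i := a *\<^sub>R x + b *\<^sub>R y)) = a * \<eta> (v(i := x)) + b * \<eta> (v(i := y))"
  unfolding alternating_form_def by blast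

lemma alternating_form_eq:
  "alternating_form n V \<eta> \<Longrightarrow> \<forall>j\<in>{1..n}. v j \<in> V \<Longrightarrow> i \<in> {1..n} \<Longrightarrow> j \<in> {1..n} \<Longrightarrow> i \<noteq> j \<Longrightarrow>
     v i = v j \<Longrightarrow> \<eta> v = 0"
  unfolding alternating_form_def by blast

lemma alternating_form_sum:
  assumes \<eta>: "alternating_form n V \<eta>" and V: "subspace V"
    and v: "\<forall>j\<in>{1..n}. v j \<in> V" and i: "i \<in> {1..n}" and y: "\<And>l. l \<in> I \<Longrightarrow> y l \<in> V"
  shows "\<eta> (v(i := \<Sum>l\<in>I. a l *\<^sub>R y l)) = (\<Sum>l\<in>I. a l * \<eta> (v(i := y l)))"
  using y
proof (induction I rule: infinite_finite_induct)
  case (insert l I)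
  have "\<eta> (v(i := a l *\<^sub>R y l + 1 *\<^sub>R (\<Sum>l\<in>I. a l *\<^sub>R y l)))
      = a l * \<eta> (v(i := y l)) + 1 * \<eta> (v(i := \<Sum>l\<in>I. a l *\<^sub>R y l))"
    using insert V by (intro alternating_form_lin[OF \<eta> v i]) (auto intro: subspace_sum subspace_scale)
  then show ?case using insert by (simp del: fun_upd_apply)
qed (use alternating_form_lin[OF \<eta> v i, where a = 0 and b = 0 and x = 0 and y = 0] V subspace_0 in \<open>auto simp del: fun_upd_apply\<close>)

lemma alternating_form_swap:
  assumes \<eta>: "alternating_form n V \<eta>" and V: "subspace V"
    and v: "\<forall>j\<in>{1..n}. v j \<in> V" and ij: "i \<in> {1..n}" "j \<in> {1..n}" "i \<noteq> j"
  shows "\<eta> (v \<circ> Transposition.transpose i j) = - \<eta> v"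
proof -
  define F where "F a b = \<eta> (v(i := a, j := b))" for a b
  have F1: "F (a + a') b = F a b + F a' b" if "a \<in> V" "a' \<in> V" "b \<in> V" for a a' b
    using alternating_form_lin[OF \<eta>, of "v(j := b)" i a a' 1 1] v ij that
    by (simp add: F_def fun_upd_twist)
  have F2: "F b (a + a') = F b a + F b a'" if "a \<in> V" "a' \<in> V" "b \<in> V" for a a' b
    using alternating_form_lin[OF \<eta>, of "v(i := b)" j a a' 1 1] v ij that
    by (simp add: F_def)
  have F0: "F a a = 0" if "a \<in> V" for a
    unfolding F_def using v ij that by (intro alternating_form_eq[OF \<eta> _ ij]) auto
  let ?a = "v i" and ?b = "v j"
  have ab: "?a \<in> V" "?b \<in> V" "?a + ?b \<in> V" using v ij V by (auto intro: subspace_add)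
  then have "F (?a + ?b) (?a + ?b) = (F ?a ?a + F ?b ?a) + (F ?a ?b + F ?b ?b)" by (simp add: F1 F2)
  then have "F ?a ?b + F ?b ?a = 0" using F0[OF ab(1)] F0[OF ab(2)] F0[OF ab(3)] by linarith
  moreover have "F ?a ?b = \<eta> v" by (simp add: F_def)
  moreover have "F ?b ?a = \<eta> (v \<circ> Transposition.transpose i j)"
    unfolding F_def using ij by (intro arg_cong[where f = \<eta>]) (auto simp: fun_eq_iff Transposition.transpose_def)
  ultimately show ?thesis by simp
qed

lemma span_tuple:
  fixes x :: "nat \<Rightarrow> 'v::real_vector"
  assumes "inj_on x {1..N}"
  shows "v \<in> span (x ` {1..N}) \<longleftrightarrow> (\<exists>a. v = (\<Sum>l=1..N. a l *\<^sub>R x l))"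
proof
  assume "v \<in> span (x ` {1..N})"
  then obtain u where "v = (\<Sum>y\<in>x ` {1..N}. u y *\<^sub>R y)" by (auto simp: span_finite)
  then show "\<exists>a. v = (\<Sum>l=1..N. a l *\<^sub>R x l)" using assms by (auto simp: sum.reindex)
qed (auto intro: span_sum span_scale span_base)

lemma alternating_form_vanish:
  assumes \<eta>: "alternating_form n V \<eta>" and x: "basis_tuple n V x" and zero: "\<eta> x = 0"
    and v: "\<And>j. j \<in> {1..n} \<Longrightarrow> v j \<in> V"
  shows "\<eta> v = 0"
proof -
  have V: "subspace V" and xV: "\<And>l. l \<in> {1..n} \<Longrightarrow> x l \<in> V"
    using x by (auto simp: basis_tuple_def intro: span_base)
  show ?thesis
  proof (rule alternating_vanish[where Q = \<eta> and M = V and x = x])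
    show "\<eta> v = \<eta> w" if "\<And>i. i \<in> {1..n} \<Longrightarrow> v i = w i" for v w
      using that by (rule alternating_form_local[OF \<eta>])
    show "\<eta> (v \<circ> Transposition.transpose i j) = - \<eta> v"
      if "\<And>l. l \<in> {1..n} \<Longrightarrow> v l \<in> V" "i \<in> {1..n}" "j \<in> {1..n}" "i \<noteq> j" for v i j
      using that by (intro alternating_form_swap[OF \<eta> V]) auto
    show "\<exists>a. \<eta> v = (\<Sum>l=1..n. a l * \<eta> (v(i := x l)))"
      if v: "\<And>l. l \<in> {1..n} \<Longrightarrow> v l \<in> V" and i: "i \<in> {1..n}" for v i
    proof -
      obtain a where "v i = (\<Sum>l=1..n. a l *\<^sub>R x l)"
        using v[OF i] x span_tuple[of x n "v i"] by (auto simp: basis_tuple_def)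
      moreover have "\<forall>l\<in>{1..n}. v l \<in> V" using v by blast
      ultimately show ?thesis
        using alternating_form_sum[OF \<eta> V, of v i "{1..n}" x a] i xV by (intro exI[of _ a]) (metis fun_upd_triv)
    qed
  qed (use assms xV in auto)
qed

text \<open>The space of alternating forms of top degree is one-dimensional: the difference of the two sides
  vanishes on the basis.\<close>

lemma alternating_form_proportional:
  assumes \<eta>: "alternating_form n V \<eta>" and \<zeta>: "alternating_form n V \<zeta>" and x: "basis_tuple n V x"
    and v: "\<And>j. j \<in> {1..n} \<Longrightarrow> v j \<in> V"
  shows "\<eta> v * \<zeta> x = \<eta> x * \<zeta> v"
proof -
  define F where "F v = \<eta> v * \<zeta> x - \<eta> x * \<zeta> v" for v
  have "alternating_form n V F"
    unfolding alternating_form_def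
  proof (intro conjI allI impI)
    fix v w :: "nat \<Rightarrow> 'a" assume "\<forall>i\<in>{1..n}. v i = w i"
    then show "F v = F w"
      using alternating_form_local[OF \<eta>, of v w] alternating_form_local[OF \<zeta>, of v w] by (simp add: F_def)
  next
    fix v i a b x y assume v: "\<forall>j\<in>{1..n}. v j \<in> V" and xy: "i \<in> {1..n}" "x \<in> V" "y \<in> V"
    show "F (v(i := a *\<^sub>R x + b *\<^sub>R y)) = a * F (v(i := x)) + b * F (v(i := y))"
      using alternating_form_lin[OF \<eta> v xy] alternating_form_lin[OF \<zeta> v xy]
      by (simp add: F_def algebra_simps)
  next
    fix v i j assume "\<forall>l\<in>{1..n}. v l \<in> V" "i \<in> {1..n}" "j \<in> {1..n}" "i \<noteq> j" "v i = v j"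
    then have "\<eta> v = 0" "\<zeta> v = 0" using alternating_form_eq[OF \<eta>] alternating_form_eq[OF \<zeta>] by blast+
    then show "F v = 0" by (simp add: F_def)
  qed
  then have "F v = 0" by (rule alternating_form_vanish[OF _ x]) (use v in \<open>auto simp: F_def\<close>)
  then show ?thesis by (simp add: F_def)
qed

locale oriented_frame = manifold_atlas A
  for A :: "('a::{t2_space, second_countable_topology}, 'e::euclidean_space) atlas" +
  fixes n :: nat and \<omega> :: "'a \<Rightarrow> (nat \<Rightarrow> 'a functional) \<Rightarrow> real"
    and U :: "'a set" and X :: "nat \<Rightarrow> 'a \<Rightarrow> 'a functional"
  assumes orientation: "orientation_form A n \<omega>"
    and frame_vf: "\<And>i. i \<in> {1..n} \<Longrightarrow> smooth_vf A U (X i)"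
    and frame_basis: "\<And>p. p \<in> U \<Longrightarrow> basis_tuple n (tangent_space A p) (\<lambda>i. X i p)"
    and frame_open: "open U"
begin

text \<open>The \<open>l\<close>-th coordinate of \<open>v\<close> in the frame, by Cramer's rule for the form \<open>\<omega>\<close>. As \<open>\<omega>\<close> takes smooth
  values on smooth vector fields, this definition makes the coordinates of smooth vector fields smooth
  without any recourse to charts.\<close>

definition coord :: "'a \<Rightarrow> 'a functional \<Rightarrow> nat \<Rightarrow> real" where
  "coord p v l = \<omega> p ((\<lambda>i. X i p)(l := v)) / \<omega> p (\<lambda>i. X i p)"

lemma orientation_alternating: "alternating_form n (tangent_space A p) (\<omega> p)"
  using orientation by (auto simp: orientation_form_def)

lemma orientation_smooth:
  "open W \<Longrightarrow> (\<And>i. i \<in> {1..n} \<Longrightarrow> smooth_vf A W (Y i)) \<Longrightarrow> smooth_on A W (\<lambda>q. \<omega> q (\<lambda>i. Y i q))"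
  using orientation by (auto simp: orientation_form_def)

lemma orientation_nz: "p \<in> U \<Longrightarrow> \<omega> p (\<lambda>i. X i p) \<noteq> 0"
  using orientation frame_basis by (auto simp: orientation_form_def)

lemma frame_tangent: "p \<in> U \<Longrightarrow> i \<in> {1..n} \<Longrightarrow> X i p \<in> tangent_space A p"
  using frame_vf by (auto simp: smooth_vf_def)

lemma coord_frame: "p \<in> U \<Longrightarrow> i \<in> {1..n} \<Longrightarrow> l \<in> {1..n} \<Longrightarrow> coord p (X i p) l = (if i = l then 1 else 0)"
proof -
  assume p: "p \<in> U" and i: "i \<in> {1..n}" and l: "l \<in> {1..n}"
  have "\<omega> p ((\<lambda>i. X i p)(l := X i p)) = 0" if "i \<noteq> l"
    using that p i l frame_tangent
    by (intro alternating_form_eq[OF orientation_alternating[of p], of _ i l]) auto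
  moreover have "(\<lambda>i. X i p)(l := X l p) = (\<lambda>i. X i p)" by auto
  ultimately show ?thesis using orientation_nz[OF p] by (auto simp: coord_def)
qed

lemma coord_sum:
  assumes "p \<in> U" "l \<in> {1..n}" "\<And>i. i \<in> I \<Longrightarrow> v i \<in> tangent_space A p"
  shows "coord p (\<Sum>i\<in>I. a i *\<^sub>R v i) l = (\<Sum>i\<in>I. a i * coord p (v i) l)"
  using alternating_form_sum[OF orientation_alternating[of p] tangent_space_subspace, of "\<lambda>i. X i p" l I v a]
    assms frame_tangent by (simp add: coord_def sum_divide_distrib)

lemma coord_add:
  "p \<in> U \<Longrightarrow> l \<in> {1..n} \<Longrightarrow> v \<in> tangent_space A p \<Longrightarrow> w \<in> tangent_space A p \<Longrightarrow>
     coord p (v + w) l = coord p v l + coord p w l"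
  using alternating_form_lin[OF orientation_alternating[of p], of "\<lambda>i. X i p" l v w 1 1] frame_tangent
  by (simp add: coord_def add_divide_distrib)

lemma coord_scale:
  "p \<in> U \<Longrightarrow> l \<in> {1..n} \<Longrightarrow> v \<in> tangent_space A p \<Longrightarrow> coord p (r *\<^sub>R v) l = r * coord p v l"
  using coord_sum[of p l "{0::nat}" "\<lambda>_. v" "\<lambda>_. r"] by simp

lemma coord_diff:
  "p \<in> U \<Longrightarrow> l \<in> {1..n} \<Longrightarrow> v \<in> tangent_space A p \<Longrightarrow> w \<in> tangent_space A p \<Longrightarrow>
     coord p (v - w) l = coord p v l - coord p w l"
  using alternating_form_lin[OF orientation_alternating[of p], of "\<lambda>i. X i p" l v w 1 "-1"] frame_tangent
  by (simp add: coord_def diff_divide_distrib)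

lemma coord_zero: "p \<in> U \<Longrightarrow> l \<in> {1..n} \<Longrightarrow> coord p 0 l = 0"
  using coord_scale[of p l 0 0] subspace_0[OF tangent_space_subspace] by simp

lemma coord_of_comb:
  assumes "p \<in> U" "l \<in> {1..n}" "N \<le> n"
  shows "coord p (\<Sum>i=1..N. a i *\<^sub>R X i p) l = (if l \<le> N then a l else 0)"
proof -
  have "coord p (\<Sum>i=1..N. a i *\<^sub>R X i p) l = (\<Sum>i=1..N. a i * coord p (X i p) l)"
    using assms frame_tangent by (intro coord_sum) auto
  also have "\<dots> = (\<Sum>i=1..N. if i = l then a i else 0)"
    using assms by (intro sum.cong) (auto simp: coord_frame)
  also have "\<dots> = (if l \<le> N then a l else 0)" using assms by simp
  finally show ?thesis .
qed

lemma coord_expand: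
  assumes p: "p \<in> U" and v: "v \<in> tangent_space A p"
  shows "v = (\<Sum>l=1..n. coord p v l *\<^sub>R X l p)"
proof -
  obtain a where a: "v = (\<Sum>l=1..n. a l *\<^sub>R X l p)"
    using frame_basis[OF p] v span_tuple[of "\<lambda>i. X i p" n v] by (auto simp: basis_tuple_def)
  have "coord p v l = a l" if "l \<in> {1..n}" for l
    unfolding a using coord_of_comb[OF p that, of n a] that by auto
  then show ?thesis using a by simp
qed

lemma coord_smooth:
  assumes W: "W \<subseteq> U" "open W" and S: "smooth_vf A W S" and l: "l \<in> {1..n}"
  shows "smooth_on A W (\<lambda>p. coord p (S p) l)"
proof -
  have "smooth_vf A W ((X(l := S)) i)" if "i \<in> {1..n}" for i
    using S frame_vf[OF that] smooth_vf_subset W by auto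
  then have "smooth_on A W (\<lambda>q. \<omega> q (\<lambda>i. (X(l := S)) i q))"
    by (rule orientation_smooth[OF W(2)])
  moreover have "(\<lambda>i. (X(l := S)) i q) = (\<lambda>i. X i q)(l := S q)" for q by auto
  ultimately have 1: "smooth_on A W (\<lambda>q. \<omega> q ((\<lambda>i. X i q)(l := S q)))" by simp
  have "smooth_on A W (\<lambda>q. \<omega> q (\<lambda>i. X i q))"
    by (rule orientation_smooth[OF W(2)]) (use frame_vf smooth_vf_subset W in auto)
  then have "smooth_on A W (\<lambda>q. inverse (\<omega> q (\<lambda>i. X i q)))"
    by (rule smooth_on_inverse[OF W(2)]) (use orientation_nz W in auto)
  from smooth_on_mult[OF W(2) 1 this] show ?thesis by (simp add: coord_def field_simps)
qed

lemma mem_span_frame: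
  assumes p: "p \<in> U" and N: "N \<le> n"
  shows "v \<in> span ((\<lambda>i. X i p) ` {1..N}) \<longleftrightarrow> v \<in> tangent_space A p \<and> (\<forall>l\<in>{N+1..n}. coord p v l = 0)"
proof
  assume v: "v \<in> span ((\<lambda>i. X i p) ` {1..N})"
  have "inj_on (\<lambda>i. X i p) {1..N}"
    using frame_basis[OF p] N by (auto simp: basis_tuple_def intro: inj_on_subset)
  then obtain a where a: "v = (\<Sum>l=1..N. a l *\<^sub>R X l p)" using v span_tuple by blast
  show "v \<in> tangent_space A p \<and> (\<forall>l\<in>{N+1..n}. coord p v l = 0)"
    unfolding a using N coord_of_comb[OF p, of _ N a] frame_tangent[OF p]
    by (auto intro!: subspace_sum subspace_scale tangent_space_subspace)
next
  assume v: "v \<in> tangent_space A p \<and> (\<forall>l\<in>{N+1..n}. coord p v l = 0)"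
  have "v = (\<Sum>l=1..n. coord p v l *\<^sub>R X l p)" using coord_expand[OF p] v by blast
  also have "\<dots> = (\<Sum>l=1..N. coord p v l *\<^sub>R X l p)"
    using v N by (intro sum.mono_neutral_right) auto
  finally have eq: "v = (\<Sum>l=1..N. coord p v l *\<^sub>R X l p)" .
  show "v \<in> span ((\<lambda>i. X i p) ` {1..N})"
    by (subst eq, rule span_sum, rule span_scale, rule span_base) auto
qed

end

section \<open>The flag in an adapted frame\<close>

lemma multi_indices_0: "multi_indices k 0 = {[]}"
  by (auto simp: multi_indices_def)

lemma multi_indices_Suc: "multi_indices k (Suc j) = (\<lambda>(a, I). a # I) ` ({1..k} \<times> multi_indices k j)"
  by (auto simp: multi_indices_def length_Suc_conv image_iff)

lemma finite_multi_indices [simp]: "finite (multi_indices k j)"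
  by (induction j) (auto simp: multi_indices_0 multi_indices_Suc)

lemma sum_multi_indices_Suc:
  "(\<Sum>I\<in>multi_indices k (Suc j). F I) = (\<Sum>a=1..k. \<Sum>I\<in>multi_indices k j. F (a # I))"
  unfolding multi_indices_Suc
  by (subst sum.reindex) (auto simp: inj_on_def sum.cartesian_product case_prod_unfold comp_def)

lemma sum_multi_indices_1: "(\<Sum>I\<in>multi_indices k 1. F I) = (\<Sum>a=1..k. F [a])"
  using sum_multi_indices_Suc[of F k 0] by (simp add: multi_indices_0)

lemma basis_tuple_dim: "basis_tuple N V v \<Longrightarrow> dim V = N"
  unfolding basis_tuple_def by (metis card_atLeastAtMost card_image diff_Suc_1 dim_span_eq_card_independent)

context manifold_atlas
begin

text \<open>The case of constant coefficients of \<open>bracket_sum\<close>.\<close>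

lemma bracket_diff_sum:
  assumes X: "smooth_vf A W X" and q: "q \<in> W" and S: "smooth_vf A W S"
    and Y: "\<And>i. i \<in> I \<Longrightarrow> smooth_vf A W (Y i)" and fin: "finite I"
  shows "bracket A X (\<lambda>p. S p - (\<Sum>i\<in>I. a i *\<^sub>R Y i p)) q
     = bracket A X S q - (\<Sum>i\<in>I. a i *\<^sub>R bracket A X (Y i) q)"
proof -
  have W: "open W" and Xq: "X q \<in> tangent_space A q" using X q by (auto simp: smooth_vf_def)
  let ?u = "\<lambda>z (p::'a). case z of None \<Rightarrow> 1 | Some i \<Rightarrow> - a i"
  let ?Z = "\<lambda>z. case z of None \<Rightarrow> S | Some i \<Rightarrow> Y i"
  have "(\<lambda>p. S p - (\<Sum>i\<in>I. a i *\<^sub>R Y i p)) = (\<lambda>p. \<Sum>z\<in>insert None (Some ` I). ?u z p *\<^sub>R ?Z z p)"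
    by (simp add: fin sum.reindex sum_negf)
  then have "bracket A X (\<lambda>p. S p - (\<Sum>i\<in>I. a i *\<^sub>R Y i p)) q
      = (\<Sum>z\<in>insert None (Some ` I). ?u z q *\<^sub>R bracket A X (?Z z) q + act (X q) (?u z) *\<^sub>R ?Z z q)"
    by (simp only:, intro bracket_sum[OF X q]) (use S Y W in \<open>auto split: option.splits intro: smooth_on_const\<close>)
  also have "\<dots> = bracket A X S q - (\<Sum>i\<in>I. a i *\<^sub>R bracket A X (Y i) q)"
    by (simp add: fin sum.reindex sum_negf act_const[OF Xq])
  finally show ?thesis .
qed

end

text \<open>Rewriting with this equation would expose a span of a large comprehension in every goal about the
  flag.\<close>

declare flag.simps(3) [simp del]

locale adapted_frame_domain =
  fixes A :: "('a::{t2_space, second_countable_topology}, 'e::euclidean_space) atlas"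
    and D :: "'a \<Rightarrow> 'a functional set"
    and g :: "'a \<Rightarrow> 'a functional \<Rightarrow> 'a functional \<Rightarrow> real"
    and n k m :: nat
    and \<kappa> :: "nat \<Rightarrow> nat"
    and \<omega> :: "'a \<Rightarrow> (nat \<Rightarrow> 'a functional) \<Rightarrow> real"
    and U :: "'a set"
    and X :: "nat \<Rightarrow> 'a \<Rightarrow> 'a functional"
  assumes sub_riem: "sub_riemannian A n D k g"
    and equireg: "equiregular A D \<kappa>"
    and step: "has_step A D m"
    and orient: "orientation_form A n \<omega>"
    and frame: "adapted_frame A D g n k m \<kappa> U X"
    and nonempty: "U \<noteq> {}"
begin

sublocale oriented_frame A n \<omega> U X
  by unfold_locales
    (use sub_riem orient frame in \<open>auto simp: sub_riemannian_def adapted_frame_def adapted_basis_def\<close>)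

abbreviation "flg \<equiv> flag A D"
abbreviation "T I \<equiv> iter_bracket A (map X I)"

lemma flag_1: "flg (Suc 0) = D" by simp

lemma kappa_0: "\<kappa> 0 = 0"
proof -
  have "dim ({0} :: 'a functional set) = 0"
    using dim_span_eq_card_independent[of "{} :: 'a functional set"] independent_empty by simp
  then show ?thesis using equireg unfolding equiregular_def by (metis flag.simps(1))
qed

lemma kappa_1: "\<kappa> (Suc 0) = k"
proof -
  obtain q where "q \<in> U" using nonempty by auto
  obtain W Y where "q \<in> W" "\<forall>p\<in>W. basis_tuple k (D p) (\<lambda>i. Y i p)"
    using sub_riem unfolding sub_riemannian_def smooth_distribution_def by blast
  then have "dim (D q) = k" using basis_tuple_dim by blast
  then show ?thesis using equireg unfolding equiregular_def by (metis flag_1)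
qed

lemma kappa_m: "\<kappa> m = n"
proof -
  obtain q where q: "q \<in> U" using nonempty by auto
  have "dim (flg m q) = n"
    using step basis_tuple_dim[OF frame_basis[OF q]] by (simp add: has_step_def)
  then show ?thesis using equireg unfolding equiregular_def by metis
qed

lemma n_ge: "3 \<le> n" using sub_riem by (simp add: sub_riemannian_def)

lemma m_pos: "0 < m"
  using kappa_m kappa_0 n_ge by (metis gr0I not_numeral_le_zero)

lemma flag_span:
  assumes p: "p \<in> U" and j: "j \<le> m"
  shows "flg j p = span ((\<lambda>i. X i p) ` {1..\<kappa> j})"
proof (cases "j = 0")
  case True
  then show ?thesis by (simp add: kappa_0)
next
  case False
  then show ?thesis using frame p j by (auto simp: adapted_frame_def adapted_basis_def basis_tuple_def)
qed

lemma flag_subspace: "p \<in> U \<Longrightarrow> j \<le> m \<Longrightarrow> subspace (flg j p)"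
  by (simp add: flag_span)

lemma flag_mono_Suc: "p \<in> U \<Longrightarrow> Suc j \<le> m \<Longrightarrow> flg j p \<subseteq> flg (Suc j) p"
proof (cases j)
  case 0
  assume "p \<in> U" "Suc j \<le> m"
  then show ?thesis using subspace_0[OF flag_subspace[of p "Suc j"]] 0 by simp
next
  case (Suc i)
  show ?thesis unfolding Suc flag.simps(3)
  proof
    fix v assume "v \<in> flg (Suc i) p"
    then show "v \<in> flg (Suc i) p + span {bracket A X Y p |X Y W.
        p \<in> W \<and> is_section A (flg (Suc i)) W X \<and> is_section A D W Y}"
      using set_plus_intro[OF _ span_zero] by fastforce
  qed
qed

lemma flag_mono:
  assumes "p \<in> U" "j \<le> m" "i \<le> j"
  shows "flg i p \<subseteq> flg j p"
  using assms(3,2)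
proof (induction j rule: dec_induct)
  case (step j)
  then show ?case using flag_mono_Suc[OF assms(1), of j] by auto
qed simp

text \<open>An adapted basis of the smaller space is independent in the span of the larger one.\<close>

lemma kappa_mono:
  assumes "j \<le> m" "i \<le> j"
  shows "\<kappa> i \<le> \<kappa> j"
proof (cases "i = 0")
  case False
  obtain p where p: "p \<in> U" using nonempty by auto
  have b: "basis_tuple (\<kappa> i) (flg i p) (\<lambda>i. X i p)"
    using frame p False assms by (auto simp: adapted_frame_def adapted_basis_def)
  have "(\<lambda>i. X i p) ` {1..\<kappa> i} \<subseteq> flg i p"
    using assms by (auto simp: flag_span[OF p] intro: span_base)
  also have "\<dots> \<subseteq> span ((\<lambda>i. X i p) ` {1..\<kappa> j})"
    using flag_mono[OF p assms] flag_span[OF p assms(1)] by simp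
  finally have "card ((\<lambda>i. X i p) ` {1..\<kappa> i}) \<le> card ((\<lambda>i. X i p) ` {1..\<kappa> j})"
    using b independent_span_bound[of "(\<lambda>i. X i p) ` {1..\<kappa> j}" "(\<lambda>i. X i p) ` {1..\<kappa> i}"]
    by (auto simp: basis_tuple_def)
  also have "\<dots> \<le> \<kappa> j" using card_image_le[of "{1..\<kappa> j}" "\<lambda>i. X i p"] by simp
  finally show ?thesis using b by (simp add: basis_tuple_def card_image)
qed (simp add: kappa_0)

lemma kappa_le_n: "j \<le> m \<Longrightarrow> \<kappa> j \<le> n"
  using kappa_mono[of m j] kappa_m by simp

lemma k_le_n: "k \<le> n"
  using kappa_le_n[of "Suc 0"] kappa_1 m_pos by simp

lemma mem_flag:
  "p \<in> U \<Longrightarrow> j \<le> m \<Longrightarrow> v \<in> flg j p \<longleftrightarrow> v \<in> tangent_space A p \<and> (\<forall>l\<in>{\<kappa> j + 1..n}. coord p v l = 0)"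
  unfolding flag_span by (rule mem_span_frame) (auto intro: kappa_le_n)

lemma flag_tangent: "p \<in> U \<Longrightarrow> j \<le> m \<Longrightarrow> v \<in> flg j p \<Longrightarrow> v \<in> tangent_space A p"
  using mem_flag by blast

lemma frame_in_flag: "p \<in> U \<Longrightarrow> j \<le> m \<Longrightarrow> l \<in> {1..\<kappa> j} \<Longrightarrow> X l p \<in> flg j p"
  by (auto simp: flag_span intro: span_base)

lemma flag_expand:
  assumes p: "p \<in> U" and j: "j \<le> m" and v: "v \<in> flg j p"
  shows "v = (\<Sum>l=1..\<kappa> j. coord p v l *\<^sub>R X l p)"
proof -
  have "v = (\<Sum>l=1..n. coord p v l *\<^sub>R X l p)" using coord_expand[OF p] flag_tangent[OF p j v] by blast
  also have "\<dots> = (\<Sum>l=1..\<kappa> j. coord p v l *\<^sub>R X l p)"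
    using v mem_flag[OF p j] kappa_le_n[OF j] by (intro sum.mono_neutral_right) auto
  finally show ?thesis .
qed

lemma D_expand: "p \<in> U \<Longrightarrow> v \<in> D p \<Longrightarrow> v = (\<Sum>a=1..k. coord p v a *\<^sub>R X a p)"
  using flag_expand[of p "Suc 0" v] m_pos kappa_1 by simp

lemma frame_in_D: "p \<in> U \<Longrightarrow> a \<in> {1..k} \<Longrightarrow> X a p \<in> D p"
  using frame_in_flag[of p "Suc 0" a] m_pos kappa_1 by simp

lemma section_vf: "is_section A E W S \<Longrightarrow> smooth_vf A W S"
  by (simp add: is_section_def)

lemma section_mem: "is_section A E W S \<Longrightarrow> q \<in> W \<Longrightarrow> S q \<in> E q"
  by (simp add: is_section_def)

lemma section_subset: "is_section A E W S \<Longrightarrow> open V \<Longrightarrow> V \<subseteq> W \<Longrightarrow> is_section A E V S"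
  by (auto simp: is_section_def intro: smooth_vf_subset)

lemma frame_section: "W \<subseteq> U \<Longrightarrow> open W \<Longrightarrow> j \<le> m \<Longrightarrow> l \<in> {1..\<kappa> j} \<Longrightarrow> is_section A (flg j) W (X l)"
  using kappa_le_n[of j] frame_in_flag
  by (auto simp: is_section_def intro!: smooth_vf_subset[OF frame_vf])

lemma frame_section_D: "W \<subseteq> U \<Longrightarrow> open W \<Longrightarrow> a \<in> {1..k} \<Longrightarrow> is_section A D W (X a)"
  using frame_section[of W "Suc 0" a] m_pos kappa_1 by simp

lemma bracket_in_flag:
  assumes S: "is_section A (flg j) W S" and Y: "is_section A D W Y"
    and q: "q \<in> W" "q \<in> U" and j: "1 \<le> j" "j \<le> m"
  shows "bracket A Y S q \<in> flg (Suc j) q"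
proof -
  obtain i where i: "j = Suc i" using j by (cases j) auto
  have "bracket A S Y q \<in> span {bracket A X Y q | X Y W.
       q \<in> W \<and> is_section A (flg (Suc i)) W X \<and> is_section A D W Y}"
    using S Y q i by (intro span_base) blast
  then have "bracket A Y S q \<in> span {bracket A X Y q | X Y W.
       q \<in> W \<and> is_section A (flg (Suc i)) W X \<and> is_section A D W Y}"
    unfolding bracket_antisym[of Y S] by (rule span_neg)
  moreover have "0 \<in> flg (Suc i) q" using flag_subspace[OF q(2) j(2)] i subspace_0 by blast
  ultimately have "0 + bracket A Y S q \<in> flg (Suc i) q + span {bracket A X Y q | X Y W.
       q \<in> W \<and> is_section A (flg (Suc i)) W X \<and> is_section A D W Y}"
    by (intro set_plus_intro)
  then show ?thesis unfolding i flag.simps(3) add_0 .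
qed

lemma iter_bracket_section:
  assumes W: "W \<subseteq> U" "open W" and V: "\<And>V. V \<in> set Vs \<Longrightarrow> is_section A D W V"
    and len: "1 \<le> length Vs" "length Vs \<le> m"
  shows "is_section A (flg (length Vs)) W (iter_bracket A Vs)"
  using V len
proof (induction Vs rule: induct_list012)
  case (3 V V' Vs)
  let ?S = "iter_bracket A (V' # Vs)"
  have S: "is_section A (flg (length (V' # Vs))) W ?S" using 3 by auto
  have Y: "is_section A D W V" using 3 by auto
  have "bracket A V ?S q \<in> flg (Suc (length (V' # Vs))) q" if "q \<in> W" for q
    using bracket_in_flag[OF S Y that] that W 3 by auto
  then show ?case
    using smooth_vf_bracket[OF section_vf[OF Y] section_vf[OF S]]
    unfolding is_section_def iter_bracket.simps(3) length_Cons[of V] by blast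
next
  case (2 V)
  have "is_section A D W V" by (rule 2(1)) (rule list.set_intros)
  then show ?case by (simp only: iter_bracket.simps(2) list.size add_0 One_nat_def[symmetric] flag_1[folded One_nat_def])
next
  case 1
  then show ?case by (simp only: list.size)
qed

lemma T_section:
  assumes "W \<subseteq> U" "open W" "I \<in> multi_indices k j" "1 \<le> j" "j \<le> m"
  shows "is_section A (flg j) W (T I)"
proof -
  have I: "length (map X I) = j" "set I \<subseteq> {1..k}" using assms(3) by (auto simp: multi_indices_def)
  have "is_section A D W V" if "V \<in> set (map X I)" for V
    using that I frame_section_D[OF assms(1,2)] by auto
  then show ?thesis
    using iter_bracket_section[of W "map X I", OF assms(1,2)] assms(4,5) unfolding I(1) by blast
qed

lemma T_Cons: "I \<in> multi_indices k j \<Longrightarrow> 1 \<le> j \<Longrightarrow> T (a # I) = bracket A (X a) (T I)"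
  by (cases I) (auto simp: multi_indices_def)

text \<open>Bracketing with a section of \<open>D\<close> induces a map on the graded pieces that is tensorial: write
  \<open>S = \<Sum> f\<^sub>l X\<^sub>l\<close> with smooth \<open>f\<^sub>l\<close>. The frame fields of lower degree bracket into the flag of degree \<open>j\<close>; the
  coefficients \<open>f\<^sub>l\<close> of those of degree exactly \<open>j\<close> vanish at \<open>q\<close>, which leaves only derivatives of \<open>f\<^sub>l\<close>
  times \<open>X\<^sub>l\<close>.\<close>

lemma bracket_tensorial:
  assumes W: "W \<subseteq> U" "open W" and q: "q \<in> W" and j: "1 \<le> j" "j \<le> m"
    and S: "is_section A (flg j) W S" and Y: "is_section A D W Y"
    and Sq: "S q \<in> flg (j - 1) q"
  shows "bracket A Y S q \<in> flg j q"
proof -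
  have qU: "q \<in> U" using q W by auto
  have vf: "smooth_vf A W S" "smooth_vf A W Y" using S Y section_vf by auto
  have Xvf: "smooth_vf A W (X l)" if "l \<in> {1..\<kappa> j}" for l
    using frame_section[OF W j(2) that] section_vf by blast
  have cfs: "smooth_on A W (\<lambda>p. coord p (S p) l)" if "l \<in> {1..\<kappa> j}" for l
    using coord_smooth[OF W vf(1)] that kappa_le_n[OF j(2)] by auto
  have "bracket A Y S q = bracket A Y (\<lambda>p. \<Sum>l=1..\<kappa> j. coord p (S p) l *\<^sub>R X l p) q"
  proof (rule bracket_local[OF _ refl _ _ W(2) q])
    show "S p = (\<Sum>l=1..\<kappa> j. coord p (S p) l *\<^sub>R X l p)" if "p \<in> W" for p
      using flag_expand[OF _ j(2) section_mem[OF S that]] that W by auto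
  qed (use vf q in \<open>auto intro: smooth_vfD\<close>)
  also have "\<dots> = (\<Sum>l=1..\<kappa> j. coord q (S q) l *\<^sub>R bracket A Y (X l) q + act (Y q) (\<lambda>p. coord p (S p) l) *\<^sub>R X l q)"
    using cfs Xvf by (intro bracket_sum[OF vf(2) q]) auto
  also have "\<dots> \<in> flg j q"
  proof (intro subspace_sum subspace_add flag_subspace qU j(2))
    fix l assume l: "l \<in> {1..\<kappa> j}"
    show "act (Y q) (\<lambda>p. coord p (S p) l) *\<^sub>R X l q \<in> flg j q"
      by (intro subspace_scale flag_subspace frame_in_flag qU j l)
    show "coord q (S q) l *\<^sub>R bracket A Y (X l) q \<in> flg j q"
    proof (cases "l \<le> \<kappa> (j - 1)")
      case True
      then have "j - 1 \<noteq> 0" using l kappa_0 by (metis atLeastAtMost_iff le_zero_eq not_one_le_zero)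
      then have "bracket A Y (X l) q \<in> flg (Suc (j - 1)) q"
        using True l j by (intro bracket_in_flag[OF frame_section[OF W] Y q qU]) auto
      then show ?thesis using j by (intro subspace_scale flag_subspace qU) auto
    next
      case False
      then have "coord q (S q) l = 0"
        using Sq mem_flag[OF qU, of "j - 1"] j l kappa_le_n[OF j(2)] by auto
      then show ?thesis using subspace_0[OF flag_subspace[OF qU j(2)]] by simp
    qed
  qed
  finally show ?thesis .
qed

lemma bracket_T_expand:
  assumes W: "W \<subseteq> U" "open W" and q: "q \<in> W" and j: "1 \<le> j" "j \<le> m"
    and I: "I \<in> multi_indices k j" and Y: "is_section A D W Y"
  shows "bracket A Y (T I) q - (\<Sum>a=1..k. coord q (Y q) a *\<^sub>R T (a # I) q) \<in> flg j q"
proof -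
  have qU: "q \<in> U" using q W by auto
  have vf: "smooth_vf A W (T I)" "smooth_vf A W Y" using T_section[OF W I j] Y section_vf by auto
  have Xvf: "smooth_vf A W (X a)" if "a \<in> {1..k}" for a
    using frame_section_D[OF W that] section_vf by blast
  have cfs: "smooth_on A W (\<lambda>p. coord p (Y p) a)" if "a \<in> {1..k}" for a
    using coord_smooth[OF W vf(2)] that k_le_n by auto
  have "bracket A (T I) Y q = bracket A (T I) (\<lambda>p. \<Sum>a=1..k. coord p (Y p) a *\<^sub>R X a p) q"
  proof (rule bracket_local[OF _ refl _ _ W(2) q])
    show "Y p = (\<Sum>a=1..k. coord p (Y p) a *\<^sub>R X a p)" if "p \<in> W" for p
      using D_expand[OF _ section_mem[OF Y that]] that W by auto
  qed (use vf q in \<open>auto intro: smooth_vfD\<close>)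
  also have "\<dots> = (\<Sum>a=1..k. coord q (Y q) a *\<^sub>R bracket A (T I) (X a) q + act (T I q) (\<lambda>p. coord p (Y p) a) *\<^sub>R X a q)"
    using cfs Xvf by (intro bracket_sum[OF vf(1) q]) auto
  also have "\<dots> = (\<Sum>a=1..k. act (T I q) (\<lambda>p. coord p (Y p) a) *\<^sub>R X a q) - (\<Sum>a=1..k. coord q (Y q) a *\<^sub>R T (a # I) q)"
    using bracket_antisym[of "T I" _ q] by (simp add: T_Cons[OF I j(1), symmetric] sum.distrib sum_negf sum_subtractf)
  finally have "bracket A Y (T I) q - (\<Sum>a=1..k. coord q (Y q) a *\<^sub>R T (a # I) q)
      = - (\<Sum>a=1..k. act (T I q) (\<lambda>p. coord p (Y p) a) *\<^sub>R X a q)"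
    unfolding bracket_antisym[of Y "T I"] by simp
  also have "\<dots> \<in> flg j q"
    using flag_mono[OF qU j(2), of "Suc 0"] j frame_in_D[OF qU]
    by (intro subspace_neg subspace_sum subspace_scale flag_subspace qU j) auto
  finally show ?thesis .
qed

text \<open>This is the inductive step behind both properties of \<open>\<pi>\<^sub>j\<close> that are needed, its multilinearity and its
  surjectivity. Only the values at \<open>q\<close> have to agree modulo lower order, so constant coefficients \<open>\<beta>\<close>
  suffice; \<open>bracket_tensorial\<close> takes care of the difference.\<close>

lemma bracket_expand:
  assumes W: "W \<subseteq> U" "open W" and q: "q \<in> W" and j: "1 \<le> j" "j \<le> m"
    and S: "is_section A (flg j) W S" and Y: "is_section A D W Y"
    and Sq: "S q - (\<Sum>I\<in>multi_indices k j. \<beta> I *\<^sub>R T I q) \<in> flg (j - 1) q"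
  shows "bracket A Y S q - (\<Sum>a=1..k. \<Sum>I\<in>multi_indices k j. (coord q (Y q) a * \<beta> I) *\<^sub>R T (a # I) q) \<in> flg j q"
proof -
  have qU: "q \<in> U" using q W by auto
  have vf: "smooth_vf A W S" "smooth_vf A W Y" using S Y section_vf by auto
  have Tvf: "smooth_vf A W (T I)" if "I \<in> multi_indices k j" for I
    using T_section[OF W that j] section_vf by blast
  let ?S = "\<lambda>p. S p - (\<Sum>I\<in>multi_indices k j. \<beta> I *\<^sub>R T I p)"
  have "smooth_vf A W ?S"
    by (intro smooth_vf_diff_sum vf Tvf smooth_on_const W) auto
  moreover have "?S p \<in> flg j p" if "p \<in> W" for p
    using that W section_mem[OF S that] section_mem[OF T_section[OF W _ j] that]
    by (intro subspace_diff subspace_sum subspace_scale flag_subspace j) auto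
  ultimately have "is_section A (flg j) W ?S" by (simp add: is_section_def)
  from bracket_tensorial[OF W q j this Y Sq]
  have 1: "bracket A Y S q - (\<Sum>I\<in>multi_indices k j. \<beta> I *\<^sub>R bracket A Y (T I) q) \<in> flg j q"
    using bracket_diff_sum[OF vf(2) q vf(1), of "multi_indices k j" T \<beta>] Tvf by simp
  have 2: "(\<Sum>I\<in>multi_indices k j. \<beta> I *\<^sub>R (bracket A Y (T I) q - (\<Sum>a=1..k. coord q (Y q) a *\<^sub>R T (a # I) q))) \<in> flg j q"
    by (intro subspace_sum subspace_scale bracket_T_expand[OF W q j _ Y] flag_subspace j qU)
  have "(\<Sum>I\<in>multi_indices k j. \<beta> I *\<^sub>R (bracket A Y (T I) q - (\<Sum>a=1..k. coord q (Y q) a *\<^sub>R T (a # I) q)))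
      = (\<Sum>I\<in>multi_indices k j. \<beta> I *\<^sub>R bracket A Y (T I) q)
        - (\<Sum>I\<in>multi_indices k j. \<Sum>a=1..k. (coord q (Y q) a * \<beta> I) *\<^sub>R T (a # I) q)"
    by (simp add: scaleR_diff_right sum_subtractf scaleR_sum_right mult.commute)
  also have "(\<Sum>I\<in>multi_indices k j. \<Sum>a=1..k. (coord q (Y q) a * \<beta> I) *\<^sub>R T (a # I) q)
      = (\<Sum>a=1..k. \<Sum>I\<in>multi_indices k j. (coord q (Y q) a * \<beta> I) *\<^sub>R T (a # I) q)"
    by (rule sum.swap)
  finally show ?thesis
    using subspace_add[OF flag_subspace[OF qU j(2)] 1 2] by simp
qed

text \<open>Repeated use of \<open>bracket_expand\<close>. The coefficients involve the sections through their values at \<open>q\<close> only,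
  and multilinearly; so \<open>\<pi>\<^sub>j\<close> is well defined and multilinear.\<close>

lemma iter_bracket_expand:
  assumes W: "W \<subseteq> U" "open W" and q: "q \<in> W" and V: "\<And>V. V \<in> set Vs \<Longrightarrow> is_section A D W V"
    and len: "1 \<le> length Vs" "length Vs \<le> m"
  shows "iter_bracket A Vs q - (\<Sum>I\<in>multi_indices k (length Vs).
     (\<Prod>l<length Vs. coord q ((Vs ! l) q) (I ! l)) *\<^sub>R T I q) \<in> flg (length Vs - 1) q"
  using V len
proof (induction Vs rule: induct_list012)
  case (2 V)
  have "V q = (\<Sum>a=1..k. coord q (V q) a *\<^sub>R X a q)"
    using 2 q W by (intro D_expand section_mem[of D W V]) auto
  then show ?case by (simp add: sum_multi_indices_1[simplified])
next
  case (3 V V' Vs)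
  let ?Vs = "V' # Vs" and ?j = "length (V' # Vs)"
  have j: "1 \<le> ?j" "?j \<le> m" using 3 by auto
  have S: "is_section A (flg ?j) W (iter_bracket A ?Vs)"
    by (rule iter_bracket_section[OF W]) (use 3 in auto)
  have Y: "is_section A D W V" using 3 by auto
  have IH: "iter_bracket A ?Vs q - (\<Sum>I\<in>multi_indices k ?j.
     (\<Prod>l<?j. coord q ((?Vs ! l) q) (I ! l)) *\<^sub>R T I q) \<in> flg (?j - 1) q"
    using 3 by auto
  show ?case
    using bracket_expand[OF W q j S Y IH]
    unfolding length_Cons[of V] sum_multi_indices_Suc
    by (simp add: prod.lessThan_Suc_shift del: prod.lessThan_Suc)
qed auto

text \<open>The vectors that are combinations of the \<open>T I\<close> modulo lower order form a subspace, which by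
  \<open>bracket_expand\<close> contains the brackets that generate the next step of the flag. So \<open>\<pi>\<^sub>j\<close> is onto.\<close>

lemma popp_surjective:
  assumes p: "p \<in> U" and j: "1 \<le> j" "j \<le> m" and v: "v \<in> flg j p"
  shows "\<exists>\<beta>. v - (\<Sum>I\<in>multi_indices k j. \<beta> I *\<^sub>R T I p) \<in> flg (j - 1) p"
  using j v
proof (induction j arbitrary: v rule: nat_induct_at_least)
  case base
  have "v = (\<Sum>a=1..k. coord p v a *\<^sub>R X a p)" using base by (intro D_expand[OF p]) auto
  then have "v - (\<Sum>I\<in>multi_indices k 1. coord p v (hd I) *\<^sub>R T I p) = 0"
    by (subst sum_multi_indices_1) simp
  then have "v - (\<Sum>I\<in>multi_indices k 1. coord p v (hd I) *\<^sub>R T I p) \<in> flg (1 - 1) p" by simp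
  then show ?case by (intro exI[of _ "\<lambda>I. coord p v (hd I)"])
next
  case (Suc j)
  then obtain i where i: "j = Suc i" by (cases j) auto
  let ?P = "{v. \<exists>\<beta>. v - (\<Sum>I\<in>multi_indices k (Suc j). \<beta> I *\<^sub>R T I p) \<in> flg j p}"
  have j: "1 \<le> j" "j \<le> m" using Suc by auto
  note sub = flag_subspace[OF p j(2)]
  have P: "subspace ?P"
  proof (rule subspaceI)
    show "0 \<in> ?P" using subspace_0[OF sub] by (auto intro!: exI[of _ "\<lambda>_. 0"])
  next
    fix x y assume "x \<in> ?P" "y \<in> ?P"
    then obtain \<beta> \<gamma> where "x - (\<Sum>I\<in>multi_indices k (Suc j). \<beta> I *\<^sub>R T I p) \<in> flg j p"
       "y - (\<Sum>I\<in>multi_indices k (Suc j). \<gamma> I *\<^sub>R T I p) \<in> flg j p" by auto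
    from subspace_add[OF sub this]
    show "x + y \<in> ?P"
      by (auto intro!: exI[of _ "\<lambda>I. \<beta> I + \<gamma> I"] simp: scaleR_add_left sum.distrib algebra_simps)
  next
    fix r x assume "x \<in> ?P"
    then obtain \<beta> where "x - (\<Sum>I\<in>multi_indices k (Suc j). \<beta> I *\<^sub>R T I p) \<in> flg j p" by auto
    from subspace_scale[OF sub this, of r]
    show "r *\<^sub>R x \<in> ?P"
      by (auto intro!: exI[of _ "\<lambda>I. r * \<beta> I"] simp: scaleR_diff_right scaleR_sum_right)
  qed
  have "{bracket A S Y p | S Y W.
       p \<in> W \<and> is_section A (flg (Suc i)) W S \<and> is_section A D W Y} \<subseteq> ?P"
  proof clarify
    fix S Y W assume pW: "p \<in> W" and S: "is_section A (flg (Suc i)) W S" and Y: "is_section A D W Y"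
    have W': "W \<inter> U \<subseteq> U" "open (W \<inter> U)" "p \<in> W \<inter> U"
      using pW p frame_open section_vf[OF S] by (auto simp: smooth_vf_def)
    have S': "is_section A (flg j) (W \<inter> U) S" and Y': "is_section A D (W \<inter> U) Y"
      using S Y section_subset W' i by auto
    obtain \<beta> where "S p - (\<Sum>I\<in>multi_indices k j. \<beta> I *\<^sub>R T I p) \<in> flg (j - 1) p"
      using Suc.IH[OF j(2)] section_mem[OF S' W'(3)] by blast
    from bracket_expand[OF W' j S' Y' this]
    have "- (bracket A Y S p - (\<Sum>a=1..k. \<Sum>I\<in>multi_indices k j. (coord p (Y p) a * \<beta> I) *\<^sub>R T (a # I) p)) \<in> flg j p"
      by (rule subspace_neg[OF sub])
    then have "bracket A S Y p - (\<Sum>I\<in>multi_indices k (Suc j). (- coord p (Y p) (hd I) * \<beta> (tl I)) *\<^sub>R T I p) \<in> flg j p"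
      unfolding bracket_antisym[of S Y] sum_multi_indices_Suc by (simp add: sum_negf)
    then show "\<exists>\<beta>. bracket A S Y p - (\<Sum>I\<in>multi_indices k (Suc j). \<beta> I *\<^sub>R T I p) \<in> flg j p"
      by (intro exI[of _ "\<lambda>I. - coord p (Y p) (hd I) * \<beta> (tl I)"])
  qed
  then have B: "span {bracket A S Y p | S Y W.
       p \<in> W \<and> is_section A (flg (Suc i)) W S \<and> is_section A D W Y} \<subseteq> ?P"
    using P by (rule span_minimal)
  have F: "flg (Suc i) p \<subseteq> ?P" using i by (auto intro!: exI[of _ "\<lambda>_. 0"])
  have "flg (Suc (Suc i)) p \<subseteq> ?P"
    unfolding flag.simps(3)
  proof
    fix v assume "v \<in> flg (Suc i) p + span {bracket A S Y p | S Y W.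
       p \<in> W \<and> is_section A (flg (Suc i)) W S \<and> is_section A D W Y}"
    then show "v \<in> ?P"
    proof (rule set_plus_elim)
      fix a b assume "v = a + b" "a \<in> flg (Suc i) p" "b \<in> span {bracket A S Y p | S Y W.
         p \<in> W \<and> is_section A (flg (Suc i)) W S \<and> is_section A D W Y}"
      then show "v \<in> ?P" using subspace_add[OF P subsetD[OF F] subsetD[OF B]] by blast
    qed
  qed
  then show ?case using Suc i by auto
qed

end

section \<open>The inner product on a layer of the graded space\<close>

text \<open>In this lemma and the next two, \<open>\<beta> I\<close> is the image of the \<open>I\<close>-th vector of an orthonormal basis under
  a linear map, and \<open>G\<close> inverts the Gram matrix \<open>\<Sum>\<^sub>I \<beta> I h \<beta> I i\<close>. The preimage of \<open>y\<close> of least norm has the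
  coordinates \<open>\<zeta> I = \<Sum>\<^sub>i \<beta> I i (G y)\<^sub>i\<close>: it is a preimage, and every other preimage \<open>z\<close> has the same inner
  product with \<open>\<zeta>\<close> as \<open>\<zeta>\<close> itself, so that \<open>z - \<zeta>\<close> is orthogonal to \<open>\<zeta>\<close>.\<close>

lemma least_norm_dual:
  fixes \<beta> :: "'i \<Rightarrow> nat \<Rightarrow> real"
  assumes inv: "\<And>h l. h < N \<Longrightarrow> l < N \<Longrightarrow>
     (\<Sum>i<N. (\<Sum>I\<in>S. \<beta> I h * \<beta> I i) * G i l) = (if h = l then 1 else 0)"
    and h: "h < N"
  shows "(\<Sum>I\<in>S. (\<Sum>i<N. \<beta> I i * (\<Sum>l<N. G i l * y l)) * \<beta> I h) = y h"
proof -
  have "(\<Sum>I\<in>S. (\<Sum>i<N. \<beta> I i * (\<Sum>l<N. G i l * y l)) * \<beta> I h)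
      = (\<Sum>I\<in>S. \<Sum>i<N. \<Sum>l<N. \<beta> I h * \<beta> I i * G i l * y l)"
    by (simp add: sum_distrib_left sum_distrib_right mult_ac)
  also have "\<dots> = (\<Sum>i<N. \<Sum>I\<in>S. \<Sum>l<N. \<beta> I h * \<beta> I i * G i l * y l)"
    by (rule sum.swap)
  also have "\<dots> = (\<Sum>i<N. \<Sum>l<N. (\<Sum>I\<in>S. \<beta> I h * \<beta> I i) * G i l * y l)"
    by (simp add: sum_distrib_right sum.swap[of _ S])
  also have "\<dots> = (\<Sum>l<N. (\<Sum>i<N. (\<Sum>I\<in>S. \<beta> I h * \<beta> I i) * G i l) * y l)"
    by (subst sum.swap) (simp add: sum_distrib_right)
  also have "\<dots> = (\<Sum>l<N. if h = l then y l else 0)"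
    by (intro sum.cong) (auto simp: inv h)
  finally show ?thesis using h by simp
qed

lemma least_norm_inner:
  fixes \<beta> :: "'i \<Rightarrow> nat \<Rightarrow> real"
  assumes "\<And>h. h < N \<Longrightarrow> (\<Sum>I\<in>S. z I * \<beta> I h) = y h"
  shows "(\<Sum>I\<in>S. z I * (\<Sum>i<N. \<beta> I i * w i)) = (\<Sum>i<N. y i * w i)"
proof -
  have "(\<Sum>I\<in>S. z I * (\<Sum>i<N. \<beta> I i * w i)) = (\<Sum>I\<in>S. \<Sum>i<N. z I * \<beta> I i * w i)"
    by (simp add: sum_distrib_left mult_ac)
  also have "\<dots> = (\<Sum>i<N. (\<Sum>I\<in>S. z I * \<beta> I i) * w i)"
    by (subst sum.swap) (simp add: sum_distrib_right)
  finally show ?thesis using assms by simp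
qed

lemma least_norm_minimal:
  fixes z \<zeta> :: "'i \<Rightarrow> real"
  assumes "(\<Sum>I\<in>S. z I * \<zeta> I) = (\<Sum>I\<in>S. \<zeta> I * \<zeta> I)"
  shows "(\<Sum>I\<in>S. \<zeta> I * \<zeta> I) \<le> (\<Sum>I\<in>S. z I * z I)"
proof -
  have "0 \<le> (\<Sum>I\<in>S. (z I - \<zeta> I)\<^sup>2)" by (simp add: sum_nonneg)
  also have "\<dots> = (\<Sum>I\<in>S. z I * z I) - 2 * (\<Sum>I\<in>S. z I * \<zeta> I) + (\<Sum>I\<in>S. \<zeta> I * \<zeta> I)"
    by (simp add: power2_eq_square algebra_simps sum.distrib sum_subtractf sum_distrib_left)
  finally show ?thesis using assms by simp
qed

lemma prod_sum_multi_indices: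
  fixes F :: "nat \<Rightarrow> nat \<Rightarrow> real"
  shows "(\<Prod>l<j. \<Sum>a=1..k. F l a) = (\<Sum>I\<in>multi_indices k j. \<Prod>l<j. F l (I ! l))"
proof (induction j arbitrary: F)
  case 0
  then show ?case by (simp add: multi_indices_0)
next
  case (Suc j)
  have "(\<Prod>l<Suc j. \<Sum>a=1..k. F l a) = (\<Sum>a=1..k. F 0 a) * (\<Prod>l<j. \<Sum>a=1..k. F (Suc l) a)"
    by (simp add: prod.lessThan_Suc_shift del: prod.lessThan_Suc)
  also have "\<dots> = (\<Sum>a=1..k. F 0 a) * (\<Sum>I\<in>multi_indices k j. \<Prod>l<j. F (Suc l) (I ! l))"
    using Suc[of "\<lambda>l. F (Suc l)"] by simp
  also have "\<dots> = (\<Sum>a=1..k. \<Sum>I\<in>multi_indices k j. F 0 a * (\<Prod>l<j. F (Suc l) (I ! l)))"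
    by (rule sum_product)
  finally show ?case
    by (simp add: sum_multi_indices_Suc prod.lessThan_Suc_shift del: prod.lessThan_Suc)
qed

lemma elt_set_plus_eq_iff:
  assumes "subspace F"
  shows "u +o F = u' +o F \<longleftrightarrow> u - u' \<in> F"
proof
  assume "u +o F = u' +o F"
  moreover have "u \<in> u +o F" using subspace_0[OF assms] by (auto simp: elt_set_plus_def)
  ultimately have "u \<in> u' +o F" by simp
  then show "u - u' \<in> F" by (auto simp: elt_set_plus_def)
next
  assume d: "u - u' \<in> F"
  have "u + b \<in> u' +o F" if "b \<in> F" for b
    using subspace_add[OF assms d that] by (auto simp: elt_set_plus_def intro!: bexI[of _ "u - u' + b"])
  moreover have "u' + b \<in> u +o F" if "b \<in> F" for b
    using subspace_diff[OF assms that d] by (auto simp: elt_set_plus_def intro!: bexI[of _ "b - (u - u')"])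
  ultimately show "u +o F = u' +o F" by (auto simp: elt_set_plus_def)
qed

lemma elt_set_plus_add:
  fixes F :: "'v::real_vector set"
  assumes "subspace F"
  shows "(u +o F) + (u' +o F) = (u + u') +o F"
proof -
  have "F + F = F"
    using subspace_add[OF assms] subspace_0[OF assms] set_zero_plus2[of F F]
    by (auto elim!: set_plus_elim)
  then show ?thesis by (simp add: set_plus_rearrange)
qed

lemma mat_inverse_of_det:
  fixes B :: "real Matrix.mat"
  assumes B: "B \<in> carrier_mat N N" and det: "Determinant.det B \<noteq> 0"
  shows "the (mat_inverse B) \<in> carrier_mat N N" "B * the (mat_inverse B) = 1\<^sub>m N"
    "the (mat_inverse B) * B = 1\<^sub>m N"
proof -
  have "mat_inverse B \<noteq> None"
    using mat_inverse(1)[OF B, where b = "()"] det_non_zero_imp_unit[OF B det, where b = "()"] by blast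
  then obtain C where C: "mat_inverse B = Some C" by auto
  show "the (mat_inverse B) \<in> carrier_mat N N" "B * the (mat_inverse B) = 1\<^sub>m N"
    "the (mat_inverse B) * B = 1\<^sub>m N"
    using mat_inverse(2)[OF B C] C by auto
qed

context adapted_frame_domain
begin

definition width :: "nat \<Rightarrow> nat" where "width j = \<kappa> j - \<kappa> (j - 1)"

text \<open>The adapted structure constants, extended to \<open>j = 1\<close>. The index \<open>h\<close> counts the frame vectors of
  the layer from \<open>0\<close>.\<close>

definition bracket_coord :: "'a \<Rightarrow> nat \<Rightarrow> nat list \<Rightarrow> nat \<Rightarrow> real" where
  "bracket_coord p j I h = coord p (T I p) (\<kappa> (j - 1) + 1 + h)"

text \<open>The matrix \<open>B\<^sub>j\<close>, by a formula that is uniform in \<open>j\<close>; see \<open>popp_matrix_gram\<close>.\<close>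

definition gram :: "nat \<Rightarrow> 'a \<Rightarrow> real Matrix.mat" where
  "gram j p = Matrix.mat (width j) (width j)
     (\<lambda>(h, l). \<Sum>I\<in>multi_indices k j. bracket_coord p j I h * bracket_coord p j I l)"

definition gram_inv :: "nat \<Rightarrow> 'a \<Rightarrow> real Matrix.mat" where
  "gram_inv j p = the (mat_inverse (gram j p))"

lemma gram_carrier [simp]: "gram j p \<in> carrier_mat (width j) (width j)"
  by (simp add: gram_def)

lemma layer_index:
  assumes "1 \<le> j" "j \<le> m" "h < width j"
  shows "\<kappa> (j - 1) + 1 + h \<in> {1..n}" "\<kappa> (j - 1) + 1 + h \<in> {\<kappa> (j - 1) + 1..n}"
    "\<kappa> (j - 1) + 1 + h \<in> {1..\<kappa> j}"
  using assms kappa_le_n[of j] by (auto simp: width_def)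

lemma coord_flag_zero: "p \<in> U \<Longrightarrow> 1 \<le> j \<Longrightarrow> j \<le> m \<Longrightarrow> h < width j \<Longrightarrow> v \<in> flg (j - 1) p \<Longrightarrow>
    coord p v (\<kappa> (j - 1) + 1 + h) = 0"
  using mem_flag[of p "j - 1" v] layer_index(2)[of j h] by auto

lemma flag_diff_iff:
  assumes p: "p \<in> U" and j: "1 \<le> j" "j \<le> m" and u: "u \<in> flg j p" and v: "v \<in> flg j p"
  shows "u - v \<in> flg (j - 1) p \<longleftrightarrow>
     (\<forall>h<width j. coord p v (\<kappa> (j - 1) + 1 + h) = coord p u (\<kappa> (j - 1) + 1 + h))" (is "?L \<longleftrightarrow> ?R")
proof -
  have ut: "u \<in> tangent_space A p" and vt: "v \<in> tangent_space A p"
    using flag_tangent[OF p j(2)] u v by auto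
  have d: "coord p (u - v) l = coord p u l - coord p v l" if "l \<in> {1..n}" for l
    using coord_diff[OF p that ut vt] .
  show ?thesis
  proof
    assume ?L
    show ?R
    proof (intro allI impI)
      fix h assume "h < width j"
      from coord_flag_zero[OF p j this \<open>?L\<close>] d[OF layer_index(1)[OF j this]]
      show "coord p v (\<kappa> (j - 1) + 1 + h) = coord p u (\<kappa> (j - 1) + 1 + h)" by simp
    qed
  next
    assume R: ?R
    have "coord p (u - v) l = 0" if l: "l \<in> {\<kappa> (j - 1) + 1..n}" for l
    proof (cases "l \<le> \<kappa> j")
      case True
      then have "l = \<kappa> (j - 1) + 1 + (l - (\<kappa> (j - 1) + 1))" "l - (\<kappa> (j - 1) + 1) < width j"
        using l by (auto simp: width_def)
      then have "coord p v l = coord p u l" using R by metis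
      then show ?thesis using d[of l] l by simp
    next
      case False
      then have "coord p u l = 0" "coord p v l = 0" using mem_flag[OF p j(2)] u v l by auto
      then show ?thesis using d[of l] l by simp
    qed
    moreover have "u - v \<in> tangent_space A p"
      using ut vt by (rule subspace_diff[OF tangent_space_subspace])
    ultimately show ?L using mem_flag[OF p, of "j - 1"] j by auto
  qed
qed

lemma T_mem: "p \<in> U \<Longrightarrow> I \<in> multi_indices k j \<Longrightarrow> 1 \<le> j \<Longrightarrow> j \<le> m \<Longrightarrow> T I p \<in> flg j p"
  using section_mem[OF T_section[of U]] frame_open by blast

text \<open>If \<open>B\<^sub>j v = 0\<close>, then \<open>v\<^sup>T B\<^sub>j v = 0\<close> is a sum of squares, so the functional with coefficients \<open>v\<close> kills every
  \<open>T I\<close>. By surjectivity of \<open>\<pi>\<^sub>j\<close> it kills the whole layer, that is \<open>v = 0\<close>.\<close>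

lemma gram_det_nz:
  assumes p: "p \<in> U" and j: "1 \<le> j" "j \<le> m"
  shows "Determinant.det (gram j p) \<noteq> 0"
proof
  let ?N = "width j"
  assume "Determinant.det (gram j p) = 0"
  then obtain v where v: "v \<in> carrier_vec ?N" "v \<noteq> 0\<^sub>v ?N" "gram j p *\<^sub>v v = 0\<^sub>v ?N"
    using det_0_iff_vec_prod_zero[OF gram_carrier] by blast
  have row: "(\<Sum>l<?N. (\<Sum>I\<in>multi_indices k j. bracket_coord p j I h * bracket_coord p j I l) * v $ l) = 0" if h: "h < ?N" for h
  proof -
    have "(gram j p *\<^sub>v v) $ h = 0" using v h by simp
    then show ?thesis
      using h v(1) by (simp add: gram_def scalar_prod_def atLeast0LessThan)
  qed
  have "0 = (\<Sum>h<?N. v $ h * (\<Sum>l<?N. (\<Sum>I\<in>multi_indices k j. bracket_coord p j I h * bracket_coord p j I l) * v $ l))"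
    using row by simp
  also have "\<dots> = (\<Sum>h<?N. \<Sum>l<?N. \<Sum>I\<in>multi_indices k j. (v $ h * bracket_coord p j I h) * (v $ l * bracket_coord p j I l))"
    by (simp add: sum_distrib_left sum_distrib_right mult_ac)
  also have "\<dots> = (\<Sum>h<?N. \<Sum>I\<in>multi_indices k j. \<Sum>l<?N. (v $ h * bracket_coord p j I h) * (v $ l * bracket_coord p j I l))"
    by (intro sum.cong refl sum.swap)
  also have "\<dots> = (\<Sum>I\<in>multi_indices k j. \<Sum>h<?N. \<Sum>l<?N. (v $ h * bracket_coord p j I h) * (v $ l * bracket_coord p j I l))"
    by (rule sum.swap)
  also have "\<dots> = (\<Sum>I\<in>multi_indices k j. (\<Sum>h<?N. v $ h * bracket_coord p j I h)\<^sup>2)"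
    by (simp add: power2_eq_square sum_product)
  finally have zero: "(\<Sum>h<?N. v $ h * bracket_coord p j I h) = 0" if "I \<in> multi_indices k j" for I
    using that sum_nonneg_eq_0_iff[of "multi_indices k j" "\<lambda>I. (\<Sum>h<?N. v $ h * bracket_coord p j I h)\<^sup>2"] by simp
  have "v $ i = 0" if i: "i < ?N" for i
  proof -
    let ?l = "\<lambda>h. \<kappa> (j - 1) + 1 + h"
    have Xi: "X (?l i) p \<in> flg j p" using layer_index(3)[OF j i] frame_in_flag[OF p j(2)] by blast
    obtain \<beta> where \<beta>: "X (?l i) p - (\<Sum>I\<in>multi_indices k j. \<beta> I *\<^sub>R T I p) \<in> flg (j - 1) p"
      using popp_surjective[OF p j Xi] by blast
    have "(\<Sum>I\<in>multi_indices k j. \<beta> I *\<^sub>R T I p) \<in> flg j p"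
      using T_mem[OF p _ j] by (intro subspace_sum subspace_scale flag_subspace p j)
    then have eq: "coord p (X (?l i) p) (?l h) = coord p (\<Sum>I\<in>multi_indices k j. \<beta> I *\<^sub>R T I p) (?l h)" if "h < ?N" for h
      using flag_diff_iff[OF p j Xi] \<beta> that by auto
    have "v $ i = (\<Sum>h<?N. if h = i then v $ h else 0)" using i by simp
    also have "\<dots> = (\<Sum>h<?N. v $ h * (if i = h then 1 else 0))"
      by (intro sum.cong refl) simp
    also have "\<dots> = (\<Sum>h<?N. v $ h * coord p (X (?l i) p) (?l h))"
      using layer_index(1)[OF j] i by (intro sum.cong refl) (simp add: coord_frame[OF p])
    also have "\<dots> = (\<Sum>h<?N. v $ h * (\<Sum>I\<in>multi_indices k j. \<beta> I * bracket_coord p j I h))"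
    proof (intro sum.cong refl)
      fix h assume "h \<in> {..<?N}"
      then have h: "h < ?N" by simp
      have "coord p (\<Sum>I\<in>multi_indices k j. \<beta> I *\<^sub>R T I p) (?l h) = (\<Sum>I\<in>multi_indices k j. \<beta> I * coord p (T I p) (?l h))"
        by (rule coord_sum[OF p layer_index(1)[OF j h]]) (use T_mem[OF p _ j] flag_tangent[OF p j(2)] in auto)
      then show "v $ h * coord p (X (?l i) p) (?l h) = v $ h * (\<Sum>I\<in>multi_indices k j. \<beta> I * bracket_coord p j I h)"
        by (simp only: eq[OF h] bracket_coord_def)
    qed
    also have "\<dots> = (\<Sum>I\<in>multi_indices k j. \<beta> I * (\<Sum>h<?N. v $ h * bracket_coord p j I h))"
      by (simp add: sum_distrib_left mult_ac sum.swap[of _ "multi_indices k j"])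
    also have "\<dots> = 0" using zero by simp
    finally show ?thesis .
  qed
  then have "v = 0\<^sub>v ?N" using v(1) by (intro eq_vecI) auto
  then show False using v by simp
qed

lemma gram_inv_facts:
  assumes "p \<in> U" "1 \<le> j" "j \<le> m"
  shows "gram_inv j p \<in> carrier_mat (width j) (width j)" "gram j p * gram_inv j p = 1\<^sub>m (width j)"
    "gram_inv j p * gram j p = 1\<^sub>m (width j)"
  unfolding gram_inv_def using mat_inverse_of_det[OF gram_carrier gram_det_nz[OF assms]] by auto

lemma gram_gram_inv_entry:
  assumes "p \<in> U" "1 \<le> j" "j \<le> m" "h < width j" "l < width j"
  shows "(\<Sum>i<width j. (\<Sum>I\<in>multi_indices k j. bracket_coord p j I h * bracket_coord p j I i) * gram_inv j p $$ (i, l))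
     = (if h = l then 1 else 0)"
proof -
  have "(gram j p * gram_inv j p) $$ (h, l) = (if h = l then 1 else 0)"
    using gram_inv_facts(2)[OF assms(1-3)] assms by simp
  then show ?thesis
    using gram_inv_facts(1)[OF assms(1-3)] assms by (simp add: gram_def scalar_prod_def atLeast0LessThan)
qed

text \<open>This turns out to be the inner product on the layer in coordinates, with matrix \<open>B\<^sub>j\<^sup>-\<^sup>1\<close>.\<close>

definition layer_form :: "nat \<Rightarrow> 'a \<Rightarrow> (nat \<Rightarrow> real) \<Rightarrow> (nat \<Rightarrow> real) \<Rightarrow> real" where
  "layer_form j p y y' = (\<Sum>h<width j. y h * (\<Sum>l<width j. gram_inv j p $$ (h, l) * y' l))"

text \<open>The coordinates of the tensor of least norm that \<open>\<pi>\<^sub>j\<close> maps to the class with coordinates \<open>y\<close>.\<close>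

definition lift_coord :: "nat \<Rightarrow> 'a \<Rightarrow> (nat \<Rightarrow> real) \<Rightarrow> nat list \<Rightarrow> real" where
  "lift_coord j p y I = (\<Sum>h<width j. bracket_coord p j I h * (\<Sum>l<width j. gram_inv j p $$ (h, l) * y l))"

lemma lift_coord_dual:
  assumes "p \<in> U" "1 \<le> j" "j \<le> m" "h < width j"
  shows "(\<Sum>I\<in>multi_indices k j. lift_coord j p y I * bracket_coord p j I h) = y h"
  unfolding lift_coord_def by (rule least_norm_dual) (use gram_gram_inv_entry assms in auto)

lemma lift_coord_inner:
  assumes "\<And>h. h < width j \<Longrightarrow> (\<Sum>I\<in>multi_indices k j. z I * bracket_coord p j I h) = y h"
  shows "(\<Sum>I\<in>multi_indices k j. z I * lift_coord j p y' I) = layer_form j p y y'"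
  unfolding lift_coord_def layer_form_def by (rule least_norm_inner) (rule assms)

lemma layer_form_lift:
  assumes "p \<in> U" "1 \<le> j" "j \<le> m"
  shows "layer_form j p y y' = (\<Sum>I\<in>multi_indices k j. lift_coord j p y I * lift_coord j p y' I)"
  by (rule lift_coord_inner[symmetric]) (rule lift_coord_dual[OF assms])

lemma layer_form_sym: "p \<in> U \<Longrightarrow> 1 \<le> j \<Longrightarrow> j \<le> m \<Longrightarrow> layer_form j p y y' = layer_form j p y' y"
  by (simp add: layer_form_lift mult.commute)

lemma layer_form_nonneg: "p \<in> U \<Longrightarrow> 1 \<le> j \<Longrightarrow> j \<le> m \<Longrightarrow> 0 \<le> layer_form j p y y"
  by (simp add: layer_form_lift sum_nonneg)

text \<open>The fields \<open>X 1, \<dots>, X k\<close> are an orthonormal basis of \<open>D p\<close>.\<close>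

lemma metric_coord:
  assumes p: "p \<in> U" and x: "x \<in> D p" and y: "y \<in> D p"
  shows "g p x y = (\<Sum>a=1..k. coord p x a * coord p y a)"
proof -
  have ip: "inner_product_on (D p) (g p)"
    using sub_riem by (auto simp: sub_riemannian_def smooth_metric_def)
  have sub: "subspace (D p)" using flag_subspace[OF p, of "Suc 0"] m_pos by simp
  have lin: "g p (\<Sum>a\<in>I. c a *\<^sub>R z a) w = (\<Sum>a\<in>I. c a * g p (z a) w)"
    if "finite I" "w \<in> D p" "\<And>a. a \<in> I \<Longrightarrow> z a \<in> D p" for I w and c :: "nat \<Rightarrow> real" and z
    using that
  proof (induction I rule: finite_induct)
    case empty
    have "g p (0 *\<^sub>R w + 0 *\<^sub>R w) w = 0 * g p w w + 0 * g p w w"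
      using ip empty unfolding inner_product_on_def by blast
    then show ?case by simp
  next
    case (insert a I)
    have "(\<Sum>a\<in>I. c a *\<^sub>R z a) \<in> D p" using insert by (intro subspace_sum subspace_scale sub) auto
    moreover have "z a \<in> D p" using insert by auto
    ultimately have "g p (c a *\<^sub>R z a + 1 *\<^sub>R (\<Sum>a\<in>I. c a *\<^sub>R z a)) w
        = c a * g p (z a) w + 1 * g p (\<Sum>a\<in>I. c a *\<^sub>R z a) w"
      using ip insert(4) unfolding inner_product_on_def by blast
    then show ?case using insert by simp
  qed
  have sym: "g p u w = g p w u" if "u \<in> D p" "w \<in> D p" for u w
    using ip that by (auto simp: inner_product_on_def)
  have orth: "g p (X a p) (X b p) = (if a = b then 1 else 0)" if "a \<in> {1..k}" "b \<in> {1..k}" for a b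
    using frame p that by (auto simp: adapted_frame_def)
  have Xy: "g p (X a p) y = coord p y a" if a: "a \<in> {1..k}" for a
  proof -
    have "g p (X a p) y = g p y (X a p)" using sym frame_in_D[OF p a] y by blast
    also have "\<dots> = g p (\<Sum>b=1..k. coord p y b *\<^sub>R X b p) (X a p)" using D_expand[OF p y] by simp
    also have "\<dots> = (\<Sum>b=1..k. coord p y b * g p (X b p) (X a p))"
      using frame_in_D[OF p] a by (intro lin) auto
    also have "\<dots> = (\<Sum>b=1..k. if b = a then coord p y b else 0)"
      using a by (intro sum.cong) (auto simp: orth)
    finally show ?thesis using a by simp
  qed
  have "g p x y = g p (\<Sum>a=1..k. coord p x a *\<^sub>R X a p) y" using D_expand[OF p x] by simp
  also have "\<dots> = (\<Sum>a=1..k. coord p x a * g p (X a p) y)"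
    using frame_in_D[OF p] y by (intro lin) auto
  finally show ?thesis using Xy by simp
qed

definition tensor_coord :: "'a \<Rightarrow> nat \<Rightarrow> ('a functional list \<Rightarrow>\<^sub>0 real) \<Rightarrow> nat list \<Rightarrow> real" where
  "tensor_coord p j Z I = (\<Sum>xs\<in>Poly_Mapping.keys Z. Poly_Mapping.lookup Z xs * (\<Prod>l<j. coord p (xs ! l) (I ! l)))"

text \<open>The products \<open>X I\<^sub>1 \<otimes> \<dots> \<otimes> X I\<^sub>j\<close> are orthonormal. As the norm only involves coordinates, it does not depend
  on the representing formal combination.\<close>

lemma tensor_norm_coord:
  assumes p: "p \<in> U" and Z: "Z \<in> tensors (D p) j"
  shows "tensor_norm (g p) j Z = sqrt (\<Sum>I\<in>multi_indices k j. tensor_coord p j Z I * tensor_coord p j Z I)"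
proof -
  let ?K = "Poly_Mapping.keys Z" and ?c = "Poly_Mapping.lookup Z" and ?M = "multi_indices k j"
  let ?F = "\<lambda>xs I. \<Prod>l<j. coord p (xs ! l) (I ! l)"
  have "(\<Prod>l<j. g p (xs ! l) (ys ! l)) = (\<Sum>I\<in>?M. ?F xs I * ?F ys I)" if "xs \<in> ?K" "ys \<in> ?K" for xs ys
  proof -
    have "(\<Prod>l<j. g p (xs ! l) (ys ! l)) = (\<Prod>l<j. \<Sum>a=1..k. coord p (xs ! l) a * coord p (ys ! l) a)"
    proof (rule prod.cong[OF refl])
      fix l assume "l \<in> {..<j}"
      moreover have "length xs = j" "set xs \<subseteq> D p" "length ys = j" "set ys \<subseteq> D p"
        using Z that by (auto simp: tensors_def)
      ultimately have "xs ! l \<in> D p" "ys ! l \<in> D p" by (metis lessThan_iff nth_mem subsetD)+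
      then show "g p (xs ! l) (ys ! l) = (\<Sum>a=1..k. coord p (xs ! l) a * coord p (ys ! l) a)"
        by (rule metric_coord[OF p])
    qed
    also have "\<dots> = (\<Sum>I\<in>?M. \<Prod>l<j. coord p (xs ! l) (I ! l) * coord p (ys ! l) (I ! l))"
      by (rule prod_sum_multi_indices)
    finally show ?thesis by (simp add: prod.distrib)
  qed
  then have "tensor_inner (g p) j Z Z = (\<Sum>xs\<in>?K. \<Sum>ys\<in>?K. ?c xs * ?c ys * (\<Sum>I\<in>?M. ?F xs I * ?F ys I))"
    unfolding tensor_inner_def by (intro sum.cong refl) auto
  also have "\<dots> = (\<Sum>xs\<in>?K. \<Sum>ys\<in>?K. \<Sum>I\<in>?M. (?c xs * ?F xs I) * (?c ys * ?F ys I))"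
    by (simp add: sum_distrib_left mult_ac)
  also have "\<dots> = (\<Sum>xs\<in>?K. \<Sum>I\<in>?M. \<Sum>ys\<in>?K. (?c xs * ?F xs I) * (?c ys * ?F ys I))"
    by (intro sum.cong refl sum.swap)
  also have "\<dots> = (\<Sum>I\<in>?M. \<Sum>xs\<in>?K. \<Sum>ys\<in>?K. (?c xs * ?F xs I) * (?c ys * ?F ys I))"
    by (rule sum.swap)
  also have "\<dots> = (\<Sum>I\<in>?M. tensor_coord p j Z I * tensor_coord p j Z I)"
    by (simp add: tensor_coord_def sum_product)
  finally show ?thesis by (simp add: tensor_norm_def)
qed

lemma extension_section:
  assumes p: "p \<in> U" and v: "v \<in> D p"
  shows "(\<exists>W. p \<in> W \<and> is_section A D W (extension A D p v)) \<and> extension A D p v p = v"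
proof -
  \<comment> \<open>The coefficients are frozen at \<open>p\<close>.\<close>
  let ?V = "\<lambda>q. \<Sum>a=1..k. coord p v a *\<^sub>R X a q"
  have sub: "subspace (D q)" if "q \<in> U" for q
    using flag_subspace[OF that, of "Suc 0"] m_pos by simp
  have "smooth_vf A U ?V"
    using k_le_n by (intro smooth_vf_sum smooth_on_const frame_open frame_vf) auto
  moreover have "?V q \<in> D q" if "q \<in> U" for q
    using that frame_in_D by (intro subspace_sum subspace_scale sub) auto
  ultimately have "is_section A D U ?V" by (simp add: is_section_def)
  then have "(\<exists>W. p \<in> W \<and> is_section A D W ?V) \<and> ?V p = v" using D_expand[OF p v] p by auto
  then show ?thesis 
    unfolding extension_def by (rule someI[of "\<lambda>V. (\<exists>W. p \<in> W \<and> is_section A D W V) \<and> V p = v"])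
qed

lemma common_domain:
  assumes "p \<in> U" "\<And>V. V \<in> set Vs \<Longrightarrow> \<exists>W. p \<in> W \<and> is_section A D W V"
  shows "\<exists>W. p \<in> W \<and> open W \<and> W \<subseteq> U \<and> (\<forall>V\<in>set Vs. is_section A D W V)"
  using assms(2)
proof (induction Vs)
  case Nil
  then show ?case using assms(1) frame_open by auto
next
  case (Cons V Vs)
  obtain W where W: "p \<in> W" "open W" "W \<subseteq> U" "\<forall>V\<in>set Vs. is_section A D W V"
    using Cons by auto
  obtain W' where W': "p \<in> W'" "is_section A D W' V" using Cons.prems by auto
  then have "open W'" by (auto simp: is_section_def smooth_vf_def)
  then have "\<forall>V\<in>set (V # Vs). is_section A D (W \<inter> W') V"
    using W W' section_subset[OF W'(2), of "W \<inter> W'"] section_subset[of D W _ "W \<inter> W'"]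
    by (simp add: open_Int)
  then show ?case using W W' \<open>open W'\<close> by (intro exI[of _ "W \<inter> W'"]) auto
qed

lemma popp_value:
  assumes p: "p \<in> U" and j: "1 \<le> j" "j \<le> m" and Z: "Z \<in> tensors (D p) j"
  defines "v \<equiv> \<Sum>xs\<in>Poly_Mapping.keys Z. Poly_Mapping.lookup Z xs *\<^sub>R iter_bracket A (map (extension A D p) xs) p"
  shows "v \<in> flg j p"
    and "h < width j \<Longrightarrow> coord p v (\<kappa> (j - 1) + 1 + h) = (\<Sum>I\<in>multi_indices k j. tensor_coord p j Z I * bracket_coord p j I h)"
proof -
  let ?M = "multi_indices k j" and ?K = "Poly_Mapping.keys Z" and ?c = "Poly_Mapping.lookup Z"
  let ?br = "\<lambda>xs. iter_bracket A (map (extension A D p) xs) p"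
  let ?F = "\<lambda>xs I. \<Prod>l<j. coord p (xs ! l) (I ! l)"
  have main: "?br xs \<in> flg j p \<and> (\<forall>h<width j. coord p (?br xs) (\<kappa> (j - 1) + 1 + h) = (\<Sum>I\<in>?M. ?F xs I * bracket_coord p j I h))"
    if xs: "xs \<in> ?K" for xs
  proof -
    have len: "length xs = j" and D: "set xs \<subseteq> D p" using Z xs by (auto simp: tensors_def)
    let ?Vs = "map (extension A D p) xs"
    have "\<exists>W. p \<in> W \<and> is_section A D W V" if V: "V \<in> set ?Vs" for V
    proof -
      obtain v where "v \<in> D p" "V = extension A D p v" using V D by auto
      then show ?thesis using extension_section[OF p] by blast
    qed
    then have "\<exists>W. p \<in> W \<and> open W \<and> W \<subseteq> U \<and> (\<forall>V\<in>set ?Vs. is_section A D W V)"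
      by (rule common_domain[OF p])
    then obtain W where all: "p \<in> W \<and> open W \<and> W \<subseteq> U \<and> (\<forall>V\<in>set ?Vs. is_section A D W V)" ..
    then have W: "W \<subseteq> U" "open W" and pW: "p \<in> W" by (simp_all only:)
    have V: "is_section A D W V" if "V \<in> set ?Vs" for V
      using all that by (simp only: Ball_def)
    have lenV: "length ?Vs = j" using len by simp
    have sec: "is_section A (flg j) W (iter_bracket A ?Vs)"
      by (rule iter_bracket_section[where Vs = ?Vs, OF W, unfolded lenV]) (rule V j, assumption?)+
    then have br: "?br xs \<in> flg j p" using pW by (rule section_mem)
    have "?br xs - (\<Sum>I\<in>?M. (\<Prod>l<j. coord p ((?Vs ! l) p) (I ! l)) *\<^sub>R T I p) \<in> flg (j - 1) p"
      by (rule iter_bracket_expand[where Vs = ?Vs, OF W pW, unfolded lenV]) (rule V j, assumption?)+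
    moreover have "(\<Prod>l<j. coord p ((?Vs ! l) p) (I ! l)) = ?F xs I" for I
    proof (rule prod.cong[OF refl])
      fix l assume "l \<in> {..<j}"
      then have l: "l < length xs" using len by simp
      then have "xs ! l \<in> D p" using D nth_mem by blast
      then show "coord p ((?Vs ! l) p) (I ! l) = coord p (xs ! l) (I ! l)"
        using extension_section[OF p] l by simp
    qed
    ultimately have d: "?br xs - (\<Sum>I\<in>?M. ?F xs I *\<^sub>R T I p) \<in> flg (j - 1) p" by simp
    have s: "(\<Sum>I\<in>?M. ?F xs I *\<^sub>R T I p) \<in> flg j p"
      using T_mem[OF p _ j] by (intro subspace_sum subspace_scale flag_subspace p j)
    have "coord p (?br xs) (\<kappa> (j - 1) + 1 + h) = (\<Sum>I\<in>?M. ?F xs I * bracket_coord p j I h)" if h: "h < width j" for h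
    proof -
      have "coord p (?br xs) (\<kappa> (j - 1) + 1 + h) = coord p (\<Sum>I\<in>?M. ?F xs I *\<^sub>R T I p) (\<kappa> (j - 1) + 1 + h)"
        using flag_diff_iff[OF p j br s] d h by auto
      also have "\<dots> = (\<Sum>I\<in>?M. ?F xs I * coord p (T I p) (\<kappa> (j - 1) + 1 + h))"
        by (rule coord_sum[OF p layer_index(1)[OF j h]]) (use T_mem[OF p _ j] flag_tangent[OF p j(2)] in auto)
      finally show ?thesis by (simp add: bracket_coord_def)
    qed
    then show ?thesis using br by blast
  qed
  show "v \<in> flg j p" unfolding v_def
    using main by (intro subspace_sum subspace_scale flag_subspace p j) auto
  assume h: "h < width j"
  have "coord p v (\<kappa> (j - 1) + 1 + h) = (\<Sum>xs\<in>?K. ?c xs * coord p (?br xs) (\<kappa> (j - 1) + 1 + h))"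
    unfolding v_def
    by (rule coord_sum[OF p layer_index(1)[OF j h]]) (use main flag_tangent[OF p j(2)] in auto)
  also have "\<dots> = (\<Sum>xs\<in>?K. ?c xs * (\<Sum>I\<in>?M. ?F xs I * bracket_coord p j I h))"
    using main h by (intro sum.cong refl) auto
  also have "\<dots> = (\<Sum>xs\<in>?K. \<Sum>I\<in>?M. ?c xs * ?F xs I * bracket_coord p j I h)"
    by (simp add: sum_distrib_left mult_ac)
  also have "\<dots> = (\<Sum>I\<in>?M. tensor_coord p j Z I * bracket_coord p j I h)"
    by (subst sum.swap) (simp add: tensor_coord_def sum_distrib_right)
  finally show "coord p v (\<kappa> (j - 1) + 1 + h) = (\<Sum>I\<in>?M. tensor_coord p j Z I * bracket_coord p j I h)" .
qed

lemma popp_map_eq_iff: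
  assumes p: "p \<in> U" and j: "1 \<le> j" "j \<le> m" and Z: "Z \<in> tensors (D p) j" and u: "u \<in> flg j p"
  shows "popp_map A D p j Z = u +o flg (j - 1) p \<longleftrightarrow>
    (\<forall>h<width j. (\<Sum>I\<in>multi_indices k j. tensor_coord p j Z I * bracket_coord p j I h) = coord p u (\<kappa> (j - 1) + 1 + h))"
proof -
  have sub: "subspace (flg (j - 1) p)" using flag_subspace[OF p] j by auto
  show ?thesis
    unfolding popp_map_def elt_set_plus_eq_iff[OF sub]
    using flag_diff_iff[OF p j popp_value(1)[OF p j Z] u] popp_value(2)[OF p j Z] by auto
qed

lemma tensor_with_coord:
  assumes p: "p \<in> U"
  shows "\<exists>Z\<in>tensors (D p) j. \<forall>I\<in>multi_indices k j. tensor_coord p j Z I = \<zeta> I"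
proof -
  let ?M = "multi_indices k j" and ?f = "map (\<lambda>a. X a p)"
  define Z where "Z = (\<Sum>I\<in>?M. Poly_Mapping.single (?f I) (\<zeta> I))"
  have injX: "inj_on (\<lambda>a. X a p) {1..k}"
    using frame_basis[OF p] k_le_n by (auto simp: basis_tuple_def intro: inj_on_subset)
  have inj: "inj_on ?f ?M"
    by (rule inj_on_mapI, rule inj_on_subset[OF injX]) (auto simp: multi_indices_def)
  have lk: "Poly_Mapping.lookup Z xs = (\<Sum>I\<in>?M. if ?f I = xs then \<zeta> I else 0)" for xs
    by (simp add: Z_def lookup_sum lookup_single when_def)
  have keys: "Poly_Mapping.keys Z \<subseteq> ?f ` ?M"
  proof
    fix xs assume "xs \<in> Poly_Mapping.keys Z"
    then have "(\<Sum>I\<in>?M. if ?f I = xs then \<zeta> I else 0) \<noteq> 0" by (simp add: in_keys_iff lk)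
    then obtain I where I: "I \<in> ?M" "(if ?f I = xs then \<zeta> I else 0) \<noteq> 0"
      by (rule sum.not_neutral_contains_not_neutral)
    then have "xs = ?f I" by (metis (full_types))
    then show "xs \<in> ?f ` ?M" using I(1) by (rule image_eqI)
  qed
  have lkI: "Poly_Mapping.lookup Z (?f I) = \<zeta> I" if "I \<in> ?M" for I
  proof -
    have "Poly_Mapping.lookup Z (?f I) = (\<Sum>J\<in>?M. if J = I then \<zeta> J else 0)"
      unfolding lk using inj that by (intro sum.cong refl) (auto dest: inj_onD)
    then show ?thesis using that by simp
  qed
  have "tensor_coord p j Z J = \<zeta> J" if J: "J \<in> ?M" for J
  proof -
    have "tensor_coord p j Z J = (\<Sum>xs\<in>?f ` ?M. Poly_Mapping.lookup Z xs * (\<Prod>l<j. coord p (xs ! l) (J ! l)))"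
      unfolding tensor_coord_def using keys by (intro sum.mono_neutral_left) (auto simp: in_keys_iff)
    also have "\<dots> = (\<Sum>I\<in>?M. \<zeta> I * (\<Prod>l<j. coord p (?f I ! l) (J ! l)))"
      by (subst sum.reindex[OF inj]) (simp add: lkI)
    also have "\<dots> = (\<Sum>I\<in>?M. if I = J then \<zeta> I else 0)"
    proof (intro sum.cong refl)
      fix I assume I: "I \<in> ?M"
      have len: "length I = j" "length J = j" using I J by (auto simp: multi_indices_def)
      have sub: "set I \<subseteq> {1..n}" "set J \<subseteq> {1..n}" using I J k_le_n by (force simp: multi_indices_def)+
      have ran: "I ! l \<in> {1..n}" "J ! l \<in> {1..n}" if "l < j" for l
        using that len subsetD[OF sub(1) nth_mem[of l I]] subsetD[OF sub(2) nth_mem[of l J]] by auto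
      have "(\<Prod>l<j. coord p (?f I ! l) (J ! l)) = (\<Prod>l<j. if I ! l = J ! l then 1 else 0)"
        using ran len by (intro prod.cong refl) (simp add: coord_frame[OF p])
      also have "\<dots> = (if I = J then 1 else 0)"
      proof (cases "I = J")
        case False
        then obtain l where "l < j" "I ! l \<noteq> J ! l" using len nth_equalityI[of I J] by auto
        then show ?thesis using False by (auto intro!: prod_zero)
      qed simp
      finally show "\<zeta> I * (\<Prod>l<j. coord p (?f I ! l) (J ! l)) = (if I = J then \<zeta> I else 0)" by simp
    qed
    finally show ?thesis using J by simp
  qed
  moreover have "Z \<in> tensors (D p) j"
    unfolding tensors_def
  proof (intro CollectI ballI)
    fix xs assume "xs \<in> Poly_Mapping.keys Z"
    then obtain I where "I \<in> ?M" "xs = ?f I" using keys by blast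
    then show "length xs = j \<and> set xs \<subseteq> D p"
      using frame_in_D[OF p] by (auto simp: multi_indices_def)
  qed
  ultimately show ?thesis by blast
qed

text \<open>By \<open>popp_map_eq_iff\<close> the infimum runs over the norms of solutions of a linear system, and the
  least-norm lemmas exhibit its minimum.\<close>

lemma layer_norm_eq:
  assumes p: "p \<in> U" and j: "1 \<le> j" "j \<le> m" and u: "u \<in> flg j p"
  defines "y \<equiv> \<lambda>h. coord p u (\<kappa> (j - 1) + 1 + h)"
  shows "layer_norm A D g p j (u +o flg (j - 1) p) = sqrt (layer_form j p y y)"
proof -
  let ?M = "multi_indices k j"
  let ?S = "{tensor_norm (g p) j Z | Z. Z \<in> tensors (D p) j \<and> popp_map A D p j Z = u +o flg (j - 1) p}"
  have "Inf ?S = sqrt (layer_form j p y y)"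
  proof (rule cInf_eq_minimum)
    obtain Z where Z: "Z \<in> tensors (D p) j" "\<And>I. I \<in> ?M \<Longrightarrow> tensor_coord p j Z I = lift_coord j p y I"
      using tensor_with_coord[OF p] by blast
    have "popp_map A D p j Z = u +o flg (j - 1) p"
      unfolding popp_map_eq_iff[OF p j Z(1) u]
    proof (intro allI impI)
      fix h assume h: "h < width j"
      have "(\<Sum>I\<in>?M. tensor_coord p j Z I * bracket_coord p j I h) = (\<Sum>I\<in>?M. lift_coord j p y I * bracket_coord p j I h)"
        using Z(2) by (intro sum.cong refl) simp
      then show "(\<Sum>I\<in>?M. tensor_coord p j Z I * bracket_coord p j I h) = coord p u (\<kappa> (j - 1) + 1 + h)"
        using lift_coord_dual[OF p j h, of y] by (simp add: y_def)
    qed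
    moreover have "tensor_norm (g p) j Z = sqrt (layer_form j p y y)"
      unfolding tensor_norm_coord[OF p Z(1)] layer_form_lift[OF p j] using Z(2) by simp
    ultimately show "sqrt (layer_form j p y y) \<in> ?S" using Z(1) by (auto intro!: exI[of _ Z])
  next
    fix x assume "x \<in> ?S"
    then obtain Z where Z: "Z \<in> tensors (D p) j" and x: "x = tensor_norm (g p) j Z"
      and eq: "popp_map A D p j Z = u +o flg (j - 1) p" by auto
    have "\<And>h. h < width j \<Longrightarrow> (\<Sum>I\<in>?M. tensor_coord p j Z I * bracket_coord p j I h) = y h"
      using eq popp_map_eq_iff[OF p j Z u] by (auto simp: y_def)
    then have "(\<Sum>I\<in>?M. tensor_coord p j Z I * lift_coord j p y I) = layer_form j p y y"
      by (rule lift_coord_inner)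
    then have "layer_form j p y y \<le> (\<Sum>I\<in>?M. tensor_coord p j Z I * tensor_coord p j Z I)"
      unfolding layer_form_lift[OF p j] by (rule least_norm_minimal)
    then show "sqrt (layer_form j p y y) \<le> x" unfolding x tensor_norm_coord[OF p Z] by simp
  qed
  then show ?thesis by (simp add: layer_norm_def)
qed

lemma layer_form_add:
  "layer_form j p (\<lambda>h. y h + y' h) z = layer_form j p y z + layer_form j p y' z"
  "layer_form j p z (\<lambda>h. y h + y' h) = layer_form j p z y + layer_form j p z y'"
  by (simp_all add: layer_form_def algebra_simps sum.distrib)

lemma layer_form_cong:
  assumes "\<And>h. h < width j \<Longrightarrow> y h = z h" "\<And>h. h < width j \<Longrightarrow> y' h = z' h"
  shows "layer_form j p y y' = layer_form j p z z'"
  unfolding layer_form_def using assms by (intro sum.cong refl arg_cong2[where f = "(*)"]) auto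

text \<open>The norm comes from the bilinear form \<open>layer_form\<close>, so polarization recovers that form.\<close>

lemma layer_inner_eq:
  assumes p: "p \<in> U" and j: "1 \<le> j" "j \<le> m" and u: "u \<in> flg j p" and u': "u' \<in> flg j p"
  shows "layer_inner A D g p j (u +o flg (j - 1) p) (u' +o flg (j - 1) p)
    = layer_form j p (\<lambda>h. coord p u (\<kappa> (j - 1) + 1 + h)) (\<lambda>h. coord p u' (\<kappa> (j - 1) + 1 + h))"
proof -
  have sub: "subspace (flg (j - 1) p)" using flag_subspace[OF p] j by auto
  have s: "u + u' \<in> flg j p" using subspace_add[OF flag_subspace[OF p j(2)] u u'] .
  let ?y = "\<lambda>h. coord p u (\<kappa> (j - 1) + 1 + h)" and ?y' = "\<lambda>h. coord p u' (\<kappa> (j - 1) + 1 + h)"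
  have "layer_form j p (\<lambda>h. coord p (u + u') (\<kappa> (j - 1) + 1 + h)) (\<lambda>h. coord p (u + u') (\<kappa> (j - 1) + 1 + h))
     = layer_form j p (\<lambda>h. ?y h + ?y' h) (\<lambda>h. ?y h + ?y' h)"
    using flag_tangent[OF p j(2)] u u' layer_index(1)[OF j]
    by (intro layer_form_cong coord_add p) auto
  also have "\<dots> = layer_form j p ?y ?y + 2 * layer_form j p ?y ?y' + layer_form j p ?y' ?y'"
    using layer_form_sym[OF p j, of ?y' ?y] by (simp add: layer_form_add)
  finally show ?thesis
    unfolding layer_inner_def elt_set_plus_add[OF sub] layer_norm_eq[OF p j u] layer_norm_eq[OF p j u']
      layer_norm_eq[OF p j s] real_sqrt_pow2[OF layer_form_nonneg[OF p j]]
    by simp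
qed

end

section \<open>Derivatives of determinants\<close>

context manifold_atlas
begin

text \<open>Differentiating the product in each term of the Leibniz formula, and collecting the terms in which the
  factor from row \<open>r\<close> is differentiated, gives the determinant of the matrix \<open>R r\<close> with that row
  differentiated. Its expansion along row \<open>r\<close> has the cofactors of the original matrix.\<close>

lemma act_det:
  assumes v: "v \<in> tangent_space A q" and M: "\<And>p. M p \<in> carrier_mat N N"
    and sm: "\<And>r s. r < N \<Longrightarrow> s < N \<Longrightarrow> smooth_at A q (\<lambda>p. M p $$ (r, s))"
  shows "act v (\<lambda>p. Determinant.det (M p))
    = (\<Sum>r<N. \<Sum>s<N. act v (\<lambda>p. M p $$ (r, s)) * cofactor (M q) r s)"
proof -
  let ?P = "{\<pi>. \<pi> permutes {0..<N}}"
  let ?d = "\<lambda>r s. act v (\<lambda>p. M p $$ (r, s))"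
  define R where "R r = Matrix.mat N N (\<lambda>(i, s). if i = r then ?d r s else M q $$ (i, s))" for r
  have R: "R r \<in> carrier_mat N N" for r by (simp add: R_def)
  have in_range: "\<pi> i < N" if "\<pi> \<in> ?P" "i \<in> {0..<N}" for \<pi> i
    using that permutes_in_image[of \<pi> "{0..<N}" i] by auto
  have "act v (\<lambda>p. Determinant.det (M p)) = act v (\<lambda>p. \<Sum>\<pi>\<in>?P. signof \<pi> * (\<Prod>i=0..<N. M p $$ (i, \<pi> i)))"
    unfolding det_def'[OF M] ..
  also have "\<dots> = (\<Sum>\<pi>\<in>?P. act v (\<lambda>p. signof \<pi> * (\<Prod>i=0..<N. M p $$ (i, \<pi> i))))"
    using in_range by (intro act_of_sum[OF v] smooth_at_mult smooth_at_const smooth_at_prod sm) auto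
  also have "\<dots> = (\<Sum>\<pi>\<in>?P. \<Sum>r=0..<N. signof \<pi> * (\<Prod>i=0..<N. R r $$ (i, \<pi> i)))"
  proof (intro sum.cong refl)
    fix \<pi> assume \<pi>: "\<pi> \<in> ?P"
    have s: "smooth_at A q (\<lambda>p. M p $$ (i, \<pi> i))" if "i \<in> {0..<N}" for i
      using in_range[OF \<pi> that] that by (intro sm) auto
    have "act v (\<lambda>p. signof \<pi> * (\<Prod>i=0..<N. M p $$ (i, \<pi> i)))
        = signof \<pi> * act v (\<lambda>p. \<Prod>i=0..<N. M p $$ (i, \<pi> i))"
      using s by (intro act_cmult[OF v] smooth_at_prod) auto
    also have "act v (\<lambda>p. \<Prod>i=0..<N. M p $$ (i, \<pi> i))
        = (\<Sum>r=0..<N. ?d r (\<pi> r) * (\<Prod>i\<in>{0..<N} - {r}. M q $$ (i, \<pi> i)))"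
      using s by (intro act_of_prod[OF v]) auto
    also have "\<dots> = (\<Sum>r=0..<N. \<Prod>i=0..<N. R r $$ (i, \<pi> i))"
    proof (intro sum.cong refl)
      fix r assume r: "r \<in> {0..<N}"
      have "(\<Prod>i=0..<N. R r $$ (i, \<pi> i)) = R r $$ (r, \<pi> r) * (\<Prod>i\<in>{0..<N} - {r}. R r $$ (i, \<pi> i))"
        by (rule prod.remove) (use r in auto)
      also have "R r $$ (r, \<pi> r) = ?d r (\<pi> r)" using r in_range[OF \<pi> r] by (simp add: R_def)
      also have "(\<Prod>i\<in>{0..<N} - {r}. R r $$ (i, \<pi> i)) = (\<Prod>i\<in>{0..<N} - {r}. M q $$ (i, \<pi> i))"
        using in_range[OF \<pi>] by (intro prod.cong refl) (auto simp: R_def)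
      finally show "?d r (\<pi> r) * (\<Prod>i\<in>{0..<N} - {r}. M q $$ (i, \<pi> i)) = (\<Prod>i=0..<N. R r $$ (i, \<pi> i))" ..
    qed
    finally show "act v (\<lambda>p. signof \<pi> * (\<Prod>i=0..<N. M p $$ (i, \<pi> i)))
        = (\<Sum>r=0..<N. signof \<pi> * (\<Prod>i=0..<N. R r $$ (i, \<pi> i)))" by (simp add: sum_distrib_left)
  qed
  also have "\<dots> = (\<Sum>r=0..<N. Determinant.det (R r))"
    unfolding det_def'[OF R] by (rule sum.swap)
  also have "\<dots> = (\<Sum>r<N. \<Sum>s<N. ?d r s * cofactor (M q) r s)"
    unfolding atLeast0LessThan
  proof (intro sum.cong refl)
    fix r assume r: "r \<in> {..<N}"
    have "mat_delete (R r) r s = mat_delete (M q) r s" if "s < N" for s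
      using M[of q] r that by (intro eq_matI) (auto simp: mat_delete_def R_def)
    then have "cofactor (R r) r s = cofactor (M q) r s" if "s < N" for s
      using that by (simp add: cofactor_def)
    moreover have "Determinant.det (R r) = (\<Sum>s<N. R r $$ (r, s) * cofactor (R r) r s)"
      using r by (intro laplace_expansion_row[OF R]) auto
    ultimately show "Determinant.det (R r) = (\<Sum>s<N. ?d r s * cofactor (M q) r s)"
      using r by (simp add: R_def)
  qed
  finally show ?thesis .
qed

lemma mat_derivative_local:
  assumes "v \<in> tangent_space A q" "open W" "q \<in> W" "\<And>p. p \<in> W \<Longrightarrow> M p = N p"
  shows "mat_derivative v M q = mat_derivative v N q"
proof -
  have "act v (\<lambda>p. M p $$ (h, l)) = act v (\<lambda>p. N p $$ (h, l))" for h l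
    by (rule act_local[OF assms(1-3)]) (simp add: assms(4))
  then show ?thesis using assms(3,4) by (simp add: mat_derivative_def)
qed

text \<open>Jacobi's formula: the cofactors form the adjugate matrix, which is the determinant times the inverse.\<close>

lemma act_det_trace:
  assumes v: "v \<in> tangent_space A q" and M: "\<And>p. M p \<in> carrier_mat N N"
    and sm: "\<And>r s. r < N \<Longrightarrow> s < N \<Longrightarrow> smooth_at A q (\<lambda>p. M p $$ (r, s))"
    and C: "C \<in> carrier_mat N N" "C * M q = 1\<^sub>m N"
  shows "act v (\<lambda>p. Determinant.det (M p)) = Determinant.det (M q) * mat_trace (C * mat_derivative v M q)"
proof -
  let ?d = "\<lambda>r s. act v (\<lambda>p. M p $$ (r, s))"
  have Mq: "M q \<in> carrier_mat N N" "dim_row (M q) = N" "dim_col (M q) = N" using M[of q] by auto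
  have "adj_mat (M q) = (C * M q) * adj_mat (M q)" using C adj_mat(1)[OF Mq(1)] by simp
  also have "\<dots> = C * (M q * adj_mat (M q))"
    using C Mq adj_mat(1)[OF Mq(1)] by (intro assoc_mult_mat) auto
  also have "\<dots> = Determinant.det (M q) \<cdot>\<^sub>m C"
    using adj_mat(2)[OF Mq(1)] C by (simp add: mult_smult_distrib[of C N N "1\<^sub>m N" N])
  finally have adj: "adj_mat (M q) = Determinant.det (M q) \<cdot>\<^sub>m C" .
  have cof: "cofactor (M q) r s = Determinant.det (M q) * C $$ (s, r)" if "r < N" "s < N" for r s
  proof -
    have "cofactor (M q) r s = adj_mat (M q) $$ (s, r)" using that Mq by (simp add: adj_mat_def)
    then show ?thesis using that C(1) unfolding adj by simp
  qed
  have "act v (\<lambda>p. Determinant.det (M p)) = (\<Sum>r<N. \<Sum>s<N. ?d r s * cofactor (M q) r s)"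
    by (rule act_det[OF v M sm])
  also have "\<dots> = (\<Sum>r<N. \<Sum>s<N. ?d r s * (Determinant.det (M q) * C $$ (s, r)))"
    by (intro sum.cong refl) (simp add: cof)
  also have "\<dots> = Determinant.det (M q) * (\<Sum>s<N. \<Sum>r<N. C $$ (s, r) * ?d r s)"
    by (subst sum.swap) (simp add: sum_distrib_left mult_ac)
  also have "(\<Sum>s<N. \<Sum>r<N. C $$ (s, r) * ?d r s) = mat_trace (C * mat_derivative v M q)"
    using C(1) Mq by (simp add: mat_trace_def mat_derivative_def scalar_prod_def atLeast0LessThan)
  finally show ?thesis .
qed

end

section \<open>Popp's volume of an adapted frame\<close>

lemma sum_lessThan_add:
  fixes f :: "nat \<Rightarrow> real"
  shows "(\<Sum>r<a + d. f r) = (\<Sum>r<a. f r) + (\<Sum>h<d. f (a + h))"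
  by (induction d) auto

context adapted_frame_domain
begin

text \<open>Rows and columns are counted from \<open>0\<close>, so that layer \<open>i\<close> consists of the indices \<open>r\<close> with
  \<open>\<kappa> (i - 1) \<le> r < \<kappa> i\<close>.\<close>

definition layer_of :: "nat \<Rightarrow> nat" where "layer_of r = (LEAST i. r < \<kappa> i)"

lemma kappa_width: "1 \<le> j \<Longrightarrow> j \<le> m \<Longrightarrow> \<kappa> (j - 1) + width j = \<kappa> j"
  using kappa_mono[of j "j - 1"] by (simp add: width_def)

lemma layer_of_eq:
  assumes "1 \<le> i" "i \<le> m" "\<kappa> (i - 1) \<le> r" "r < \<kappa> i"
  shows "layer_of r = i"
  unfolding layer_of_def
proof (rule Least_equality)
  fix y assume y: "r < \<kappa> y"
  show "i \<le> y"
  proof (rule ccontr)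
    assume "\<not> i \<le> y"
    then have "\<kappa> y \<le> \<kappa> (i - 1)" using assms by (intro kappa_mono) auto
    then show False using y assms by simp
  qed
qed (use assms in simp)

lemma layer_of_index: "1 \<le> i \<Longrightarrow> i \<le> m \<Longrightarrow> h < width i \<Longrightarrow> layer_of (\<kappa> (i - 1) + h) = i"
  by (rule layer_of_eq) (auto simp: width_def)

lemma layer_of_bounds:
  assumes "j \<le> m" "r < \<kappa> j"
  shows "1 \<le> layer_of r \<and> layer_of r \<le> j \<and> \<kappa> (layer_of r - 1) \<le> r \<and> r < \<kappa> (layer_of r)"
  using assms
proof (induction j)
  case 0
  then show ?case by (simp add: kappa_0)
next
  case (Suc j)
  show ?case
  proof (cases "r < \<kappa> j")
    case True
    then show ?thesis using Suc by auto
  next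
    case False
    then have "layer_of r = Suc j" using Suc by (intro layer_of_eq) auto
    then show ?thesis using False Suc by auto
  qed
qed

lemma sum_layers:
  fixes f :: "nat \<Rightarrow> real"
  assumes "j \<le> m"
  shows "(\<Sum>r<\<kappa> j. f r) = (\<Sum>i=1..j. \<Sum>h<width i. f (\<kappa> (i - 1) + h))"
  using assms
proof (induction j)
  case 0
  then show ?case by (simp add: kappa_0)
next
  case (Suc j)
  have "\<kappa> (Suc j) = \<kappa> j + width (Suc j)" using kappa_width[of "Suc j"] Suc by simp
  then show ?case using Suc by (simp add: sum_lessThan_add)
qed

text \<open>The Gram matrix of the classes of the frame vectors in the graded space. Different layers are
  orthogonal, and on layer \<open>i\<close> it is \<open>B\<^sub>i\<^sup>-\<^sup>1\<close>.\<close>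

definition block :: "'a \<Rightarrow> nat \<Rightarrow> nat \<Rightarrow> real" where
  "block p r s = (if layer_of r = layer_of s
     then gram_inv (layer_of r) p $$ (r - \<kappa> (layer_of r - 1), s - \<kappa> (layer_of r - 1)) else 0)"

lemma det_block:
  assumes p: "p \<in> U" and j: "j \<le> m"
  shows "Determinant.det (Matrix.mat (\<kappa> j) (\<kappa> j) (\<lambda>(r, s). block p r s)) = (\<Prod>i=1..j. Determinant.det (gram_inv i p))"
  using j
proof (induction j)
  case 0
  then show ?case by (simp add: kappa_0 det_def)
next
  case (Suc j)
  let ?w = "width (Suc j)" and ?A = "Matrix.mat (\<kappa> j) (\<kappa> j) (\<lambda>(r, s). block p r s)"
  have k: "\<kappa> (Suc j) = \<kappa> j + ?w" using kappa_width[of "Suc j"] Suc by simp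
  have G: "gram_inv (Suc j) p \<in> carrier_mat ?w ?w" using gram_inv_facts(1)[OF p, of "Suc j"] Suc by auto
  have low: "layer_of r \<le> j" if "r < \<kappa> j" for r using layer_of_bounds[of j r] that Suc by auto
  have high: "layer_of r = Suc j" if "\<not> r < \<kappa> j" "r < \<kappa> j + ?w" for r
    using that Suc by (intro layer_of_eq) (auto simp: k)
  have ne: "layer_of r \<noteq> Suc j" if "r < \<kappa> j" for r using low[OF that] by simp
  have "Matrix.mat (\<kappa> (Suc j)) (\<kappa> (Suc j)) (\<lambda>(r, s). block p r s)
      = four_block_mat ?A (0\<^sub>m (\<kappa> j) ?w) (0\<^sub>m ?w (\<kappa> j)) (gram_inv (Suc j) p)"
  proof (rule eq_matI)
    fix r s
    assume "r < dim_row (four_block_mat ?A (0\<^sub>m (\<kappa> j) ?w) (0\<^sub>m ?w (\<kappa> j)) (gram_inv (Suc j) p))"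
      "s < dim_col (four_block_mat ?A (0\<^sub>m (\<kappa> j) ?w) (0\<^sub>m ?w (\<kappa> j)) (gram_inv (Suc j) p))"
    then have rs: "r < \<kappa> j + ?w" "s < \<kappa> j + ?w" using G by auto
    have off: "block p r s = 0" if "r < \<kappa> j \<longleftrightarrow> \<not> s < \<kappa> j"
      using that rs high[of r] high[of s] ne[of r] ne[of s] by (auto simp: block_def)
    have diag: "block p r s = gram_inv (Suc j) p $$ (r - \<kappa> j, s - \<kappa> j)" if "\<not> r < \<kappa> j" "\<not> s < \<kappa> j"
      using that rs high[of r] high[of s] by (simp add: block_def)
    show "Matrix.mat (\<kappa> (Suc j)) (\<kappa> (Suc j)) (\<lambda>(r, s). block p r s) $$ (r, s)
        = four_block_mat ?A (0\<^sub>m (\<kappa> j) ?w) (0\<^sub>m ?w (\<kappa> j)) (gram_inv (Suc j) p) $$ (r, s)"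
      using rs G off diag by (cases "r < \<kappa> j"; cases "s < \<kappa> j") (simp_all add: k)
  qed (use G in \<open>auto simp: k\<close>)
  then have "Determinant.det (Matrix.mat (\<kappa> (Suc j)) (\<kappa> (Suc j)) (\<lambda>(r, s). block p r s))
      = Determinant.det ?A * Determinant.det (gram_inv (Suc j) p)"
    using det_four_block_mat_lower_left_zero[of ?A "\<kappa> j" "0\<^sub>m (\<kappa> j) ?w" ?w "0\<^sub>m ?w (\<kappa> j)", OF _ _ refl G]
    by simp
  then show ?case using Suc by simp
qed

text \<open>Two representatives of the class \<open>x i\<close> differ by an element of lower degree, so in layer \<open>i\<close> the
  coordinates of the chosen one are those of any other; see \<open>gr_coord_eq\<close>.\<close>

definition gr_coord :: "'a \<Rightarrow> (nat \<Rightarrow> 'a functional set) \<Rightarrow> nat \<Rightarrow> nat \<Rightarrow> real" where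
  "gr_coord p x i h = coord p (SOME v. v \<in> flg i p \<and> x i = v +o flg (i - 1) p) (\<kappa> (i - 1) + 1 + h)"

definition gr_row :: "'a \<Rightarrow> (nat \<Rightarrow> 'a functional set) \<Rightarrow> nat \<Rightarrow> real" where
  "gr_row p x r = gr_coord p x (layer_of r) (r - \<kappa> (layer_of r - 1))"

lemma gr_coord_eq:
  assumes p: "p \<in> U" and i: "1 \<le> i" "i \<le> m" and h: "h < width i"
    and v: "v \<in> flg i p" "x i = v +o flg (i - 1) p"
  shows "gr_coord p x i h = coord p v (\<kappa> (i - 1) + 1 + h)"
proof -
  define u where "u = (SOME v. v \<in> flg i p \<and> x i = v +o flg (i - 1) p)"
  have u: "u \<in> flg i p \<and> x i = u +o flg (i - 1) p"
    unfolding u_def by (rule someI[of "\<lambda>v. v \<in> flg i p \<and> x i = v +o flg (i - 1) p" v]) (use v in simp)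
  have sub: "subspace (flg (i - 1) p)" by (rule flag_subspace[OF p]) (use i in simp)
  have "u +o flg (i - 1) p = v +o flg (i - 1) p" using u v(2) by simp
  then have "u - v \<in> flg (i - 1) p" using elt_set_plus_eq_iff[OF sub] by blast
  then have "coord p v (\<kappa> (i - 1) + 1 + h) = coord p u (\<kappa> (i - 1) + 1 + h)"
    using flag_diff_iff[OF p i conjunct1[OF u] v(1)] h by blast
  then show ?thesis unfolding gr_coord_def u_def by (rule sym)
qed

lemma gr_inner_row:
  assumes p: "p \<in> U" and x: "x \<in> gr A D m p" and y: "y \<in> gr A D m p"
  shows "gr_inner A D g m p x y = (\<Sum>r<n. \<Sum>s<n. gr_row p x r * block p r s * gr_row p y s)"
proof -
  have rep: "\<exists>v. v \<in> flg i p \<and> z i = v +o flg (i - 1) p" if "z \<in> gr A D m p" "i \<in> {1..m}" for z i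
    using PiE_mem[OF that(1)[unfolded gr_def] that(2)] by auto
  have inner: "layer_inner A D g p i (x i) (y i) = layer_form i p (gr_coord p x i) (gr_coord p y i)" if i: "i \<in> {1..m}" for i
  proof -
    obtain u v where u: "u \<in> flg i p" "x i = u +o flg (i - 1) p" and v: "v \<in> flg i p" "y i = v +o flg (i - 1) p"
      using rep[OF x i] rep[OF y i] by blast
    have i': "1 \<le> i" "i \<le> m" using i by auto
    show ?thesis unfolding u(2) v(2) layer_inner_eq[OF p i' u(1) v(1)]
      by (rule layer_form_cong) (simp_all only: gr_coord_eq[of p i _ u x, OF p i' _ u] gr_coord_eq[of p i _ v y, OF p i' _ v])
  qed
  let ?c = "\<lambda>i h. \<kappa> (i - 1) + h"
  have row: "gr_row p z (?c i h) = gr_coord p z i h" if "i \<in> {1..m}" "h < width i" for z i h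
    using layer_of_index[of i h] that by (simp add: gr_row_def)
  have blk: "block p (?c i h) (?c i' h') = (if i = i' then gram_inv i p $$ (h, h') else 0)"
    if "i \<in> {1..m}" "h < width i" "i' \<in> {1..m}" "h' < width i'" for i h i' h'
    using layer_of_index[of i h] layer_of_index[of i' h'] that by (auto simp: block_def)
  have "(\<Sum>r<n. \<Sum>s<n. gr_row p x r * block p r s * gr_row p y s)
     = (\<Sum>i=1..m. \<Sum>h<width i. \<Sum>i'=1..m. \<Sum>h'<width i'.
          gr_row p x (?c i h) * block p (?c i h) (?c i' h') * gr_row p y (?c i' h'))"
    unfolding kappa_m[symmetric] sum_layers[OF order_refl] ..
  also have "\<dots> = (\<Sum>i=1..m. \<Sum>h<width i. \<Sum>i'=1..m.
      if i' = i then (\<Sum>h'<width i. gr_coord p x i h * gram_inv i p $$ (h, h') * gr_coord p y i h') else 0)"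
  proof (intro sum.cong refl)
    fix i h i' assume i: "i \<in> {1..m}" and h: "h \<in> {..<width i}" and i': "i' \<in> {1..m}"
    have "(\<Sum>h'<width i'. gr_row p x (?c i h) * block p (?c i h) (?c i' h') * gr_row p y (?c i' h'))
        = (\<Sum>h'<width i'. gr_coord p x i h * (if i = i' then gram_inv i p $$ (h, h') else 0) * gr_coord p y i' h')"
    proof (intro sum.cong refl)
      fix h' assume "h' \<in> {..<width i'}"
      then show "gr_row p x (?c i h) * block p (?c i h) (?c i' h') * gr_row p y (?c i' h')
          = gr_coord p x i h * (if i = i' then gram_inv i p $$ (h, h') else 0) * gr_coord p y i' h'"
        using i h i' by (simp only: row blk lessThan_iff)
    qed
    then show "(\<Sum>h'<width i'. gr_row p x (?c i h) * block p (?c i h) (?c i' h') * gr_row p y (?c i' h'))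
        = (if i' = i then (\<Sum>h'<width i. gr_coord p x i h * gram_inv i p $$ (h, h') * gr_coord p y i h') else 0)"
      by auto
  qed
  also have "\<dots> = (\<Sum>i=1..m. \<Sum>h<width i. \<Sum>h'<width i. gr_coord p x i h * gram_inv i p $$ (h, h') * gr_coord p y i h')"
    by (rule sum.cong[OF refl], rule sum.cong[OF refl], subst sum.delta) simp_all
  also have "\<dots> = (\<Sum>i=1..m. layer_form i p (gr_coord p x i) (gr_coord p y i))"
    by (simp add: layer_form_def sum_distrib_left mult.assoc)
  also have "\<dots> = gr_inner A D g m p x y"
    unfolding gr_inner_def using inner by simp
  finally show ?thesis ..
qed

lemma theta_hat_gr:
  assumes p: "p \<in> U"
  shows "theta_hat A D m \<kappa> p (\<lambda>i. X i p) b \<in> gr A D m p"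
    and "b = Suc s \<Longrightarrow> r < n \<Longrightarrow> s < n \<Longrightarrow> gr_row p (theta_hat A D m \<kappa> p (\<lambda>i. X i p) b) r = (if r = s then 1 else 0)"
proof -
  let ?v = "\<lambda>i. if \<kappa> (i - 1) < b \<and> b \<le> \<kappa> i then X b p else 0"
  have v: "?v i \<in> flg i p" if "i \<in> {1..m}" for i
    using that frame_in_flag[OF p, of i b] subspace_0[OF flag_subspace[OF p, of i]] by auto
  show "theta_hat A D m \<kappa> p (\<lambda>i. X i p) b \<in> gr A D m p"
    unfolding theta_hat_def gr_def
    by (rule restrict_PiE_iff[THEN iffD2], rule ballI, rule image_eqI[OF refl], rule v)
  assume b: "b = Suc s" and r: "r < n" and s: "s < n"
  let ?i = "layer_of r"
  have i: "1 \<le> ?i" "?i \<le> m" "\<kappa> (?i - 1) \<le> r" "r < \<kappa> ?i" using layer_of_bounds[of m r] r kappa_m by auto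
  then have h: "r - \<kappa> (?i - 1) < width ?i" by (auto simp: width_def)
  have "gr_row p (theta_hat A D m \<kappa> p (\<lambda>i. X i p) b) r = coord p (?v ?i) (\<kappa> (?i - 1) + 1 + (r - \<kappa> (?i - 1)))"
    unfolding gr_row_def by (rule gr_coord_eq[OF p i(1,2) h v]) (use i in \<open>auto simp: theta_hat_def\<close>)
  also have "\<dots> = coord p (?v ?i) (Suc r)" using i by simp
  also have "\<dots> = (if r = s then 1 else 0)"
    using i r s coord_frame[OF p, of b "Suc r"] coord_zero[OF p, of "Suc r"] b by auto
  finally show "gr_row p (theta_hat A D m \<kappa> p (\<lambda>i. X i p) b) r = (if r = s then 1 else 0)" .
qed

text \<open>Let \<open>E\<close> hold the coordinates of the orthonormal basis and \<open>G\<close> be the block matrix of the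
  \<open>B\<^sub>j\<^sup>-\<^sup>1\<close>. The classes of the frame vectors are the coordinate vectors, so Popp's volume of the frame is
  \<open>det (E G)\<close>, and orthonormality says \<open>E G E\<^sup>T = 1\<close>. Hence its square is \<open>det G\<close>, which is the product of the
  \<open>det (B\<^sub>j)\<^sup>-\<^sup>1\<close>.\<close>

lemma popp_volume_frame:
  assumes P: "popp_volume A D g n m \<kappa> \<omega> P" and p: "p \<in> U"
  shows "(P p (\<lambda>i. X i p))\<^sup>2 * (\<Prod>j=1..m. Determinant.det (gram j p)) = 1"
proof -
  let ?X = "\<lambda>i. X i p" and ?th = "\<lambda>b. theta_hat A D m \<kappa> p (\<lambda>i. X i p) b"
  have ad: "adapted_basis A D n m \<kappa> p ?X" using frame p by (auto simp: adapted_frame_def)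
  obtain e where e: "gr_orthonormal_basis A D g n m p e"
    and Pe: "P p ?X = gr_volume A D g n m p e (theta_hat A D m \<kappa> p ?X)"
    using P ad unfolding popp_volume_def by blast
  have egr: "e a \<in> gr A D m p" if "a \<in> {1..n}" for a using e that by (auto simp: gr_orthonormal_basis_def)
  define E where "E = Matrix.mat n n (\<lambda>(a, r). gr_row p (e (Suc a)) r)"
  define G where "G = Matrix.mat n n (\<lambda>(r, s). block p r s)"
  have E: "E \<in> carrier_mat n n" and G: "G \<in> carrier_mat n n" by (auto simp: E_def G_def)
  have EG: "(E * G) $$ (a, s) = (\<Sum>r<n. gr_row p (e (Suc a)) r * block p r s)" if "a < n" "s < n" for a s
    using that by (simp add: E_def G_def scalar_prod_def atLeast0LessThan)
  have swap: "gr_inner A D g m p (e (Suc a)) y = (\<Sum>s<n. (E * G) $$ (a, s) * gr_row p y s)"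
    if "a < n" "y \<in> gr A D m p" for a y
  proof -
    have "gr_inner A D g m p (e (Suc a)) y
        = (\<Sum>r<n. \<Sum>s<n. gr_row p (e (Suc a)) r * block p r s * gr_row p y s)"
      using that by (intro gr_inner_row p egr) auto
    also have "\<dots> = (\<Sum>s<n. \<Sum>r<n. gr_row p (e (Suc a)) r * block p r s * gr_row p y s)"
      by (rule sum.swap)
    finally show ?thesis using that by (simp add: EG sum_distrib_right)
  qed
  have "Matrix.mat n n (\<lambda>(a, b). gr_inner A D g m p (e (Suc a)) (?th (Suc b))) = E * G"
  proof (rule eq_matI)
    fix a b assume "a < dim_row (E * G)" "b < dim_col (E * G)"
    then have ab: "a < n" "b < n" using E G by auto
    have "gr_inner A D g m p (e (Suc a)) (?th (Suc b)) = (\<Sum>s<n. (E * G) $$ (a, s) * gr_row p (?th (Suc b)) s)"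
      by (rule swap[OF ab(1) theta_hat_gr(1)[OF p]])
    also have "\<dots> = (\<Sum>s<n. if s = b then (E * G) $$ (a, s) else 0)"
      using ab theta_hat_gr(2)[OF p refl] by (intro sum.cong refl) auto
    finally show "Matrix.mat n n (\<lambda>(a, b). gr_inner A D g m p (e (Suc a)) (?th (Suc b))) $$ (a, b) = (E * G) $$ (a, b)"
      using ab by simp
  qed (use E G in auto)
  then have 1: "P p ?X = Determinant.det E * Determinant.det G"
    using Pe det_mult[OF E G] by (simp add: gr_volume_def)
  have "(E * G) * transpose_mat E = 1\<^sub>m n"
  proof (rule eq_matI)
    fix a b assume "a < dim_row (1\<^sub>m n)" "b < dim_col (1\<^sub>m n)"
    then have ab: "a < n" "b < n" by auto
    have "((E * G) * transpose_mat E) $$ (a, b) = (\<Sum>s<n. (E * G) $$ (a, s) * E $$ (b, s))"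
      using ab E G by (subst index_mult_mat) (auto simp: scalar_prod_def atLeast0LessThan)
    also have "\<dots> = (\<Sum>s<n. (E * G) $$ (a, s) * gr_row p (e (Suc b)) s)"
      using ab by (intro sum.cong refl) (simp add: E_def)
    also have "\<dots> = gr_inner A D g m p (e (Suc a)) (e (Suc b))"
      using ab by (intro swap[symmetric] egr) auto
    finally show "((E * G) * transpose_mat E) $$ (a, b) = (1\<^sub>m n :: real Matrix.mat) $$ (a, b)"
      using e ab by (auto simp: gr_orthonormal_basis_def)
  qed (use E G in auto)
  then have "Determinant.det ((E * G) * transpose_mat E) = 1" by simp
  then have 2: "Determinant.det E * Determinant.det G * Determinant.det E = 1"
    using E G by (simp add: det_mult[of _ n] det_transpose[OF E])
  have "(P p ?X)\<^sup>2 = (Determinant.det E * Determinant.det G * Determinant.det E) * Determinant.det G"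
    unfolding 1 by (simp add: power2_eq_square mult_ac)
  also have "\<dots> = Determinant.det G" using 2 by simp
  also have "\<dots> = (\<Prod>i=1..m. Determinant.det (gram_inv i p))"
    using det_block[OF p order_refl] by (simp add: G_def kappa_m)
  finally have "(P p ?X)\<^sup>2 * (\<Prod>j=1..m. Determinant.det (gram j p))
      = (\<Prod>i=1..m. Determinant.det (gram_inv i p) * Determinant.det (gram i p))"
    by (simp add: prod.distrib)
  also have "\<dots> = 1"
  proof (rule prod.neutral, rule ballI)
    fix i assume "i \<in> {1..m}"
    then have i: "1 \<le> i" "i \<le> m" by auto
    show "Determinant.det (gram_inv i p) * Determinant.det (gram i p) = 1"
      using det_mult[OF gram_inv_facts(1)[OF p i] gram_carrier[of i p]] gram_inv_facts(3)[OF p i] by simp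
  qed
  finally show ?thesis .
qed

lemma gram_smooth:
  assumes j: "1 \<le> j" "j \<le> m" and rs: "r < width j" "s < width j"
  shows "smooth_on A U (\<lambda>p. gram j p $$ (r, s))"
proof -
  have t: "smooth_on A U (\<lambda>p. bracket_coord p j I h)" if "I \<in> multi_indices k j" "h < width j" for I h
    unfolding bracket_coord_def
    using section_vf[OF T_section[OF order_refl frame_open that(1) j]] layer_index(1)[OF j that(2)]
    by (intro coord_smooth frame_open) auto
  have "smooth_on A U (\<lambda>p. \<Sum>I\<in>multi_indices k j. bracket_coord p j I r * bracket_coord p j I s)"
    by (intro smooth_on_sum smooth_on_mult t frame_open rs)
  then show ?thesis using rs by (simp add: gram_def)
qed

text \<open>An adapted structure constant is the coordinate of an iterated bracket, since the remainder of lower order has no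
  coordinates in the layer. For \<open>j = 1\<close> the brackets are the frame vectors themselves, with
  the identity as Gram matrix.\<close>

lemma popp_matrix_gram:
  assumes b: "adapted_structure_constants A D k m \<kappa> U X b" and p: "p \<in> U" and j: "1 \<le> j" "j \<le> m"
  shows "popp_matrix k \<kappa> b j p = gram j p"
proof (cases "j = 1")
  case True
  have w: "width 1 = k" by (simp add: width_def kappa_0 kappa_1)
  have "gram 1 p = 1\<^sub>m k"
  proof (rule eq_matI)
    fix h l assume "h < dim_row (1\<^sub>m k)" "l < dim_col (1\<^sub>m k)"
    then have hl: "h < k" "l < k" by auto
    have "gram 1 p $$ (h, l) = (\<Sum>a=1..k. coord p (X a p) (Suc h) * coord p (X a p) (Suc l))"
      using hl w unfolding gram_def sum_multi_indices_1 by (simp add: bracket_coord_def kappa_0)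
    also have "\<dots> = (\<Sum>a=1..k. if a = Suc h then if h = l then 1 else 0 else 0)"
      using hl k_le_n by (intro sum.cong refl) (auto simp: coord_frame[OF p])
    finally show "gram 1 p $$ (h, l) = (1\<^sub>m k :: real Matrix.mat) $$ (h, l)" using hl by simp
  qed (simp_all add: gram_def w[simplified])
  then show ?thesis using True by (simp add: popp_matrix_def)
next
  case False
  then have j2: "j \<in> {2..m}" using j by auto
  have bI: "b I (\<kappa> (j - 1) + 1 + h) p = bracket_coord p j I h" if I: "I \<in> multi_indices k j" and h: "h < width j" for I h
  proof -
    let ?s = "\<Sum>l=\<kappa> (j - 1) + 1..\<kappa> j. b I l p *\<^sub>R X l p"
    have d: "T I p - ?s \<in> flg (j - 1) p"
      using b j2 I p by (auto simp: adapted_structure_constants_def)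
    have s: "?s \<in> flg j p"
      using frame_in_flag[OF p j(2)] by (intro subspace_sum subspace_scale flag_subspace p j) auto
    have l: "\<kappa> (j - 1) + 1 + h \<in> {1..n}" "\<kappa> (j - 1) + 1 + h \<in> {\<kappa> (j - 1) + 1..\<kappa> j}"
      using layer_index[OF j h] by auto
    have "bracket_coord p j I h = coord p ?s (\<kappa> (j - 1) + 1 + h)"
      using flag_diff_iff[OF p j T_mem[OF p I j] s] d h by (simp add: bracket_coord_def)
    also have "\<dots> = (\<Sum>l=\<kappa> (j - 1) + 1..\<kappa> j. b I l p * coord p (X l p) (\<kappa> (j - 1) + 1 + h))"
      using kappa_le_n[OF j(2)] by (intro coord_sum p l frame_tangent) auto
    also have "\<dots> = (\<Sum>l=\<kappa> (j - 1) + 1..\<kappa> j. if l = \<kappa> (j - 1) + 1 + h then b I l p else 0)"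
      using l kappa_le_n[OF j(2)] by (intro sum.cong refl) (auto simp: coord_frame[OF p])
    also have "\<dots> = b I (\<kappa> (j - 1) + 1 + h) p" using l(2) by (subst sum.delta) auto
    finally show ?thesis ..
  qed
  show ?thesis
    unfolding popp_matrix_def gram_def width_def[symmetric]
    using False bI by (intro eq_matI) auto
qed

end

section \<open>Gradient, Lie derivative and divergence\<close>

context adapted_frame_domain
begin

text \<open>The coefficients are forced by testing against the orthonormal fields \<open>X 1, \<dots>, X k\<close>.\<close>

lemma gradient_frame:
  assumes f: "smooth_on A U f" and p: "p \<in> U"
  shows "gradient A D g f p = (\<Sum>i=1..k. act (X i p) f *\<^sub>R X i p)"
  unfolding gradient_def
proof (rule the_equality)
  let ?v = "\<Sum>i=1..k. act (X i p) f *\<^sub>R X i p"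
  have sub: "subspace (D p)" using flag_subspace[OF p, of "Suc 0"] m_pos by simp
  have v: "?v \<in> D p" using frame_in_D[OF p] by (intro subspace_sum subspace_scale sub) auto
  have cfv: "coord p ?v a = act (X a p) f" if "a \<in> {1..k}" for a
    using coord_of_comb[OF p _ k_le_n, of a "\<lambda>i. act (X i p) f"] that k_le_n by auto
  have "g p ?v (Z p) = act (Z p) f" if pW: "p \<in> W" and Z: "is_section A D W Z" for W Z
  proof -
    have Zp: "Z p \<in> D p" using section_mem[OF Z pW] .
    have "act (Z p) f = act (\<Sum>a=1..k. coord p (Z p) a *\<^sub>R X a p) f" using D_expand[OF p Zp] by simp
    also have "\<dots> = (\<Sum>a=1..k. coord p ?v a * coord p (Z p) a)"
      unfolding act_sum act_scale by (intro sum.cong refl) (simp only: cfv mult.commute)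
    also have "\<dots> = g p ?v (Z p)" by (rule metric_coord[OF p v Zp, symmetric])
    finally show ?thesis ..
  qed
  then show "?v \<in> D p \<and> (\<forall>W Z. p \<in> W \<longrightarrow> is_section A D W Z \<longrightarrow> g p ?v (Z p) = act (Z p) f)"
    using v by blast
next
  fix v assume v: "v \<in> D p \<and> (\<forall>W Z. p \<in> W \<longrightarrow> is_section A D W Z \<longrightarrow> g p v (Z p) = act (Z p) f)"
  have "coord p v a = act (X a p) f" if a: "a \<in> {1..k}" for a
  proof -
    have "act (X a p) f = g p v (X a p)"
      using v p frame_section_D[OF order_refl frame_open a] by auto
    also have "\<dots> = (\<Sum>b=1..k. coord p v b * coord p (X a p) b)"
      using v frame_in_D[OF p a] by (intro metric_coord p) auto
    also have "\<dots> = (\<Sum>b=1..k. if b = a then coord p v b else 0)"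
      using a k_le_n by (intro sum.cong refl) (auto simp: coord_frame[OF p])
    finally show ?thesis using a by simp
  qed
  then show "v = (\<Sum>i=1..k. act (X i p) f *\<^sub>R X i p)"
    using D_expand[OF p conjunct1[OF v]] by simp
qed

definition gram_det :: "'a \<Rightarrow> real" where
  "gram_det p = (\<Prod>j=1..m. Determinant.det (gram j p))"

lemma gram_det_smooth: "smooth_on A U gram_det"
  unfolding gram_det_def
proof (rule smooth_on_prod[OF frame_open])
  fix j assume "j \<in> {1..m}"
  then show "smooth_on A U (\<lambda>p. Determinant.det (gram j p))"
    by (intro smooth_on_det[OF frame_open gram_smooth gram_carrier]) auto
qed

lemma act_gram_det:
  assumes q: "q \<in> U" and v: "v \<in> tangent_space A q"
  shows "act v gram_det = gram_det q * (\<Sum>j=1..m. mat_trace (gram_inv j q * mat_derivative v (gram j) q))"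
proof -
  have sm: "smooth_at A q (\<lambda>p. gram j p $$ (r, s))" if "j \<in> {1..m}" "r < width j" "s < width j" for j r s
    by (rule smooth_atI[OF frame_open q gram_smooth]) (use that in auto)
  have "act v gram_det = (\<Sum>j=1..m. act v (\<lambda>p. Determinant.det (gram j p)) * (\<Prod>i\<in>{1..m} - {j}. Determinant.det (gram i q)))"
    unfolding gram_det_def
  proof (rule act_of_prod[OF v finite_atLeastAtMost])
    fix j assume j: "j \<in> {1..m}"
    show "smooth_at A q (\<lambda>p. Determinant.det (gram j p))"
      by (rule smooth_atI[OF frame_open q smooth_on_det[OF frame_open gram_smooth gram_carrier]]) (use j in auto)
  qed
  also have "\<dots> = (\<Sum>j=1..m. gram_det q * mat_trace (gram_inv j q * mat_derivative v (gram j) q))"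
  proof (intro sum.cong refl)
    fix j assume j: "j \<in> {1..m}"
    then have j': "1 \<le> j" "j \<le> m" by auto
    have "act v (\<lambda>p. Determinant.det (gram j p))
        = Determinant.det (gram j q) * mat_trace (gram_inv j q * mat_derivative v (gram j) q)"
      by (rule act_det_trace[OF v gram_carrier sm[OF j] gram_inv_facts(1)[OF q j'] gram_inv_facts(3)[OF q j']])
    moreover have "gram_det q = Determinant.det (gram j q) * (\<Prod>i\<in>{1..m} - {j}. Determinant.det (gram i q))"
      unfolding gram_det_def using j by (intro prod.remove) auto
    ultimately show "act v (\<lambda>p. Determinant.det (gram j p)) * (\<Prod>i\<in>{1..m} - {j}. Determinant.det (gram i q))
        = gram_det q * mat_trace (gram_inv j q * mat_derivative v (gram j) q)" by simp
  qed
  finally show ?thesis by (simp add: sum_distrib_left)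
qed

end

locale popp_frame_domain = adapted_frame_domain A D g n k m \<kappa> \<omega> U X
  for A :: "('a::{t2_space, second_countable_topology}, 'e::euclidean_space) atlas"
    and D g n k m \<kappa> \<omega> U X +
  fixes P :: "'a \<Rightarrow> (nat \<Rightarrow> 'a functional) \<Rightarrow> real"
  assumes popp: "popp_volume A D g n m \<kappa> \<omega> P"
begin

text \<open>The density of Popp's volume with respect to the coframe dual to the frame.\<close>

definition popp_density :: "'a \<Rightarrow> real" where "popp_density p = P p (\<lambda>i. X i p)"

lemma P_alternating: "alternating_form n (tangent_space A p) (P p)"
  using popp by (auto simp: popp_volume_def)

lemma popp_density_gram_det: "p \<in> U \<Longrightarrow> popp_density p * popp_density p * gram_det p = 1"
  using popp_volume_frame[OF popp] by (simp add: popp_density_def gram_det_def power2_eq_square)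

lemma popp_density_nz: "p \<in> U \<Longrightarrow> popp_density p \<noteq> 0"
  using popp_density_gram_det by fastforce

lemma popp_density_pos: "p \<in> U \<Longrightarrow> 0 < popp_density p * \<omega> p (\<lambda>i. X i p)"
  using popp frame_basis by (auto simp: popp_volume_def popp_density_def)

text \<open>By \<open>popp_volume_frame\<close> the density is \<open>1 / sqrt gram_det\<close> up to a sign, which is that of
  \<open>w = \<omega>(X 1, \<dots>, X n)\<close>. Writing the sign as \<open>w / sqrt (w\<^sup>2)\<close> gives a smooth expression at once, without
  an argument that it is locally constant.\<close>

lemma popp_density_smooth: "smooth_on A U popp_density"
proof -
  let ?w = "\<lambda>p. \<omega> p (\<lambda>i. X i p)"
  let ?s = "\<lambda>p. ?w p * ?w p * gram_det p"
  have eq: "?s p = (?w p / popp_density p)\<^sup>2" if p: "p \<in> U" for p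
  proof -
    have "gram_det p = 1 / (popp_density p)\<^sup>2"
      using popp_density_gram_det[OF p] popp_density_nz[OF p] by (simp add: field_simps power2_eq_square)
    then show ?thesis by (simp add: power2_eq_square)
  qed
  have pos: "0 < ?w p / popp_density p" if "p \<in> U" for p
    using popp_density_pos[OF that] by (simp add: zero_less_divide_iff zero_less_mult_iff) blast
  have spos: "0 < ?s p" if "p \<in> U" for p
    unfolding eq[OF that] by (rule zero_less_power[OF pos[OF that]])
  have w: "smooth_on A U ?w" by (rule orientation_smooth[OF frame_open frame_vf])
  have "smooth_on A U (\<lambda>p. ?w p * inverse (sqrt (?s p)))"
    by (intro smooth_on_mult smooth_on_inverse_sqrt frame_open w gram_det_smooth spos)
  then show ?thesis
  proof (rule smooth_on_cong[OF frame_open])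
    fix p assume p: "p \<in> U"
    have "sqrt (?s p) = ?w p / popp_density p"
      unfolding eq[OF p] using real_sqrt_abs[of "?w p / popp_density p"] abs_of_pos[OF pos[OF p]] by simp
    then show "?w p * inverse (sqrt (?s p)) = popp_density p" using orientation_nz[OF p] by simp
  qed
qed

text \<open>Differentiate \<open>popp_density\<^sup>2 * gram_det = 1\<close> and apply Jacobi's formula to \<open>gram_det\<close>.\<close>

lemma act_popp_density:
  assumes q: "q \<in> U" and v: "v \<in> tangent_space A q"
  shows "act v popp_density = - (1/2) * popp_density q * (\<Sum>j=1..m. mat_trace (gram_inv j q * mat_derivative v (gram j) q))"
proof -
  have r: "smooth_at A q popp_density" and d: "smooth_at A q gram_det"
    using smooth_atI[OF frame_open q] popp_density_smooth gram_det_smooth by blast+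
  let ?t = "\<Sum>j=1..m. mat_trace (gram_inv j q * mat_derivative v (gram j) q)"
  have "act v (\<lambda>p. popp_density p * popp_density p * gram_det p) = act v (\<lambda>p. 1)"
    by (rule act_local[OF v frame_open q]) (rule popp_density_gram_det)
  then have "popp_density q * popp_density q * act v gram_det + gram_det q * (popp_density q * act v popp_density + popp_density q * act v popp_density) = 0"
    by (simp add: act_mult[OF v smooth_at_mult[OF r r] d] act_mult[OF v r r] act_const[OF v])
  then have "(popp_density q * popp_density q * gram_det q) * ?t + 2 * gram_det q * popp_density q * act v popp_density = 0"
    unfolding act_gram_det[OF q v] by (simp add: algebra_simps)
  then have "?t = - 2 * gram_det q * popp_density q * act v popp_density" using popp_density_gram_det[OF q] by simp
  then have "popp_density q * ?t = - 2 * (popp_density q * popp_density q * gram_det q) * act v popp_density" by (simp add: algebra_simps)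
  then show ?thesis using popp_density_gram_det[OF q] by simp
qed

lemma P_orientation:
  assumes "p \<in> U" "\<And>j. j \<in> {1..n} \<Longrightarrow> v j \<in> tangent_space A p"
  shows "P p v = popp_density p * inverse (\<omega> p (\<lambda>i. X i p)) * \<omega> p v"
proof -
  have "P p v * \<omega> p (\<lambda>i. X i p) = popp_density p * \<omega> p v"
    unfolding popp_density_def
    by (rule alternating_form_proportional[OF P_alternating orientation_alternating frame_basis[OF assms(1)]])
      (rule assms(2))
  then show ?thesis using orientation_nz[OF assms(1)] by (simp add: field_simps)
qed

text \<open>Popp's volume is a smooth multiple of the orientation form.\<close>

lemma P_smooth:
  assumes W: "open W" "W \<subseteq> U" and Y: "\<And>i. i \<in> {1..n} \<Longrightarrow> smooth_vf A W (Y i)"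
  shows "smooth_on A W (\<lambda>p. P p (\<lambda>i. Y i p))"
proof -
  have w: "smooth_on A U (\<lambda>p. \<omega> p (\<lambda>i. X i p))" by (rule orientation_smooth[OF frame_open frame_vf])
  have "smooth_on A U (\<lambda>p. popp_density p * inverse (\<omega> p (\<lambda>i. X i p)))"
    by (intro smooth_on_mult smooth_on_inverse frame_open popp_density_smooth w orientation_nz)
  then have "smooth_on A W (\<lambda>p. popp_density p * inverse (\<omega> p (\<lambda>i. X i p)))"
    using W(2) by (rule smooth_on_subset)
  then have "smooth_on A W (\<lambda>p. popp_density p * inverse (\<omega> p (\<lambda>i. X i p)) * \<omega> p (\<lambda>i. Y i p))"
    by (rule smooth_on_mult[OF W(1) _ orientation_smooth[OF W(1) Y]])
  then show ?thesis
  proof (rule smooth_on_cong[OF W(1)])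
    fix p assume p: "p \<in> W"
    show "popp_density p * inverse (\<omega> p (\<lambda>i. X i p)) * \<omega> p (\<lambda>i. Y i p) = P p (\<lambda>i. Y i p)"
      by (rule P_orientation[symmetric]) (use p W Y smooth_vfD in blast)+
  qed
qed

lemma P_frame_upd:
  assumes p: "p \<in> U" and v: "v \<in> tangent_space A p"
  shows "P p ((\<lambda>j. X j p)(l := v)) = coord p v l * popp_density p"
proof -
  have "P p ((\<lambda>j. X j p)(l := v)) = popp_density p * inverse (\<omega> p (\<lambda>i. X i p)) * \<omega> p ((\<lambda>j. X j p)(l := v))"
    using frame_tangent[OF p] v by (intro P_orientation p) auto
  then show ?thesis by (simp add: coord_def field_simps)
qed

lemma lie_derivative_local:
  assumes "\<And>i. i \<in> {1..n} \<Longrightarrow> Y i = Z i"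
  shows "lie_derivative A n G P Y q = lie_derivative A n G P Z q"
proof -
  have "P p (\<lambda>i. Y i p) = P p (\<lambda>i. Z i p)" for p
    by (rule alternating_form_local[OF P_alternating]) (simp add: assms)
  moreover have "P q ((\<lambda>j. Y j q)(i := bracket A G (Y i) q)) = P q ((\<lambda>j. Z j q)(i := bracket A G (Z i) q))"
    if "i \<in> {1..n}" for i
    by (rule alternating_form_local[OF P_alternating]) (use assms that in simp)
  ultimately show ?thesis by (simp add: lie_derivative_def)
qed

text \<open>Exchanging two fields changes the sign of \<open>P(Y)\<close>, and permutes the correction terms up to the same sign.\<close>

lemma lie_derivative_swap:
  assumes W: "open W" "W \<subseteq> U" "q \<in> W" and G: "smooth_vf A W G"
    and Y: "\<And>i. i \<in> {1..n} \<Longrightarrow> smooth_vf A W (Y i)"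
    and ij: "i \<in> {1..n}" "j \<in> {1..n}" "i \<noteq> j"
  shows "lie_derivative A n G P (Y \<circ> Transposition.transpose i j) q = - lie_derivative A n G P Y q"
proof -
  let ?t = "Transposition.transpose i j"
  have t: "?t permutes {1..n}" using ij by (intro permutes_swap_id)
  have injt: "?t r = ?t l \<longleftrightarrow> r = l" for r l by (metis Transposition.transpose_involutory)
  have Gq: "G q \<in> tangent_space A q" using smooth_vfD(1)[OF G W(3)] .
  have Yp: "\<forall>l\<in>{1..n}. Y l p \<in> tangent_space A p" if "p \<in> W" for p using Y smooth_vfD(1) that by blast
  have sw: "P p (v \<circ> ?t) = - P p v" if "\<forall>l\<in>{1..n}. v l \<in> tangent_space A p" for p v
    by (rule alternating_form_swap[OF P_alternating tangent_space_subspace that ij])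
  have Psm: "smooth_at A q (\<lambda>p. P p (\<lambda>l. Y l p))"
    by (rule smooth_atI[OF W(1,3)], rule P_smooth[OF W(1,2)]) (rule Y)
  have "act (G q) (\<lambda>p. P p (\<lambda>l. (Y \<circ> ?t) l p)) = act (G q) (\<lambda>p. (- 1) * P p (\<lambda>l. Y l p))"
  proof (rule act_local[OF Gq W(1,3)])
    fix p assume "p \<in> W"
    then show "P p (\<lambda>l. (Y \<circ> ?t) l p) = (- 1) * P p (\<lambda>l. Y l p)"
      using sw[of "\<lambda>l. Y l p" p] Yp by (simp add: comp_def)
  qed
  also have "\<dots> = - act (G q) (\<lambda>p. P p (\<lambda>l. Y l p))"
    using act_cmult[OF Gq Psm, where c = "- 1"] by simp
  finally have 1: "act (G q) (\<lambda>p. P p (\<lambda>l. (Y \<circ> ?t) l p)) = - act (G q) (\<lambda>p. P p (\<lambda>l. Y l p))" .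
  have br: "bracket A G (Y l) q \<in> tangent_space A q" if "l \<in> {1..n}" for l
    using smooth_vfD(1)[OF smooth_vf_bracket[OF G Y[OF that]] W(3)] .
  have "(\<Sum>l=1..n. P q ((\<lambda>r. (Y \<circ> ?t) r q)(l := bracket A G ((Y \<circ> ?t) l) q)))
      = (\<Sum>l=1..n. - P q ((\<lambda>r. Y r q)(?t l := bracket A G (Y (?t l)) q)))"
  proof (intro sum.cong refl)
    fix l assume l: "l \<in> {1..n}"
    have tl: "?t l \<in> {1..n}" using permutes_in_image[OF t] l by blast
    have "(\<lambda>r. (Y \<circ> ?t) r q)(l := bracket A G ((Y \<circ> ?t) l) q)
        = (\<lambda>r. Y r q)(?t l := bracket A G (Y (?t l)) q) \<circ> ?t"
      using injt by (auto simp: fun_eq_iff)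
    then show "P q ((\<lambda>r. (Y \<circ> ?t) r q)(l := bracket A G ((Y \<circ> ?t) l) q))
        = - P q ((\<lambda>r. Y r q)(?t l := bracket A G (Y (?t l)) q))"
      using sw[of "(\<lambda>r. Y r q)(?t l := bracket A G (Y (?t l)) q)" q] Yp[OF W(3)] br[OF tl] by simp
  qed
  also have "\<dots> = - (\<Sum>l=1..n. P q ((\<lambda>r. Y r q)(l := bracket A G (Y l) q)))"
    using sum.permute[OF t, of "\<lambda>l. - P q ((\<lambda>r. Y r q)(l := bracket A G (Y l) q))"]
    by (simp add: comp_def sum_negf)
  finally show ?thesis using 1 by (simp add: lie_derivative_def)
qed

text \<open>The Lie derivative is linear over smooth functions in each slot: the derivatives of the coefficients
  produced by \<open>G(P(Y))\<close> (\<open>D1\<close>) and by the bracket in slot \<open>i\<close> (\<open>D3\<close>) cancel, and the brackets in the other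
  slots (\<open>D2\<close>) produce none.\<close>

lemma lie_derivative_expand:
  assumes W: "open W" "W \<subseteq> U" "q \<in> W" and G: "smooth_vf A W G"
    and Y: "\<And>i. i \<in> {1..n} \<Longrightarrow> smooth_vf A W (Y i)" and i: "i \<in> {1..n}"
  shows "lie_derivative A n G P Y q = (\<Sum>l=1..n. coord q (Y i q) l * lie_derivative A n G P (Y(i := X l)) q)"
proof -
  let ?T = "tangent_space A"
  define f where "f l p = coord p (Y i p) l" for l p
  define Z where "Z l = Y(i := X l)" for l
  have qU: "q \<in> U" using W by auto
  have Gq: "G q \<in> ?T q" using smooth_vfD(1)[OF G W(3)] .
  have Xvf: "smooth_vf A W (X l)" if "l \<in> {1..n}" for l using smooth_vf_subset[OF frame_vf[OF that] W(1,2)] .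
  have Zvf: "smooth_vf A W (Z l r)" if "l \<in> {1..n}" "r \<in> {1..n}" for l r
    using that Xvf Y by (simp add: Z_def)
  have Yp: "\<forall>r\<in>{1..n}. Y r p \<in> ?T p" if "p \<in> W" for p using Y smooth_vfD(1) that by blast
  have Xp: "X l p \<in> ?T p" if "l \<in> {1..n}" "p \<in> W" for l p using Xvf smooth_vfD(1) that by blast
  have br: "bracket A G (Y r) q \<in> ?T q" if "r \<in> {1..n}" for r
    using smooth_vfD(1)[OF smooth_vf_bracket[OF G Y[OF that]] W(3)] .
  have brX: "bracket A G (X r) q \<in> ?T q" if "r \<in> {1..n}" for r
    using smooth_vfD(1)[OF smooth_vf_bracket[OF G Xvf[OF that]] W(3)] .
  have Yi: "Y i p = (\<Sum>l=1..n. f l p *\<^sub>R X l p)" if "p \<in> W" for p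
    unfolding f_def using coord_expand[of p "Y i p"] Yp[OF that] i W that by auto
  have fs: "smooth_on A W (f l)" if "l \<in> {1..n}" for l
    unfolding f_def by (rule coord_smooth[OF W(2,1) Y[OF i] that])
  have fq: "smooth_at A q (f l)" if "l \<in> {1..n}" for l
    using smooth_atI[OF W(1,3) fs[OF that]] .
  have PZ: "smooth_at A q (\<lambda>p. P p (\<lambda>r. Z l r p))" if "l \<in> {1..n}" for l
    by (rule smooth_atI[OF W(1,3) P_smooth[OF W(1,2) Zvf[OF that]]])
  have slot: "P p (v(i := \<Sum>l=1..n. a l *\<^sub>R y l)) = (\<Sum>l=1..n. a l * P p (v(i := y l)))"
    if "\<forall>r\<in>{1..n}. v r \<in> ?T p" "\<And>l. l \<in> {1..n} \<Longrightarrow> y l \<in> ?T p" for p v a y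
    by (rule alternating_form_sum[OF P_alternating tangent_space_subspace that(1) i that(2)])
  have Zupd: "(\<lambda>r. Z l r p) = (\<lambda>r. Y r p)(i := X l p)" for l p by (auto simp: Z_def)
  have PY: "P p (\<lambda>r. Y r p) = (\<Sum>l=1..n. f l p * P p (\<lambda>r. Z l r p))" if p: "p \<in> W" for p
  proof -
    have "(\<lambda>r. Y r p) = (\<lambda>r. Y r p)(i := \<Sum>l=1..n. f l p *\<^sub>R X l p)" using Yi[OF p] by auto
    then have "P p (\<lambda>r. Y r p) = P p ((\<lambda>r. Y r p)(i := \<Sum>l=1..n. f l p *\<^sub>R X l p))" by (rule arg_cong)
    also have "\<dots> = (\<Sum>l=1..n. f l p * P p ((\<lambda>r. Y r p)(i := X l p)))"
      by (rule slot[OF Yp[OF p] Xp[OF _ p]])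
    finally show ?thesis by (simp only: Zupd)
  qed
  have "act (G q) (\<lambda>p. P p (\<lambda>r. Y r p)) = act (G q) (\<lambda>p. \<Sum>l=1..n. f l p * P p (\<lambda>r. Z l r p))"
    by (rule act_local[OF Gq W(1,3) PY])
  also have "\<dots> = (\<Sum>l=1..n. act (G q) (\<lambda>p. f l p * P p (\<lambda>r. Z l r p)))"
    by (rule act_of_sum[OF Gq smooth_at_mult[OF fq PZ]])
  also have "\<dots> = (\<Sum>l=1..n. f l q * act (G q) (\<lambda>p. P p (\<lambda>r. Z l r p)) + P q (\<lambda>r. Z l r q) * act (G q) (f l))"
    by (intro sum.cong refl act_mult[OF Gq] fq PZ)
  finally have D1: "act (G q) (\<lambda>p. P p (\<lambda>r. Y r p))
      = (\<Sum>l=1..n. f l q * act (G q) (\<lambda>p. P p (\<lambda>r. Z l r p))) + (\<Sum>l=1..n. P q (\<lambda>r. Z l r q) * act (G q) (f l))"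
    by (simp add: sum.distrib)
  have D2: "P q ((\<lambda>s. Y s q)(r := bracket A G (Y r) q))
      = (\<Sum>l=1..n. f l q * P q ((\<lambda>s. Z l s q)(r := bracket A G (Z l r) q)))" if r: "r \<in> {1..n} - {i}" for r
  proof -
    let ?v = "(\<lambda>s. Y s q)(r := bracket A G (Y r) q)"
    have "?v = ?v(i := \<Sum>l=1..n. f l q *\<^sub>R X l q)" using Yi[OF W(3)] r by auto
    then have "P q ?v = P q (?v(i := \<Sum>l=1..n. f l q *\<^sub>R X l q))" by (rule arg_cong)
    also have "\<dots> = (\<Sum>l=1..n. f l q * P q (?v(i := X l q)))"
      using Yp[OF W(3)] br r by (intro slot Xp W) auto
    also have "\<dots> = (\<Sum>l=1..n. f l q * P q ((\<lambda>s. Z l s q)(r := bracket A G (Z l r) q)))"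
      using r by (intro sum.cong refl arg_cong2[where f = "(*)"] arg_cong[where f = "P q"]) (auto simp: Z_def)
    finally show ?thesis .
  qed
  have D3: "P q ((\<lambda>s. Y s q)(i := bracket A G (Y i) q))
      = (\<Sum>l=1..n. f l q * P q ((\<lambda>s. Z l s q)(i := bracket A G (Z l i) q))) + (\<Sum>l=1..n. P q (\<lambda>r. Z l r q) * act (G q) (f l))"
  proof -
    have Yiq: "Y i q \<in> ?T q" using Yp[OF W(3)] i by blast
    have "bracket A G (Y i) q = bracket A G (\<lambda>p. \<Sum>l=1..n. f l p *\<^sub>R X l p) q"
      by (rule bracket_local[OF _ refl _ _ W(1,3)]) (rule Gq Yiq Yi, assumption?)+
    also have "\<dots> = (\<Sum>l=1..n. f l q *\<^sub>R bracket A G (X l) q + act (G q) (f l) *\<^sub>R X l q)"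
      by (rule bracket_sum[OF G W(3) Xvf fs])
    finally have b: "bracket A G (Y i) q
        = 1 *\<^sub>R (\<Sum>l=1..n. f l q *\<^sub>R bracket A G (X l) q) + 1 *\<^sub>R (\<Sum>l=1..n. act (G q) (f l) *\<^sub>R X l q)"
      by (simp add: sum.distrib)
    have "P q ((\<lambda>s. Y s q)(i := bracket A G (Y i) q))
        = 1 * P q ((\<lambda>s. Y s q)(i := \<Sum>l=1..n. f l q *\<^sub>R bracket A G (X l) q))
          + 1 * P q ((\<lambda>s. Y s q)(i := \<Sum>l=1..n. act (G q) (f l) *\<^sub>R X l q))"
      unfolding b
      by (intro alternating_form_lin[OF P_alternating Yp[OF W(3)] i] subspace_sum subspace_scale
          tangent_space_subspace brX Xp W)
    also have "P q ((\<lambda>s. Y s q)(i := \<Sum>l=1..n. f l q *\<^sub>R bracket A G (X l) q))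
        = (\<Sum>l=1..n. f l q * P q ((\<lambda>s. Y s q)(i := bracket A G (X l) q)))"
      by (rule slot[OF Yp[OF W(3)] brX])
    also have "P q ((\<lambda>s. Y s q)(i := \<Sum>l=1..n. act (G q) (f l) *\<^sub>R X l q))
        = (\<Sum>l=1..n. act (G q) (f l) * P q ((\<lambda>s. Y s q)(i := X l q)))"
      by (rule slot[OF Yp[OF W(3)] Xp[OF _ W(3)]])
    finally have e: "P q ((\<lambda>s. Y s q)(i := bracket A G (Y i) q))
        = (\<Sum>l=1..n. f l q * P q ((\<lambda>s. Y s q)(i := bracket A G (X l) q)))
          + (\<Sum>l=1..n. act (G q) (f l) * P q ((\<lambda>s. Y s q)(i := X l q)))" by (simp only: mult_1)
    have "(\<lambda>s. Z l s q)(i := bracket A G (Z l i) q) = (\<lambda>s. Y s q)(i := bracket A G (X l) q)" for l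
      by (auto simp: Z_def)
    then show ?thesis unfolding e by (simp only: Zupd mult.commute)
  qed
  have shift: "(\<Sum>r=1..n. x r) = K + (\<Sum>r=1..n. y r)"
    if "x i = y i + K" "\<And>r. r \<in> {1..n} - {i} \<Longrightarrow> x r = y r" for x y :: "nat \<Rightarrow> real" and K
    using sum.remove[of "{1..n}" i x] sum.remove[of "{1..n}" i y] that i by simp
  have s1: "(\<Sum>r=1..n. P q ((\<lambda>s. Y s q)(r := bracket A G (Y r) q)))
     = (\<Sum>l=1..n. P q (\<lambda>r. Z l r q) * act (G q) (f l))
       + (\<Sum>r=1..n. \<Sum>l=1..n. f l q * P q ((\<lambda>s. Z l s q)(r := bracket A G (Z l r) q)))"
    by (rule shift) (rule D3, rule D2)
  have s2: "(\<Sum>r=1..n. \<Sum>l=1..n. f l q * P q ((\<lambda>s. Z l s q)(r := bracket A G (Z l r) q)))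
     = (\<Sum>l=1..n. f l q * (\<Sum>r=1..n. P q ((\<lambda>s. Z l s q)(r := bracket A G (Z l r) q))))"
    by (subst sum.swap) (simp add: sum_distrib_left)
  have "lie_derivative A n G P Y q = (\<Sum>l=1..n. f l q * act (G q) (\<lambda>p. P p (\<lambda>r. Z l r p)))
      - (\<Sum>l=1..n. f l q * (\<Sum>r=1..n. P q ((\<lambda>s. Z l s q)(r := bracket A G (Z l r) q))))"
    unfolding lie_derivative_def D1 s1 s2 by linarith
  also have "\<dots> = (\<Sum>l=1..n. f l q * lie_derivative A n G P (Z l) q)"
    unfolding lie_derivative_def by (simp only: right_diff_distrib sum_subtractf)
  finally show ?thesis by (simp only: f_def Z_def)
qed

text \<open>The Lie derivative at \<open>q\<close> is alternating and linear over smooth functions, hence a multiple of \<open>P q\<close>;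
  the frame determines the factor.\<close>

lemma lie_derivative_proportional:
  assumes W: "open W" "W \<subseteq> U" "q \<in> W" and G: "smooth_vf A W G"
    and Y: "\<And>i. i \<in> {1..n} \<Longrightarrow> smooth_vf A W (Y i)"
  shows "lie_derivative A n G P Y q * popp_density q = lie_derivative A n G P X q * P q (\<lambda>i. Y i q)"
proof -
  have qU: "q \<in> U" using W by auto
  define Q where "Q Y = lie_derivative A n G P Y q * popp_density q - lie_derivative A n G P X q * P q (\<lambda>i. Y i q)" for Y
  have "Q Y = 0"
  proof (rule alternating_vanish[where M = "{Y. smooth_vf A W Y}" and x = X and n = n])
    fix v w :: "nat \<Rightarrow> 'a \<Rightarrow> 'a functional" assume vw: "\<And>i. i \<in> {1..n} \<Longrightarrow> v i = w i"
    have "P q (\<lambda>i. v i q) = P q (\<lambda>i. w i q)"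
      by (rule alternating_form_local[OF P_alternating]) (simp add: vw)
    moreover have "lie_derivative A n G P v q = lie_derivative A n G P w q"
      by (rule lie_derivative_local) (rule vw)
    ultimately show "Q v = Q w" by (simp add: Q_def)
  next
    fix v :: "nat \<Rightarrow> 'a \<Rightarrow> 'a functional" and i j
    assume v: "\<And>l. l \<in> {1..n} \<Longrightarrow> v l \<in> {Y. smooth_vf A W Y}" and ij: "i \<in> {1..n}" "j \<in> {1..n}" "i \<noteq> j"
    have v': "smooth_vf A W (v l)" if "l \<in> {1..n}" for l using v[OF that] by simp
    have "\<forall>l\<in>{1..n}. v l q \<in> tangent_space A q" using smooth_vfD(1)[OF v' W(3)] by blast
    from alternating_form_swap[OF P_alternating tangent_space_subspace this ij]
    have "P q (\<lambda>l. (v \<circ> Transposition.transpose i j) l q) = - P q (\<lambda>l. v l q)" by (simp add: comp_def)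
    moreover have "lie_derivative A n G P (v \<circ> Transposition.transpose i j) q = - lie_derivative A n G P v q"
      by (rule lie_derivative_swap[OF W G _ ij]) (rule v')
    ultimately show "Q (v \<circ> Transposition.transpose i j) = - Q v" by (simp add: Q_def)
  next
    fix v :: "nat \<Rightarrow> 'a \<Rightarrow> 'a functional" and i
    assume v: "\<And>l. l \<in> {1..n} \<Longrightarrow> v l \<in> {Y. smooth_vf A W Y}" and i: "i \<in> {1..n}"
    have v': "smooth_vf A W (v l)" if "l \<in> {1..n}" for l using v[OF that] by simp
    have vq: "\<forall>l\<in>{1..n}. v l q \<in> tangent_space A q" using smooth_vfD(1)[OF v' W(3)] by blast
    have "(\<lambda>l. v l q) = (\<lambda>l. v l q)(i := \<Sum>l=1..n. coord q (v i q) l *\<^sub>R X l q)"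
      using coord_expand[OF qU, of "v i q"] vq i by auto
    then have "P q (\<lambda>l. v l q) = P q ((\<lambda>l. v l q)(i := \<Sum>l=1..n. coord q (v i q) l *\<^sub>R X l q))"
      by (rule arg_cong)
    also have "\<dots> = (\<Sum>l=1..n. coord q (v i q) l * P q ((\<lambda>l. v l q)(i := X l q)))"
      by (rule alternating_form_sum[OF P_alternating tangent_space_subspace vq i frame_tangent[OF qU]])
    also have "\<dots> = (\<Sum>l=1..n. coord q (v i q) l * P q (\<lambda>r. (v(i := X l)) r q))"
      by (intro sum.cong refl arg_cong2[where f = "(*)"] arg_cong[where f = "P q"]) auto
    finally have Pv: "P q (\<lambda>l. v l q) = (\<Sum>l=1..n. coord q (v i q) l * P q (\<lambda>r. (v(i := X l)) r q))" .
    have Lv: "lie_derivative A n G P v q = (\<Sum>l=1..n. coord q (v i q) l * lie_derivative A n G P (v(i := X l)) q)"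
      by (rule lie_derivative_expand[OF W G _ i]) (rule v')
    have "Q v = (\<Sum>l=1..n. coord q (v i q) l * Q (v(i := X l)))"
      unfolding Q_def Pv Lv
      by (simp add: sum_distrib_left sum_distrib_right sum_subtractf right_diff_distrib mult_ac)
    then show "\<exists>a. Q v = (\<Sum>l=1..n. a l * Q (v(i := X l)))"
      by (intro exI[of _ "coord q (v i q)"])
  next
    show "X l \<in> {Y. smooth_vf A W Y}" if "l \<in> {1..n}" for l
      using smooth_vf_subset[OF frame_vf[OF that] W(1,2)] by simp
  qed (use Y in \<open>auto simp: Q_def popp_density_def\<close>)
  then show ?thesis by (simp add: Q_def)
qed

lemma divergence_frame:
  assumes G: "smooth_vf A U G" and q: "q \<in> U"
  shows "divergence A n P G q = lie_derivative A n G P X q / popp_density q"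
  unfolding divergence_def
proof (rule the_equality)
  show "\<forall>W Y. q \<in> W \<longrightarrow> (\<forall>i\<in>{1..n}. smooth_vf A W (Y i)) \<longrightarrow>
     lie_derivative A n G P Y q = lie_derivative A n G P X q / popp_density q * P q (\<lambda>i. Y i q)"
  proof (intro allI impI)
    fix W Y assume qW: "q \<in> W" and Y: "\<forall>i\<in>{1..n}. smooth_vf A W (Y i)"
    have "1 \<in> {1..n}" using n_ge by simp
    then have "open W" using Y by (auto simp: smooth_vf_def)
    then have W': "open (W \<inter> U)" "W \<inter> U \<subseteq> U" "q \<in> W \<inter> U" using q qW frame_open by auto
    have G': "smooth_vf A (W \<inter> U) G" using smooth_vf_subset[OF G W'(1,2)] .
    have Y': "smooth_vf A (W \<inter> U) (Y i)" if "i \<in> {1..n}" for i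
      using Y that smooth_vf_subset[OF _ W'(1)] by blast
    have "lie_derivative A n G P Y q * popp_density q = lie_derivative A n G P X q * P q (\<lambda>i. Y i q)"
      by (rule lie_derivative_proportional[OF W' G']) (rule Y')
    then show "lie_derivative A n G P Y q = lie_derivative A n G P X q / popp_density q * P q (\<lambda>i. Y i q)"
      using popp_density_nz[OF q] by (simp add: field_simps)
  qed
next
  fix r assume r: "\<forall>W Y. q \<in> W \<longrightarrow> (\<forall>i\<in>{1..n}. smooth_vf A W (Y i)) \<longrightarrow>
     lie_derivative A n G P Y q = r * P q (\<lambda>i. Y i q)"
  have "lie_derivative A n G P X q = r * popp_density q" using r q frame_vf unfolding popp_density_def by blast
  then show "r = lie_derivative A n G P X q / popp_density q" using popp_density_nz[OF q] by simp
qed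

text \<open>By \<open>divergence_frame\<close> it suffices to evaluate the Lie derivative along \<open>G = \<Sum> u\<^sub>i X\<^sub>i\<close>, \<open>u\<^sub>i = X\<^sub>i(f)\<close>, on the frame.
  The derivative of the density contributes the traces; the \<open>l\<close>-th coordinate of \<open>[G, X\<^sub>l]\<close> is
  \<open>\<Sum>\<^sub>i u\<^sub>i c\<^sup>l\<^sub>i\<^sub>l - X\<^sub>l(u\<^sub>l)\<close>, where the last term is present for \<open>l \<le> k\<close> only and yields the second derivatives.\<close>

lemma sub_laplacian_frame:
  assumes f: "smooth_on A U f" and q: "q \<in> U" and c: "structure_constants A n U X c"
  shows "sub_laplacian A D g n P f q = (\<Sum>i=1..k. act (X i q) (\<lambda>p. act (X i p) f)
     - (1 / 2 * (\<Sum>j=1..m. mat_trace (gram_inv j q * mat_derivative (X i q) (gram j) q))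
        + (\<Sum>l=1..n. c i l l q)) * act (X i q) f)"
proof -
  define G where "G = gradient A D g f"
  define u where "u i p = act (X i p) f" for i p
  let ?tr = "\<lambda>i. \<Sum>j=1..m. mat_trace (gram_inv j q * mat_derivative (X i q) (gram j) q)"
  have Xvf: "smooth_vf A U (X i)" if "i \<in> {1..k}" for i using frame_vf that k_le_n by auto
  have Xq: "X i q \<in> tangent_space A q" if "i \<in> {1..k}" for i using frame_tangent[OF q] that k_le_n by auto
  have us: "smooth_on A U (u i)" if "i \<in> {1..k}" for i
    unfolding u_def by (rule smooth_vf_act[OF Xvf[OF that] f])
  have Geq: "G p = (\<Sum>i=1..k. u i p *\<^sub>R X i p)" if "p \<in> U" for p
    unfolding G_def u_def by (rule gradient_frame[OF f that])
  have Gvf: "smooth_vf A U G"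
    by (rule smooth_vf_cong[OF smooth_vf_sum[OF frame_open Xvf us]]) (simp_all add: Geq)
  have Gq: "G q \<in> tangent_space A q" using smooth_vfD(1)[OF Gvf q] .
  have 1: "act (G q) popp_density = - popp_density q * (\<Sum>i=1..k. 1 / 2 * ?tr i * u i q)"
  proof -
    have "act (G q) popp_density = (\<Sum>i=1..k. u i q * act (X i q) popp_density)"
      unfolding Geq[OF q] act_sum act_scale ..
    also have "\<dots> = (\<Sum>i=1..k. - popp_density q * (1 / 2 * ?tr i * u i q))"
      by (intro sum.cong refl) (simp add: act_popp_density[OF q Xq])
    finally show ?thesis by (simp only: sum_distrib_left)
  qed
  have 2: "P q ((\<lambda>j. X j q)(l := bracket A G (X l) q))
      = popp_density q * ((\<Sum>i=1..k. c i l l q * u i q) - (if l \<le> k then act (X l q) (u l) else 0))"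
    if l: "l \<in> {1..n}" for l
  proof -
    have Xl: "smooth_vf A U (X l)" "X l q \<in> tangent_space A q" using frame_vf[OF l] frame_tangent[OF q l] by auto
    have "bracket A (X l) G q = bracket A (X l) (\<lambda>p. \<Sum>i=1..k. u i p *\<^sub>R X i p) q"
      by (rule bracket_local[OF _ refl _ _ frame_open q]) (rule Xl(2) Gq Geq, assumption?)+
    also have "\<dots> = (\<Sum>i=1..k. u i q *\<^sub>R bracket A (X l) (X i) q + act (X l q) (u i) *\<^sub>R X i q)"
      by (rule bracket_sum[OF Xl(1) q Xvf us])
    finally have b: "bracket A G (X l) q
        = (\<Sum>i=1..k. u i q *\<^sub>R bracket A (X i) (X l) q) - (\<Sum>i=1..k. act (X l q) (u i) *\<^sub>R X i q)"
      unfolding bracket_antisym[of G "X l"] bracket_antisym[of "X l" "X _"]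
      by (simp add: sum_subtractf)
    have br: "bracket A (X i) (X l) q \<in> tangent_space A q" if "i \<in> {1..k}" for i
      using smooth_vfD(1)[OF smooth_vf_bracket[OF Xvf[OF that] Xl(1)] q] .
    have cfb: "coord q (bracket A (X i) (X l) q) l = c i l l q" if i: "i \<in> {1..k}" for i
    proof -
      have "bracket A (X i) (X l) q = (\<Sum>s=1..n. c i l s q *\<^sub>R X s q)"
        using c i l q k_le_n by (auto simp: structure_constants_def)
      then show ?thesis using coord_of_comb[OF q l order_refl, of "\<lambda>s. c i l s q"] l by simp
    qed
    have cs: "coord q (\<Sum>i=1..k. u i q *\<^sub>R bracket A (X i) (X l) q) l
        = (\<Sum>i=1..k. u i q * coord q (bracket A (X i) (X l) q) l)"
      by (rule coord_sum[OF q l]) (rule br)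
    have "coord q (bracket A G (X l) q) l
        = coord q (\<Sum>i=1..k. u i q *\<^sub>R bracket A (X i) (X l) q) l - coord q (\<Sum>i=1..k. act (X l q) (u i) *\<^sub>R X i q) l"
      unfolding b by (intro coord_diff q l subspace_sum subspace_scale tangent_space_subspace br Xq)
    also have "coord q (\<Sum>i=1..k. u i q *\<^sub>R bracket A (X i) (X l) q) l = (\<Sum>i=1..k. c i l l q * u i q)"
      unfolding cs by (intro sum.cong refl) (simp only: cfb mult.commute)
    also have "coord q (\<Sum>i=1..k. act (X l q) (u i) *\<^sub>R X i q) l = (if l \<le> k then act (X l q) (u l) else 0)"
      by (rule coord_of_comb[OF q l k_le_n])
    finally show ?thesis
      using P_frame_upd[OF q smooth_vfD(1)[OF smooth_vf_bracket[OF Gvf Xl(1)] q], of l] by simp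
  qed
  have 3: "(\<Sum>l=1..n. if l \<le> k then act (X l q) (u l) else 0) = (\<Sum>i=1..k. act (X i q) (u i))"
    using k_le_n by (intro sum.mono_neutral_cong_right) auto
  have "lie_derivative A n G P X q = act (G q) popp_density
      - (\<Sum>l=1..n. popp_density q * ((\<Sum>i=1..k. c i l l q * u i q) - (if l \<le> k then act (X l q) (u l) else 0)))"
    unfolding lie_derivative_def popp_density_def[abs_def, symmetric] using 2 by simp
  also have "\<dots> = popp_density q * (- (\<Sum>i=1..k. 1 / 2 * ?tr i * u i q)
      - ((\<Sum>l=1..n. \<Sum>i=1..k. c i l l q * u i q) - (\<Sum>i=1..k. act (X i q) (u i))))"
    unfolding 1 sum_distrib_left[symmetric] sum_subtractf 3 by (simp add: algebra_simps)
  also have "(\<Sum>l=1..n. \<Sum>i=1..k. c i l l q * u i q) = (\<Sum>i=1..k. (\<Sum>l=1..n. c i l l q) * u i q)"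
    by (subst sum.swap) (simp add: sum_distrib_right)
  finally have "divergence A n P G q = - (\<Sum>i=1..k. 1 / 2 * ?tr i * u i q)
      - ((\<Sum>i=1..k. (\<Sum>l=1..n. c i l l q) * u i q) - (\<Sum>i=1..k. act (X i q) (u i)))"
    unfolding divergence_frame[OF Gvf q] using popp_density_nz[OF q] by simp
  also have "\<dots> = (\<Sum>i=1..k. act (X i q) (u i) - (1 / 2 * ?tr i + (\<Sum>l=1..n. c i l l q)) * u i q)"
    by (simp add: sum_subtractf sum.distrib algebra_simps)
  finally show ?thesis by (simp only: sub_laplacian_def G_def u_def[abs_def])
qed

end

theorem corollary2:
  fixes A :: "('a::{t2_space, second_countable_topology}, 'e::euclidean_space) atlas"
    and D :: "'a \<Rightarrow> 'a functional set"
    and g :: "'a \<Rightarrow> 'a functional \<Rightarrow> 'a functional \<Rightarrow> real"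
    and n k m :: nat
    and \<kappa> :: "nat \<Rightarrow> nat"
    and \<omega> P :: "'a \<Rightarrow> (nat \<Rightarrow> 'a functional) \<Rightarrow> real"
    and U :: "'a set"
    and X :: "nat \<Rightarrow> 'a \<Rightarrow> 'a functional"
    and c :: "nat \<Rightarrow> nat \<Rightarrow> nat \<Rightarrow> 'a \<Rightarrow> real"
    and b :: "nat list \<Rightarrow> nat \<Rightarrow> 'a \<Rightarrow> real"
  assumes "sub_riemannian A n D k g"
    and "equiregular A D \<kappa>"
    and "has_step A D m"
    and "orientation_form A n \<omega>"
    and "popp_volume A D g n m \<kappa> \<omega> P"
    and "adapted_frame A D g n k m \<kappa> U X"
    and "structure_constants A n U X c"
    and "adapted_structure_constants A D k m \<kappa> U X b"
  shows "\<forall>f. smooth_on A U f \<longrightarrow> (\<forall>q\<in>U.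
    sub_laplacian A D g n P f q =
      (\<Sum>i=1..k. act (X i q) (\<lambda>p. act (X i p) f) -
        (1 / 2 * (\<Sum>j=1..m. mat_trace (the (mat_inverse (popp_matrix k \<kappa> b j q)) *
                       mat_derivative (X i q) (popp_matrix k \<kappa> b j) q)) +
         (\<Sum>l=1..n. c i l l q)) * act (X i q) f))"
proof (intro allI impI ballI)
  fix f q assume f: "smooth_on A U f" and q: "q \<in> U"
  interpret popp_frame_domain A D g n k m \<kappa> \<omega> U X P
    by unfold_locales (use assms q in auto)
  have "mat_trace (the (mat_inverse (popp_matrix k \<kappa> b j q)) * mat_derivative (X i q) (popp_matrix k \<kappa> b j) q)
      = mat_trace (gram_inv j q * mat_derivative (X i q) (gram j) q)" if i: "i \<in> {1..k}" and j: "j \<in> {1..m}" for i j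
  proof -
    have eq: "popp_matrix k \<kappa> b j p = gram j p" if "p \<in> U" for p
      using popp_matrix_gram[OF assms(8) that] j by simp
    have "X i q \<in> tangent_space A q" using frame_tangent[OF q] i k_le_n by auto
    from mat_derivative_local[OF this frame_open q eq] eq[OF q] show ?thesis by (simp add: gram_inv_def)
  qed
  then have "(\<Sum>j=1..m. mat_trace (the (mat_inverse (popp_matrix k \<kappa> b j q)) *
      mat_derivative (X i q) (popp_matrix k \<kappa> b j) q))
      = (\<Sum>j=1..m. mat_trace (gram_inv j q * mat_derivative (X i q) (gram j) q))" if "i \<in> {1..k}" for i
    using that by (intro sum.cong refl) auto
  then show "sub_laplacian A D g n P f q =
      (\<Sum>i=1..k. act (X i q) (\<lambda>p. act (X i p) f) -
        (1 / 2 * (\<Sum>j=1..m. mat_trace (the (mat_inverse (popp_matrix k \<kappa> b j q)) *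
                       mat_derivative (X i q) (popp_matrix k \<kappa> b j) q)) +
         (\<Sum>l=1..n. c i l l q)) * act (X i q) f)"
    unfolding sub_laplacian_frame[OF f q assms(7)] by (intro sum.cong refl) simp
qed

end
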